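(* Let $r\ge 5$, $2\le t\le s$, and $a,b$ integers with $a+b=r$ and $b<a<r-1$. Let $T$ be a tree with bipartition $(U,V)$, $|U|=s$, $|V|=t$, and let $\mathcal T=T(a,b)$ be its $(a,b)$-blowup. Suppose $T$ has a critical leaf, i.e. a vertex $x\in V$ with $\deg_T(x)=1$. Then for all sufficiently large $n$ (depending on $T$, $a$, $b$), \[{\rm ex}_r(n,\mathcal T)\le \binom{n}{r}-\binom{n-t+1}{r}.\] If, in addition, $\tau(\mathcal T)=t$, then equality holds and $\Psi_{t-1}(n,r)$ is (up to isomorphism) the only $n$-vertex $\mathcal T$-free $r$-graph with $\binom{n}{r}-\binom{n-t+1}{r}$ edges.
   Context: An $r$-graph is a family of $r$-element subsets of a finite vertex set; ${\rm ex}_r(n,\mathcal T)$ is the maximum number of edges of an $r$-graph on $n$ vertices containing no copy of $\mathcal T$. For a bipartite graph $T$ with parts $U=\{u_1,\dots,u_s\}$ and $V=\{v_1,\dots,v_t\}$, the $(a,b)$-blowup $T(a,b)$ is the $(a+b)$-graph obtained by taking pairwise disjoint sets $U_1,\dots,U_s,V_1,\dots,V_t$ with $|U_i|=a$, $|V_j|=b$, with edge set $\{U_i\cup V_j: u_iv_j\in E(T)\}$. For a hypergraph $\mathcal H$, $\tau(\mathcal H)$ is the minimum size of a vertex set meeting every edge of $\mathcal H$. $\Psi_{c}(n,r)$ is the $r$-graph on $[n]$ consisting of all $r$-subsets of $[n]$ that meet $[c]=\{1,\dots,c\}$; it has $\binom{n}{r}-\binom{n-c}{r}$ edges. *)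

theory Defs
  imports Complex_Main
begin

definition fin_graph :: "'v set \<Rightarrow> 'v set set \<Rightarrow> bool" where
  "fin_graph X E \<longleftrightarrow> finite X \<and> (\<forall>e\<in>E. e \<subseteq> X \<and> card e = 2)"

definition walk :: "'v set \<Rightarrow> 'v set set \<Rightarrow> 'v list \<Rightarrow> bool" where
  "walk X E p \<longleftrightarrow> p \<noteq> [] \<and> set p \<subseteq> X \<and> (\<forall>i. Suc i < length p \<longrightarrow> {p ! i, p ! Suc i} \<in> E)"

definition connected_graph :: "'v set \<Rightarrow> 'v set set \<Rightarrow> bool" where
  "connected_graph X E \<longleftrightarrow>
     X \<noteq> {} \<and> (\<forall>x\<in>X. \<forall>y\<in>X. \<exists>p. walk X E p \<and> hd p = x \<and> last p = y)"

text \<open>The closing edge of a cycle is implicit: the last vertex is adjacent to the first one.\<close>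

definition is_cycle :: "'v set \<Rightarrow> 'v set set \<Rightarrow> 'v list \<Rightarrow> bool" where
  "is_cycle X E p \<longleftrightarrow> walk X E p \<and> distinct p \<and> 3 \<le> length p \<and> {last p, hd p} \<in> E"

definition is_tree :: "'v set \<Rightarrow> 'v set set \<Rightarrow> bool" where
  "is_tree X E \<longleftrightarrow> fin_graph X E \<and> connected_graph X E \<and> (\<nexists>p. is_cycle X E p)"

definition bipartition :: "'v set \<Rightarrow> 'v set \<Rightarrow> 'v set \<Rightarrow> 'v set set \<Rightarrow> bool" where
  "bipartition U V X E \<longleftrightarrow>
     U \<union> V = X \<and> U \<inter> V = {} \<and> (\<forall>e\<in>E. \<exists>u\<in>U. \<exists>v\<in>V. e = {u, v})"

definition vertex_degree :: "'v set set \<Rightarrow> 'v \<Rightarrow> nat" where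
  "vertex_degree E x = card {e \<in> E. x \<in> e}"

text \<open>A hypergraph is identified with its family of edges; the vertex set is passed separately
  where it matters.\<close>

definition r_graph :: "nat \<Rightarrow> 'a set \<Rightarrow> 'a set set \<Rightarrow> bool" where
  "r_graph r W H \<longleftrightarrow> finite W \<and> (\<forall>e\<in>H. e \<subseteq> W \<and> card e = r)"

text \<open>A copy is a not necessarily induced subhypergraph.  Only the vertices covered by edges of
  \<open>F\<close> are embedded, so \<open>F\<close> is understood to have no isolated vertices; this holds for blowups
  of trees with at least one edge.\<close>

definition contains_copy :: "'a set set \<Rightarrow> 'b set set \<Rightarrow> bool" where
  "contains_copy H F \<longleftrightarrow> (\<exists>f. inj_on f (\<Union>F) \<and> (\<forall>e\<in>F. f ` e \<in> H))"

definition isomorphic_on :: "'a set \<Rightarrow> 'a set set \<Rightarrow> 'b set \<Rightarrow> 'b set set \<Rightarrow> bool" where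
  "isomorphic_on W H W' H' \<longleftrightarrow> (\<exists>f. bij_betw f W W' \<and> (\<lambda>e. f ` e) ` H = H')"

text \<open>The maximum is over a finite set, which contains \<open>0\<close> as soon as \<open>F\<close> has an edge.\<close>

definition ex_turan :: "nat \<Rightarrow> nat \<Rightarrow> 'b set set \<Rightarrow> nat" where
  "ex_turan r n F = Max {card H | H. r_graph r {1..n} H \<and> \<not> contains_copy H F}"

definition cover_number :: "'a set set \<Rightarrow> nat" where
  "cover_number H =
     (LEAST k. \<exists>C. finite C \<and> C \<subseteq> \<Union>H \<and> card C = k \<and> (\<forall>e\<in>H. C \<inter> e \<noteq> {}))"

text \<open>The vertex \<open>(x, i)\<close> is the \<open>i\<close>-th point of the set replacing \<open>x\<close>; these sets are pairwise
  disjoint when \<open>U\<close> and \<open>V\<close> are.\<close>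

definition blowup :: "'v set \<Rightarrow> 'v set \<Rightarrow> 'v set set \<Rightarrow> nat \<Rightarrow> nat \<Rightarrow> ('v \<times> nat) set set" where
  "blowup U V E a b =
     {({u} \<times> {..<a}) \<union> ({v} \<times> {..<b}) | u v. u \<in> U \<and> v \<in> V \<and> {u, v} \<in> E}"

definition Psi :: "nat \<Rightarrow> nat \<Rightarrow> nat \<Rightarrow> nat set set" where
  "Psi c n r = {e. e \<subseteq> {1..n} \<and> card e = r \<and> e \<inter> {1..c} \<noteq> {}}"

end

theory Submission
  imports Defs "HOL-Library.Ramsey" "HOL-Library.Disjoint_Sets"
begin

text \<open>Let \<open>k = r - 1\<close> and let \<open>H\<close> be free of the blowup.

  Embedding.  Suppose every edge of a subfamily of \<open>H\<close> is split into an \<open>a\<close>-set and a \<open>b\<close>-set so that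
  each of these parts can be completed inside the subfamily while avoiding any bounded set of vertices.
  Then the tree can be embedded greedily, one vertex at a time.  So in a family without a copy of the
  blowup every chosen splitting \<open>e = A \<union> B\<close> meets a bounded set \<open>W\<close> depending on one part only:
  \<open>B \<inter> W A \<noteq> {}\<close> or \<open>A \<inter> W B \<noteq> {}\<close>.

  Centres.  Call a \<open>k\<close>-set heavy if its degree is at least \<open>\<tau> n\<close>.  Choosing the splittings well, this
  covering property shows that all but few edges \<open>e\<close> have exactly one vertex \<open>c\<close> with \<open>e - {c}\<close> not
  heavy.  A Kruskal--Katona type estimate in the links then shows that \<open>c\<close> has degree of order \<open>n^k\<close> for all
  but few edges.  Hence almost all edges meet a set \<open>W\<close> of boundedly many vertices.

  Stability.  For a \<open>k\<close>-set \<open>D\<close> put \<open>N D = {w \<in> W. D \<union> {w} \<in> H}\<close>.  The embedding argument, with the vertices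
  of \<open>V\<close> now carrying distinct vertices of \<open>W\<close>, shows that \<open>N D\<close> almost always has at most \<open>t - 1\<close>
  elements.  If \<open>H\<close> has as many edges as the extremal construction, \<open>N D\<close> almost always has exactly
  \<open>t - 1\<close> elements and agrees on \<open>k\<close>-sets sharing \<open>a\<close> vertices, so it is almost everywhere a constant \<open>L\<close>.

  Exactness.  If an edge \<open>e\<close> avoids \<open>L\<close>, then each \<open>a\<close>-subset \<open>A\<close> of \<open>e\<close> lies in many missing edges:
  otherwise \<open>A\<close> and \<open>e - A\<close> could serve as the blown-up critical edge, the other vertices of \<open>V\<close> using \<open>L\<close>.
  By the Kruskal--Katona type estimate again, there are fewer edges avoiding \<open>L\<close> than missing edges
  that meet \<open>L\<close>, unless there are none of either kind.\<close>

section \<open>Counting subsets and incidences\<close>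

lemma card_nsets_le: "finite X \<Longrightarrow> card (nsets X k) \<le> card X ^ k"
  by (cases "k \<le> card X") (simp_all add: card_nsets binomial_le_pow binomial_eq_0)

lemma real_card_nsets_le:
  assumes "finite X" "card X \<le> n" shows "real (card (nsets X k)) \<le> real n ^ k"
proof -
  have "card (nsets X k) \<le> n ^ k"
    using card_nsets_le[OF assms(1), of k] power_mono[OF assms(2), of k] by linarith
  then show ?thesis by (metis of_nat_le_iff of_nat_power)
qed

lemma card_cover_le:
  fixes c :: real
  assumes "finite I" "S \<subseteq> (\<Union>i\<in>I. T i)" "\<And>i. i \<in> I \<Longrightarrow> finite (T i)"
    "\<And>i. i \<in> I \<Longrightarrow> real (card (T i)) \<le> c"
  shows "real (card S) \<le> real (card I) * c"
proof -
  have "card S \<le> card (\<Union>i\<in>I. T i)"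
    using assms by (intro card_mono) auto
  also have "\<dots> \<le> (\<Sum>i\<in>I. card (T i))" by (rule card_UN_le[OF assms(1)])
  finally have "real (card S) \<le> (\<Sum>i\<in>I. real (card (T i)))"
    by (simp only: of_nat_sum[symmetric] of_nat_le_iff)
  also have "\<dots> \<le> real (card I) * c"
    using assms(4) by (rule sum_bounded_above)
  finally show ?thesis .
qed

lemma sum_card_swap:
  assumes "finite I" "finite J"
  shows "(\<Sum>i\<in>I. card {j\<in>J. R i j}) = (\<Sum>j\<in>J. card {i\<in>I. R i j})"
  using sum_multicount_gen[of I J R "\<lambda>j. card {i\<in>I. R i j}"] assms by simp

lemma double_count_le:
  fixes k l :: real
  assumes "finite I" "finite J"
    and "\<And>i. i \<in> I \<Longrightarrow> k \<le> real (card {j\<in>J. R i j})"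
    and "\<And>j. j \<in> J \<Longrightarrow> real (card {i\<in>I. R i j}) \<le> l"
  shows "k * real (card I) \<le> l * real (card J)"
proof -
  have "k * real (card I) = (\<Sum>i\<in>I. k)" by simp
  also have "\<dots> \<le> (\<Sum>i\<in>I. real (card {j\<in>J. R i j}))"
    using assms(3) by (rule sum_mono)
  also have "\<dots> = real (\<Sum>i\<in>I. card {j\<in>J. R i j})" by simp
  also have "\<dots> = real (\<Sum>j\<in>J. card {i\<in>I. R i j})" using sum_card_swap[OF assms(1,2)] by metis
  also have "\<dots> = (\<Sum>j\<in>J. real (card {i\<in>I. R i j}))" by simp
  also have "\<dots> \<le> (\<Sum>j\<in>J. l)" using assms(4) by (rule sum_mono)
  finally show ?thesis by (simp add: mult.commute)
qed

section \<open>Links of vertices and a weak Kruskal--Katona estimate\<close>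

lemma insert_in_nsets:
  assumes "S \<in> nsets (X - {v}) k" "v \<in> X" shows "insert v S \<in> nsets X (Suc k)"
proof -
  have "v \<notin> S" "finite S" "card S = k" using assms by (auto simp: nsets_def)
  then show ?thesis using assms by (auto simp: nsets_def)
qed

text \<open>Adding \<open>x\<close> maps the link of \<open>x\<close> bijectively onto the members
  of \<open>\<B>\<close> through \<open>x\<close>. The sum therefore counts incidences, and each
  member has \<open>Suc a\<close> vertices.\<close>

lemma sum_link_card:
  assumes "finite X" "\<B> \<subseteq> nsets X (Suc a)"
  shows "(\<Sum>x\<in>X. card {S \<in> nsets X a. x \<notin> S \<and> insert x S \<in> \<B>}) = Suc a * card \<B>"
proof -
  have fB: "finite \<B>" using assms finite_imp_finite_nsets finite_subset by blast
  have "card {S \<in> nsets X a. x \<notin> S \<and> insert x S \<in> \<B>} = card {B\<in>\<B>. x \<in> B}" if "x \<in> X" for x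
  proof (rule bij_betw_same_card[of "insert x"], rule bij_betw_byWitness[where f' = "\<lambda>B. B - {x}"])
    show "(\<lambda>B. B - {x}) ` {B \<in> \<B>. x \<in> B} \<subseteq> {S \<in> nsets X a. x \<notin> S \<and> insert x S \<in> \<B>}"
      using assms(2) by (auto simp: nsets_def insert_absorb)
  qed auto
  then have "(\<Sum>x\<in>X. card {S \<in> nsets X a. x \<notin> S \<and> insert x S \<in> \<B>}) = (\<Sum>x\<in>X. card {B\<in>\<B>. x \<in> B})"
    by simp
  also have "\<dots> = (\<Sum>B\<in>\<B>. card {x\<in>X. x \<in> B})" by (rule sum_card_swap[OF assms(1) fB])
  also have "\<dots> = (\<Sum>B\<in>\<B>. Suc a)"
  proof (rule sum.cong)
    fix B assume "B \<in> \<B>"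
    then have "{x\<in>X. x \<in> B} = B" "card B = Suc a" using assms(2) by (auto simp: nsets_def)
    then show "card {x\<in>X. x \<in> B} = Suc a" by simp
  qed simp
  finally show ?thesis by simp
qed

text \<open>A weak form of the Kruskal--Katona theorem.  A set counted here either has a vertex whose link
  is small, where the induction hypothesis applies, or consists of the few vertices with large link.\<close>

lemma few_full_sets:
  fixes \<epsilon> :: real
  assumes "0 < \<epsilon>"
  shows "\<exists>\<delta>>0. \<forall>(X::'a set) \<B>. finite X \<longrightarrow> \<B> \<subseteq> nsets X a \<longrightarrow> real (card \<B>) \<le> \<delta> * real (card X) ^ a \<longrightarrow>
     real (card {D \<in> nsets X (Suc a). nsets D a \<subseteq> \<B>}) \<le> \<epsilon> * real (card \<B>) * real (card X)"
  using assms
proof (induction a arbitrary: \<epsilon>)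
  case 0
  show ?case
  proof (rule exI[of _ "1/2"], intro conjI allI impI)
    fix X :: "'a set" and \<B>
    assume "finite X" "\<B> \<subseteq> nsets X 0" and c: "real (card \<B>) \<le> 1/2 * real (card X) ^ 0"
    then have "\<B> = {}" by (auto simp: subset_singleton_iff)
    then show "real (card {D \<in> nsets X (Suc 0). nsets D 0 \<subseteq> \<B>}) \<le> \<epsilon> * real (card \<B>) * real (card X)"
      by simp
  qed simp
next
  case (Suc a)
  \<comment> \<open>The link sizes sum to \<open>(a + 1) * card \<B>\<close>, so the induction
    hypothesis with \<open>e1\<close> costs half of \<open>\<epsilon>\<close> after summation over
    the vertices.\<close>
  define e1 where "e1 = \<epsilon> / (2 * (real a + 1))"
  have e1: "0 < e1" using Suc.prems by (simp add: e1_def)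
  obtain d1 where d1: "d1 > 0" and
    IH: "\<And>(X::'a set) \<B>. finite X \<Longrightarrow> \<B> \<subseteq> nsets X a \<Longrightarrow> real (card \<B>) \<le> d1 * real (card X) ^ a \<Longrightarrow>
     real (card {D \<in> nsets X (Suc a). nsets D a \<subseteq> \<B>}) \<le> e1 * real (card \<B>) * real (card X)"
    using Suc.IH[OF e1] by blast
  \<comment> \<open>With this bound on \<open>card \<B>\<close>, at most
    \<open>\<epsilon> / 2 * card X\<close> vertices have a link above the threshold
    \<open>d1 * card X ^ a\<close> of the induction hypothesis.\<close>
  define d where "d = \<epsilon> * d1 / (2 * (real a + 1))"
  show ?case
  proof (rule exI[of _ d], intro conjI allI impI)
    show "0 < d" using d1 Suc.prems by (simp add: d_def)
    fix X :: "'a set" and \<B>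
    assume X: "finite X" and B: "\<B> \<subseteq> nsets X (Suc a)"
      and c: "real (card \<B>) \<le> d * real (card X) ^ Suc a"
    let ?n = "real (card X)"
    define L where "L x = {S \<in> nsets X a. x \<notin> S \<and> insert x S \<in> \<B>}" for x
    have fB: "finite \<B>" using B X finite_imp_finite_nsets finite_subset by blast
    have sumL: "(\<Sum>x\<in>X. real (card (L x))) = (real a + 1) * real (card \<B>)"
      using sum_link_card[OF X B] unfolding L_def by (simp flip: of_nat_sum add: algebra_simps)
    define Hi where "Hi = {x\<in>X. real (card (L x)) > d1 * ?n ^ a}"
    let ?Full = "{D \<in> nsets X (Suc (Suc a)). nsets D (Suc a) \<subseteq> \<B>}"
    have fHi: "finite Hi" using X by (simp add: Hi_def)
    have hi: "real (card Hi) \<le> \<epsilon> / 2 * ?n"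
    proof (cases "card X = 0")
      case True then show ?thesis using X by (simp add: Hi_def)
    next
      case False
      have "real (card Hi) * (d1 * ?n ^ a) \<le> (\<Sum>x\<in>Hi. real (card (L x)))"
        using sum_bounded_below[of Hi "d1 * ?n ^ a" "\<lambda>x. real (card (L x))"] by (simp add: Hi_def)
      also have "\<dots> \<le> (\<Sum>x\<in>X. real (card (L x)))"
        using X by (intro sum_mono2) (auto simp: Hi_def)
      also have "\<dots> = (real a + 1) * real (card \<B>)" by (rule sumL)
      also have "\<dots> \<le> (real a + 1) * (d * ?n ^ Suc a)" using c by (intro mult_left_mono) auto
      also have "\<dots> = (\<epsilon> / 2 * ?n) * (d1 * ?n ^ a)" by (simp add: d_def field_simps)
      finally show ?thesis using d1 False by (simp add: mult_le_cancel_right)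
    qed
    define Lo where "Lo = (\<Union>x\<in>X - Hi. insert x ` {D \<in> nsets X (Suc a). nsets D a \<subseteq> L x})"
    \<comment> \<open>\<open>Up\<close> contains the full sets inside \<open>Hi\<close>: removing a
      vertex from such a set leaves a member of \<open>\<B>\<close>, so there are at most
      \<open>card Hi * card \<B>\<close> of them.\<close>
    define Up where "Up = (\<Union>x\<in>Hi. insert x ` \<B>)"
    have "?Full \<subseteq> Lo \<union> Up"
    proof
      fix D assume D: "D \<in> ?Full"
      then have D': "D \<subseteq> X" "finite D" "card D = Suc (Suc a)" by (auto simp: nsets_def)
      show "D \<in> Lo \<union> Up"
      proof (cases "D \<subseteq> Hi")
        case True
        obtain x where x: "x \<in> D" using D' by fastforce
        then have "D - {x} \<in> nsets D (Suc a)" using D' by (auto simp: nsets_def)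
        then have "D - {x} \<in> \<B>" using D by auto
        then have "D \<in> Up" using x True unfolding Up_def by (intro UN_I[of x]) (auto intro!: image_eqI[of _ _ "D - {x}"])
        then show ?thesis ..
      next
        case False
        then obtain x where x: "x \<in> D" "x \<notin> Hi" by auto
        have "nsets (D - {x}) a \<subseteq> L x"
        proof
          fix S assume S: "S \<in> nsets (D - {x}) a"
          then have "x \<notin> S" by (auto simp: nsets_def)
          then have "insert x S \<in> nsets D (Suc a)" "x \<notin> S" using x S by (auto simp: nsets_def)
          then show "S \<in> L x" using D S D' unfolding L_def by (auto simp: nsets_def)
        qed
        then have "D - {x} \<in> {D \<in> nsets X (Suc a). nsets D a \<subseteq> L x}" using D' x by (auto simp: nsets_def)
        then have "D \<in> Lo" using x D' unfolding Lo_def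
          by (intro UN_I[of x]) (auto intro!: image_eqI[of _ _ "D - {x}"])
        then show ?thesis ..
      qed
    qed
    moreover have fin: "finite Lo" "finite Up" using X fHi fB by (auto simp: Lo_def Up_def finite_imp_finite_nsets)
    ultimately have "card ?Full \<le> card Lo + card Up"
      by (meson card_Un_le card_mono finite_UnI le_trans)
    moreover have "real (card Lo) \<le> \<epsilon> / 2 * real (card \<B>) * ?n"
    proof -
      have "card Lo \<le> (\<Sum>x\<in>X - Hi. card (insert x ` {D \<in> nsets X (Suc a). nsets D a \<subseteq> L x}))"
        unfolding Lo_def using X by (intro card_UN_le) simp
      also have "\<dots> \<le> (\<Sum>x\<in>X - Hi. card {D \<in> nsets X (Suc a). nsets D a \<subseteq> L x})"
        using X by (intro sum_mono card_image_le) (auto simp: finite_imp_finite_nsets)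
      finally have "real (card Lo) \<le> (\<Sum>x\<in>X - Hi. real (card {D \<in> nsets X (Suc a). nsets D a \<subseteq> L x}))"
        by (simp only: of_nat_sum[symmetric] of_nat_le_iff)
      also have "\<dots> \<le> (\<Sum>x\<in>X - Hi. e1 * real (card (L x)) * ?n)"
      proof (intro sum_mono IH[OF X])
        fix x assume "x \<in> X - Hi"
        then show "L x \<subseteq> nsets X a" "real (card (L x)) \<le> d1 * ?n ^ a" by (auto simp: L_def Hi_def)
      qed
      also have "\<dots> \<le> (\<Sum>x\<in>X. e1 * real (card (L x)) * ?n)"
        using X e1 by (intro sum_mono2) auto
      also have "\<dots> = e1 * ?n * (\<Sum>x\<in>X. real (card (L x)))" by (simp add: sum_distrib_left mult_ac)
      also have "\<dots> = \<epsilon> / 2 * real (card \<B>) * ?n" unfolding sumL e1_def by (simp add: field_simps)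
      finally show ?thesis .
    qed
    moreover have "real (card Up) \<le> \<epsilon> / 2 * real (card \<B>) * ?n"
    proof -
      have "real (card Up) \<le> real (card Hi) * real (card \<B>)"
        unfolding Up_def by (rule card_cover_le[OF fHi subset_refl]) (auto simp: fB card_image_le)
      also have "\<dots> \<le> \<epsilon> / 2 * ?n * real (card \<B>)" using hi by (intro mult_right_mono) auto
      finally show ?thesis by (simp add: mult_ac)
    qed
    ultimately show "real (card ?Full) \<le> \<epsilon> * real (card \<B>) * ?n" by linarith
  qed
qed

section \<open>Sets meeting or extending given sets, and nearly constant functions\<close>

lemma card_nsets_containing_le:
  assumes "finite X" shows "card {D \<in> nsets X (Suc k). v \<in> D} \<le> card X ^ k"
proof -
  have "{D \<in> nsets X (Suc k). v \<in> D} \<subseteq> insert v ` nsets X k"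
  proof
    fix D assume "D \<in> {D \<in> nsets X (Suc k). v \<in> D}"
    then have "D = insert v (D - {v})" "D - {v} \<in> nsets X k" by (auto simp: nsets_def)
    then show "D \<in> insert v ` nsets X k" by blast
  qed
  then have "card {D \<in> nsets X (Suc k). v \<in> D} \<le> card (insert v ` nsets X k)"
    using assms by (intro card_mono) (auto simp: finite_imp_finite_nsets)
  also have "\<dots> \<le> card (nsets X k)" using assms by (intro card_image_le finite_imp_finite_nsets)
  also have "\<dots> \<le> card X ^ k" by (rule card_nsets_le[OF assms])
  finally show ?thesis .
qed

lemma card_nsets_meeting_le:
  assumes Y: "finite Y" "card Y \<le> n" and W: "finite W" "card W \<le> m"
  shows "real (card {F \<in> nsets Y (Suc k). F \<inter> W \<noteq> {}}) \<le> real m * real n ^ k"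
proof -
  have "real (card {F \<in> nsets Y (Suc k). F \<inter> W \<noteq> {}}) \<le> real (card W) * real n ^ k"
  proof (rule card_cover_le[OF W(1)])
    show "{F \<in> nsets Y (Suc k). F \<inter> W \<noteq> {}} \<subseteq> (\<Union>w\<in>W. {F \<in> nsets Y (Suc k). w \<in> F})" by auto
    show "finite {F \<in> nsets Y (Suc k). w \<in> F}" for w using Y by (simp add: finite_imp_finite_nsets)
    show "real (card {F \<in> nsets Y (Suc k). w \<in> F}) \<le> real n ^ k" for w
    proof -
      have "card {F \<in> nsets Y (Suc k). w \<in> F} \<le> n ^ k"
        using card_nsets_containing_le[OF Y(1), of k w] power_mono[OF Y(2), of k] by linarith
      then show ?thesis by (metis of_nat_le_iff of_nat_power)
    qed
  qed
  also have "\<dots> \<le> real m * real n ^ k" using W by (intro mult_right_mono) auto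
  finally show ?thesis .
qed

lemma card_nsets_meeting:
  assumes "finite X" "L \<subseteq> X"
  shows "card {e \<in> nsets X r. e \<inter> L \<noteq> {}} = (card X choose r) - ((card X - card L) choose r)"
proof -
  have fL: "finite L" using assms finite_subset by blast
  have "{e \<in> nsets X r. e \<inter> L \<noteq> {}} = nsets X r - nsets (X - L) r" by (auto simp: nsets_def)
  moreover have "nsets (X - L) r \<subseteq> nsets X r" by (auto simp: nsets_def)
  ultimately have "card {e \<in> nsets X r. e \<inter> L \<noteq> {}} = card (nsets X r) - card (nsets (X - L) r)"
    using assms(1) by (simp only:) (rule card_Diff_subset, auto simp: finite_imp_finite_nsets)
  then show ?thesis using fL assms by (simp add: card_Diff_subset)
qed

text \<open>Pairs \<open>A \<subseteq> D\<close> with \<open>A\<close> in \<open>\<I>\<close> and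
  \<open>D\<close> in \<open>\<J>\<close> are counted. Different completions \<open>B\<close> of
  \<open>A\<close> give different \<open>D\<close>, and each \<open>D\<close> has at most
  \<open>2 ^ (p + q)\<close> subsets. This turns a small number of missing sets into a small number
  of bad parts.\<close>

lemma card_sets_extending_to:
  fixes \<J> :: "'a set set"
  assumes Y: "finite Y" and J: "\<J> \<subseteq> nsets Y (p + q)" and "0 \<le> c"
    and I: "\<I> \<subseteq> nsets Y p" "\<And>A. A \<in> \<I> \<Longrightarrow> c \<le> real (card {B \<in> nsets Y q. A \<inter> B = {} \<and> A \<union> B \<in> \<J>})"
  shows "c * real (card \<I>) \<le> 2 ^ (p + q) * real (card \<J>)"
proof (rule double_count_le[where R = "\<lambda>A D. A \<subseteq> D"])
  show fI: "finite \<I>" and fJ: "finite \<J>"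
    using Y I(1) J finite_imp_finite_nsets finite_subset by blast+
  show "c \<le> real (card {D \<in> \<J>. A \<subseteq> D})" if A: "A \<in> \<I>" for A
  proof -
    have "card {B \<in> nsets Y q. A \<inter> B = {} \<and> A \<union> B \<in> \<J>} \<le> card {D \<in> \<J>. A \<subseteq> D}"
    proof (rule card_inj_on_le[where f = "\<lambda>B. A \<union> B"])
      show "inj_on (\<lambda>B. A \<union> B) {B \<in> nsets Y q. A \<inter> B = {} \<and> A \<union> B \<in> \<J>}"
        by (rule inj_onI) blast
    qed (use fJ in auto)
    then show ?thesis using I(2)[OF A] by linarith
  qed
  show "real (card {A \<in> \<I>. A \<subseteq> D}) \<le> 2 ^ (p + q)" if D: "D \<in> \<J>" for D
  proof -
    have d: "finite D" "card D = p + q" using D J by (auto simp: nsets_def)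
    have "card {A \<in> \<I>. A \<subseteq> D} \<le> card (Pow D)" using d by (intro card_mono) auto
    also have "\<dots> = 2 ^ (p + q)" using d by (simp add: card_Pow)
    finally show ?thesis by (metis of_nat_le_iff of_nat_numeral of_nat_power)
  qed
qed

text \<open>The induction passes to the link of a vertex \<open>v\<close> in which \<open>Z\<close> is sparse: for almost every set \<open>S\<close> of
  size \<open>k\<close> the value at \<open>insert v S\<close> is the common one, and every \<open>D \<supseteq> S\<close> is adjacent to \<open>insert v S\<close>.\<close>

lemma nearly_constant:
  fixes \<epsilon> :: real
  assumes "0 < \<epsilon>"
  shows "\<exists>\<delta>>0. \<exists>n0. \<forall>(X::'a set) Z (g :: 'a set \<Rightarrow> 'c). finite X \<longrightarrow> n0 \<le> card X \<longrightarrow> Z \<subseteq> nsets X k \<longrightarrow>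
     real (card Z) \<le> \<delta> * real (card X) ^ k \<longrightarrow>
     (\<forall>D\<in>nsets X k - Z. \<forall>D'\<in>nsets X k - Z. k \<le> Suc (card (D \<inter> D')) \<longrightarrow> g D = g D') \<longrightarrow>
     (\<exists>c. real (card {D \<in> nsets X k. D \<in> Z \<or> g D \<noteq> c}) \<le> \<epsilon> * real (card X) ^ k)"
  using assms
proof (induction k arbitrary: \<epsilon>)
  case 0
  show ?case
  proof (rule exI[of _ "1/2"], intro conjI exI[of _ 0] allI impI)
    fix X :: "'a set" and Z and g :: "'a set \<Rightarrow> 'c"
    assume "finite X" "Z \<subseteq> nsets X 0" "real (card Z) \<le> 1/2 * real (card X) ^ 0"
    then have "Z = {}" by (auto simp: subset_singleton_iff)
    then have *: "{D \<in> nsets X 0. D \<in> Z \<or> g D \<noteq> g {}} = {}" by auto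
    show "\<exists>c. real (card {D \<in> nsets X 0. D \<in> Z \<or> g D \<noteq> c}) \<le> \<epsilon> * real (card X) ^ 0"
      using 0 by (intro exI[of _ "g {}"]) (simp only: * card.empty, simp)
  qed simp
next
  case (Suc k)
  define e1 where "e1 = \<epsilon> / 3"
  have e1: "0 < e1" using Suc.prems by (simp add: e1_def)
  obtain d1 n1 where d1: "d1 > 0" and
    IH: "\<And>(X::'a set) Z (g :: 'a set \<Rightarrow> 'c). finite X \<Longrightarrow> n1 \<le> card X \<Longrightarrow> Z \<subseteq> nsets X k \<Longrightarrow>
     real (card Z) \<le> d1 * real (card X) ^ k \<Longrightarrow>
     (\<forall>D\<in>nsets X k - Z. \<forall>D'\<in>nsets X k - Z. k \<le> Suc (card (D \<inter> D')) \<longrightarrow> g D = g D') \<Longrightarrow>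
     (\<exists>c. real (card {D \<in> nsets X k. D \<in> Z \<or> g D \<noteq> c}) \<le> e1 * real (card X) ^ k)"
    using Suc.IH[OF e1] by blast
  \<comment> \<open>The first bound pays for \<open>Z\<close> itself. The second makes the link of
    \<open>v\<close> sparse enough for the induction hypothesis on \<open>X - {v}\<close>; the
    factor \<open>2 ^ k\<close> absorbs the passage from \<open>card X\<close> to
    \<open>card X - 1\<close>.\<close>
  define d where "d = min (\<epsilon> / 3) (d1 / ((real k + 1) * 2 ^ k))"
  have d: "0 < d" using d1 Suc.prems by (simp add: d_def)
  \<comment> \<open>\<open>Suc n1\<close> leaves \<open>n1\<close> vertices after \<open>v\<close>
    is removed, and \<open>3 / \<epsilon>\<close> makes the sets through \<open>v\<close>
    negligible.\<close>
  define n0 where "n0 = max (Suc n1) (max 2 (nat \<lceil>3 / \<epsilon>\<rceil>))"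
  show ?case
  proof (rule exI[of _ d], intro conjI exI[of _ n0] allI impI)
    show "0 < d" by (rule d)
    fix X :: "'a set" and Z and g :: "'a set \<Rightarrow> 'c"
    assume X: "finite X" and n0: "n0 \<le> card X" and Z: "Z \<subseteq> nsets X (Suc k)"
      and cZ: "real (card Z) \<le> d * real (card X) ^ Suc k"
      and g: "\<forall>D\<in>nsets X (Suc k) - Z. \<forall>D'\<in>nsets X (Suc k) - Z. Suc k \<le> Suc (card (D \<inter> D')) \<longrightarrow> g D = g D'"
    let ?n = "real (card X)"
    have n: "card X \<ge> 2" "card X \<ge> Suc n1" using n0 by (auto simp: n0_def)
    have n3: "?n \<ge> 3 / \<epsilon>" using n0 unfolding n0_def by linarith
    have fZ: "finite Z" using Z X finite_imp_finite_nsets finite_subset by blast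
    define L where "L x = {S \<in> nsets X k. x \<notin> S \<and> insert x S \<in> Z}" for x
    \<comment> \<open>Averaging the link sizes over all vertices gives such a
      \<open>v\<close>.\<close>
    obtain v where v: "v \<in> X" "real (card (L v)) \<le> (real k + 1) * d * ?n ^ k"
    proof (rule ccontr)
      assume "\<not> thesis"
      then have "\<And>v. v \<in> X \<Longrightarrow> (real k + 1) * d * ?n ^ k < real (card (L v))"
        using that by force
      moreover have "X \<noteq> {}" using n by auto
      ultimately have "(\<Sum>x\<in>X. (real k + 1) * d * ?n ^ k) < (\<Sum>x\<in>X. real (card (L x)))"
        using X by (intro sum_strict_mono) auto
      also have "\<dots> = (real k + 1) * real (card Z)"
        using sum_link_card[OF X Z] unfolding L_def by (simp flip: of_nat_sum add: algebra_simps)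
      also have "\<dots> \<le> (real k + 1) * (d * ?n ^ Suc k)" using cZ by (intro mult_left_mono) auto
      finally show False by (simp add: algebra_simps)
    qed
    let ?Y = "X - {v}" and ?Lv = "{S \<in> nsets (X - {v}) k. insert v S \<in> Z}"
    have Lv: "?Lv = L v" using v by (auto simp: L_def nsets_def)
    have cY: "card ?Y = card X - 1" using v X by simp
    have "?n \<le> 2 * real (card ?Y)" using cY n by auto
    then have "?n ^ k \<le> 2 ^ k * real (card ?Y) ^ k"
      by (metis of_nat_0_le_iff power_mono power_mult_distrib)
    moreover have "(real k + 1) * d * 2 ^ k \<le> d1"
    proof -
      have "d \<le> d1 / ((real k + 1) * 2 ^ k)" by (simp add: d_def)
      then have "d * ((real k + 1) * 2 ^ k) \<le> d1"
        by (subst (asm) pos_le_divide_eq) auto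
      then show ?thesis by (simp add: mult_ac)
    qed
    ultimately have "(real k + 1) * d * ?n ^ k \<le> d1 * real (card ?Y) ^ k"
    proof -
      assume a: "?n ^ k \<le> 2 ^ k * real (card ?Y) ^ k" and b: "(real k + 1) * d * 2 ^ k \<le> d1"
      have "(real k + 1) * d * ?n ^ k \<le> (real k + 1) * d * (2 ^ k * real (card ?Y) ^ k)"
        using a d by (intro mult_left_mono) auto
      also have "\<dots> = ((real k + 1) * d * 2 ^ k) * real (card ?Y) ^ k" by simp
      also have "\<dots> \<le> d1 * real (card ?Y) ^ k" using b by (intro mult_right_mono) auto
      finally show ?thesis .
    qed
    then have cLv: "real (card ?Lv) \<le> d1 * real (card ?Y) ^ k" using v Lv by simp
    have "\<exists>c. real (card {D \<in> nsets ?Y k. D \<in> ?Lv \<or> g (insert v D) \<noteq> c}) \<le> e1 * real (card ?Y) ^ k"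
    proof (rule IH)
      show "finite ?Y" "n1 \<le> card ?Y" "?Lv \<subseteq> nsets ?Y k" using X cY n by auto
      show "real (card ?Lv) \<le> d1 * real (card ?Y) ^ k" by (rule cLv)
      show "\<forall>D\<in>nsets ?Y k - ?Lv. \<forall>D'\<in>nsets ?Y k - ?Lv. k \<le> Suc (card (D \<inter> D')) \<longrightarrow> g (insert v D) = g (insert v D')"
      proof (intro ballI impI)
        fix D D' assume D: "D \<in> nsets ?Y k - ?Lv" "D' \<in> nsets ?Y k - ?Lv" "k \<le> Suc (card (D \<inter> D'))"
        have "insert v D \<inter> insert v D' = insert v (D \<inter> D')" "v \<notin> D \<inter> D'" "finite (D \<inter> D')"
          using D by (auto simp: nsets_def)
        then have "card (insert v D \<inter> insert v D') = Suc (card (D \<inter> D'))" by simp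
        moreover have "insert v D \<in> nsets X (Suc k) - Z" "insert v D' \<in> nsets X (Suc k) - Z"
          using D v insert_in_nsets by auto
        ultimately show "g (insert v D) = g (insert v D')" using g D(3) by simp
      qed
    qed
    then obtain c where c: "real (card {D \<in> nsets ?Y k. D \<in> ?Lv \<or> g (insert v D) \<noteq> c}) \<le> e1 * real (card ?Y) ^ k"
      by blast
    define Ex where "Ex = {D \<in> nsets ?Y k. D \<in> ?Lv \<or> g (insert v D) \<noteq> c}"
    have fEx: "finite Ex" using X by (simp add: Ex_def finite_imp_finite_nsets)
    have cEx: "real (card Ex) \<le> e1 * ?n ^ k"
    proof -
      have "real (card ?Y) ^ k \<le> ?n ^ k" using cY by (intro power_mono) auto
      then show ?thesis using c e1 unfolding Ex_def by (meson less_imp_le mult_left_mono order_trans)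
    qed
    let ?S = "{D \<in> nsets X (Suc k). D \<in> Z \<or> g D \<noteq> c}"
    define P where "P = (\<Union>x\<in>X. insert x ` Ex)"
    let ?Q = "{D \<in> nsets X (Suc k). v \<in> D}"
    \<comment> \<open>Let \<open>D\<close> avoid all three sets and take \<open>x\<close> in
      \<open>D\<close>. Then \<open>D\<close> and \<open>insert v (D - {x})\<close> share the
      \<open>k\<close> vertices of \<open>D - {x}\<close>, both lie outside \<open>Z\<close>, and
      the second has value \<open>c\<close>; so \<open>D\<close> has value \<open>c\<close> as
      well.\<close>
    have "?S \<subseteq> Z \<union> ?Q \<union> P"
    proof
      fix D assume D: "D \<in> ?S"
      show "D \<in> Z \<union> ?Q \<union> P"
      proof (rule ccontr)
        assume n: "D \<notin> Z \<union> ?Q \<union> P"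
        then have D': "D \<in> nsets X (Suc k)" "D \<notin> Z" "v \<notin> D" "D \<notin> P" "g D \<noteq> c" using D by auto
        then obtain x where x: "x \<in> D" by (auto simp: nsets_def) (metis card.empty ex_in_conv nat.distinct(1))
        have S: "D - {x} \<in> nsets ?Y k" using D' x by (auto simp: nsets_def)
        have "D - {x} \<notin> Ex"
        proof
          assume "D - {x} \<in> Ex"
          then have "D \<in> P" using x D' unfolding P_def
            by (intro UN_I[of x]) (auto intro!: image_eqI[of _ _ "D - {x}"] simp: nsets_def)
          then show False using D' by simp
        qed
        then have ii: "insert v (D - {x}) \<notin> Z" "g (insert v (D - {x})) = c" using S by (auto simp: Ex_def)
        have "insert v (D - {x}) \<in> nsets X (Suc k)" by (rule insert_in_nsets[OF S v(1)])
        moreover have "D \<inter> insert v (D - {x}) = D - {x}" using D'(3) by blast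
        moreover have "card (D - {x}) = k" using S unfolding nsets_def by blast
        ultimately have "g D = g (insert v (D - {x}))" using g D'(1,2) ii(1) by (metis DiffI order_refl)
        then show False using ii D' by simp
      qed
    qed
    moreover have fin: "finite Z" "finite ?Q" "finite P" using X fEx fZ by (auto simp: P_def finite_imp_finite_nsets)
    ultimately have "card ?S \<le> card (Z \<union> ?Q \<union> P)" by (intro card_mono) auto
    also have "\<dots> \<le> card Z + card ?Q + card P"
      by (meson add_right_mono card_Un_le le_trans)
    finally have "real (card ?S) \<le> real (card Z) + real (card ?Q) + real (card P)" by linarith
    moreover have "real (card Z) \<le> \<epsilon> / 3 * ?n ^ Suc k"
    proof -
      have "d * ?n ^ Suc k \<le> \<epsilon> / 3 * ?n ^ Suc k" by (intro mult_right_mono) (simp_all only: d_def min.cobounded1 zero_le_power of_nat_0_le_iff)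
      then show ?thesis using cZ by linarith
    qed
    moreover have "real (card ?Q) \<le> \<epsilon> / 3 * ?n ^ Suc k"
    proof -
      have "real (card ?Q) \<le> ?n ^ k" using card_nsets_containing_le[OF X, of k v]
        by (metis of_nat_le_iff of_nat_power)
      also have "\<dots> \<le> (\<epsilon> / 3 * ?n) * ?n ^ k"
      proof -
        have "1 \<le> \<epsilon> / 3 * ?n" using n3 Suc.prems by (simp add: field_simps)
        then show ?thesis by (metis mult_1 mult_right_mono of_nat_0_le_iff zero_le_power)
      qed
      finally show ?thesis by simp
    qed
    moreover have "real (card P) \<le> \<epsilon> / 3 * ?n ^ Suc k"
    proof -
      have "real (card P) \<le> ?n * real (card Ex)"
        unfolding P_def by (rule card_cover_le[OF X subset_refl]) (auto simp: fEx card_image_le)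
      also have "\<dots> \<le> ?n * (e1 * ?n ^ k)" using cEx by (intro mult_left_mono) auto
      finally show ?thesis by (simp add: e1_def mult_ac)
    qed
    ultimately show "\<exists>c. real (card {D \<in> nsets X (Suc k). D \<in> Z \<or> g D \<noteq> c}) \<le> \<epsilon> * ?n ^ Suc k"
      by (intro exI[of _ c]) argo
  qed
qed

section \<open>Choice outside a sparse family, and differences of binomials\<close>

text \<open>At least half of \<open>Y\<close> survives the removal of \<open>F\<close>, so at least
  \<open>(card Y / (2 * k)) ^ k\<close> sets of size \<open>k\<close> remain, more than
  \<open>\<B>\<close> can contain.\<close>

lemma nsets_avoiding:
  assumes Y: "finite Y" "1 \<le> k" "2 * card F \<le> card Y" "2 * k \<le> card Y" "finite F"
    and B: "finite \<B>" "real (card \<B>) < (real (card Y) / (2 * real k)) ^ k"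
  shows "\<exists>S\<in>nsets Y k. S \<inter> F = {} \<and> S \<notin> \<B>"
proof -
  have c: "card (Y - F) \<ge> card Y - card F" using assms by (intro diff_card_le_card_Diff) auto
  have ge: "real (card Y) / 2 \<le> real (card (Y - F))" "k \<le> card (Y - F)" using c assms by linarith+
  have "(real (card Y) / (2 * real k)) ^ k \<le> (real (card (Y - F)) / real k) ^ k"
    using ge assms by (intro power_mono) (auto simp: field_simps)
  also have "\<dots> \<le> real (card (Y - F) choose k)"
    using binomial_ge_n_over_k_pow_k[OF ge(2), where 'a=real] by simp
  also have "\<dots> = real (card (nsets (Y - F) k))" using Y by (simp add: card_nsets)
  finally have "card \<B> < card (nsets (Y - F) k)" using B by linarith
  then have "\<not> nsets (Y - F) k \<subseteq> \<B>" using B(1) card_mono by (metis not_less)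
  then obtain S where "S \<in> nsets (Y - F) k" "S \<notin> \<B>" by blast
  then show ?thesis by (intro bexI[of _ S]) (auto simp: nsets_def)
qed

text \<open>The sets are chosen greedily: those already chosen are added to \<open>F\<close>, which
  is why the size condition involves \<open>k * card I\<close>.\<close>

lemma disjoint_nsets_avoiding:
  assumes I: "finite I" and Y: "finite Y" "1 \<le> k" "finite F"
    and big: "2 * (card F + k * card I) \<le> card Y" "2 * k \<le> card Y"
    and B: "finite \<B>" "real (card \<B>) < (real (card Y) / (2 * real k)) ^ k"
  shows "\<exists>f. (\<forall>i\<in>I. f i \<in> nsets Y k \<and> f i \<inter> F = {} \<and> f i \<notin> \<B>) \<and> disjoint_family_on f I"
  using I big(1)
proof (induction I)
  case empty then show ?case by (auto simp: disjoint_family_on_def)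
next
  case (insert i I)
  have "2 * (card F + k * card I) \<le> card Y" using insert.prems insert.hyps by (simp add: algebra_simps)
  then obtain f where f: "\<forall>i\<in>I. f i \<in> nsets Y k \<and> f i \<inter> F = {} \<and> f i \<notin> \<B>" "disjoint_family_on f I"
    using insert.IH by blast
  let ?F = "F \<union> (\<Union>j\<in>I. f j)"
  have "card (\<Union>j\<in>I. f j) \<le> (\<Sum>j\<in>I. card (f j))" by (rule card_UN_le[OF insert.hyps(1)])
  also have "\<dots> = card I * k" using f by (auto simp: nsets_def)
  finally have "card ?F \<le> card F + k * card I"
    using card_Un_le[of F "\<Union>j\<in>I. f j"] by (simp add: mult.commute)
  then have "2 * card ?F \<le> card Y" using insert.prems insert.hyps by (simp add: algebra_simps)
  moreover have "finite ?F" using f insert.hyps Y by (auto simp: nsets_def)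
  ultimately obtain S where S: "S \<in> nsets Y k" "S \<inter> ?F = {}" "S \<notin> \<B>"
    using nsets_avoiding[OF Y(1,2) _ big(2) _ B] by meson
  have "\<forall>j\<in>insert i I. (f(i := S)) j \<in> nsets Y k \<and> (f(i := S)) j \<inter> F = {} \<and> (f(i := S)) j \<notin> \<B>"
    using f S insert.hyps by auto
  moreover have "disjoint_family_on (f(i := S)) (insert i I)"
    unfolding disjoint_family_on_def proof (intro ballI impI)
    fix p q assume pq: "p \<in> insert i I" "q \<in> insert i I" "p \<noteq> q"
    have *: "S \<inter> f j = {}" if "j \<in> I" for j using S that by blast
    show "(f(i := S)) p \<inter> (f(i := S)) q = {}"
    proof (cases "p = i \<or> q = i")
      case True then show ?thesis using pq * by (auto simp: Int_commute)
    next
      case False then show ?thesis using pq f(2) unfolding disjoint_family_on_def by auto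
    qed
  qed
  ultimately show ?case by blast
qed

text \<open>Pascal's rule splits the difference into at most \<open>m\<close> terms
  \<open>p choose k\<close> with \<open>n - m \<le> p < n\<close>, each at most
  \<open>n ^ k\<close>. In \<open>binomial_diff_ge\<close> the same terms are bounded from below by
  \<open>(n - m) choose k\<close>.\<close>

lemma binomial_diff_le: "real (n choose Suc k) - real ((n - m) choose Suc k) \<le> real m * real n ^ k"
proof (induction m)
  case (Suc m)
  have "real ((n - m) choose Suc k) - real ((n - Suc m) choose Suc k) \<le> real n ^ k"
  proof (cases "m < n")
    case True
    then obtain p where p: "n - m = Suc p" "n - Suc m = p" "p \<le> n"
      by (metis Suc_diff_Suc diff_le_self)
    have "p choose k \<le> n ^ k" using p power_mono[of p n k]
      by (cases "k \<le> p") (auto simp: binomial_eq_0 intro: order_trans[OF binomial_le_pow])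
    then have "real (p choose k) \<le> real n ^ k" by (metis of_nat_le_iff of_nat_power)
    then show ?thesis using p by simp
  qed simp
  then show ?case using Suc by (simp add: algebra_simps)
qed simp

lemma binomial_diff_ge:
  assumes "m \<le> n"
  shows "real m * real ((n - m) choose k) \<le> real (n choose Suc k) - real ((n - m) choose Suc k)"
  using assms
proof (induction m)
  case (Suc m)
  define p where "p = n - Suc m"
  have p: "n - m = Suc p" using Suc.prems by (simp add: p_def)
  have le: "p choose k \<le> Suc p choose k" by (rule binomial_right_mono) simp
  have "real m * real (p choose k) \<le> real m * real (Suc p choose k)"
    using le by (intro mult_left_mono) auto
  then show ?case using Suc.IH Suc.prems p unfolding p_def[symmetric] by (simp add: algebra_simps)
qed simp

section \<open>Greedy embedding of trees\<close>

lemma walk_snoc: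
  assumes "walk Y E p" "{last p, v} \<in> E" shows "walk (insert v Y) E (p @ [v])"
proof -
  have p: "p \<noteq> []" "set p \<subseteq> Y" "\<And>i. Suc i < length p \<Longrightarrow> {p ! i, p ! Suc i} \<in> E"
    using assms(1) by (auto simp: walk_def)
  have "{(p @ [v]) ! i, (p @ [v]) ! Suc i} \<in> E" if "Suc i < length (p @ [v])" for i
  proof (cases "Suc i < length p")
    case True then show ?thesis using p(3) by (simp add: nth_append)
  next
    case False
    then have i: "i = length p - 1" "i < length p" using that p(1) by auto
    then have "(p @ [v]) ! i = last p" "(p @ [v]) ! Suc i = v"
      using p(1) by (simp_all add: nth_append last_conv_nth)
    then show ?thesis using assms(2) by simp
  qed
  then show ?thesis using p by (auto simp: walk_def)
qed

lemma walk_Cons: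
  assumes "walk Y E p" "{v, hd p} \<in> E" shows "walk (insert v Y) E (v # p)"
proof -
  have p: "p \<noteq> []" "set p \<subseteq> Y" "\<And>i. Suc i < length p \<Longrightarrow> {p ! i, p ! Suc i} \<in> E"
    using assms(1) by (auto simp: walk_def)
  have "{(v # p) ! i, (v # p) ! Suc i} \<in> E" if "Suc i < length (v # p)" for i
    using that p assms(2) by (cases i) (auto simp: hd_conv_nth)
  then show ?thesis using p by (auto simp: walk_def)
qed

lemma walk_mono: "walk Y E p \<Longrightarrow> Y \<subseteq> Y' \<Longrightarrow> walk Y' E p"
  by (auto simp: walk_def)

text \<open>The first vertex of the walk outside \<open>Y\<close> serves as \<open>y\<close>, and
  its predecessor as \<open>x\<close>.\<close>

lemma walk_crossing:
  assumes "walk X E p" "hd p \<in> Y" "last p \<notin> Y"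
  obtains x y where "x \<in> Y" "y \<in> X - Y" "{x, y} \<in> E"
proof -
  have p: "p \<noteq> []" "set p \<subseteq> X" "\<And>i. Suc i < length p \<Longrightarrow> {p ! i, p ! Suc i} \<in> E"
    using assms(1) by (auto simp: walk_def)
  define i where "i = (LEAST i. i < length p \<and> p ! i \<notin> Y)"
  have "length p - 1 < length p \<and> p ! (length p - 1) \<notin> Y"
    using p(1) assms(3) by (simp add: last_conv_nth)
  then have i: "i < length p" "p ! i \<notin> Y"
    unfolding i_def by (rule LeastI2_wellorder; simp)+
  have "i \<noteq> 0" using assms(2) i(2) p(1) by (metis hd_conv_nth)
  then obtain j where j: "i = Suc j" by (cases i) auto
  have "p ! j \<in> Y" using not_less_Least[of j "\<lambda>i. i < length p \<and> p ! i \<notin> Y"] i j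
    unfolding i_def[symmetric] by auto
  moreover have "p ! i \<in> X" using i p(2) by auto
  ultimately show ?thesis using that[of "p ! j" "p ! i"] i j p(3)[of j] by auto
qed

text \<open>The sets built up from the root are kept connected by paths inside themselves, so that a
  second edge back from the new vertex would close a cycle.\<close>

lemma tree_induct:
  assumes tree: "is_tree X E" and root: "x0 \<in> X" "Q {x0}"
    and step: "\<And>Y v p. Y \<subseteq> X \<Longrightarrow> v \<in> X - Y \<Longrightarrow> p \<in> Y \<Longrightarrow> {p, v} \<in> E \<Longrightarrow>
      (\<And>q. q \<in> Y \<Longrightarrow> {q, v} \<in> E \<Longrightarrow> q = p) \<Longrightarrow> Q Y \<Longrightarrow> Q (insert v Y)"
  shows "Q X"
proof -
  define joined where "joined Y \<longleftrightarrow> (\<forall>y\<in>Y. \<forall>z\<in>Y. \<exists>p. walk Y E p \<and> distinct p \<and> hd p = y \<and> last p = z)" for Y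
  have fX: "finite X" using tree by (simp add: is_tree_def fin_graph_def)
  have conn: "\<exists>p. walk X E p \<and> hd p = x \<and> last p = y" if "x \<in> X" "y \<in> X" for x y
    using tree that by (auto simp: is_tree_def connected_graph_def)
  have acyc: "\<not> is_cycle X E p" for p using tree by (simp add: is_tree_def)
  have "Q X" if "Y \<subseteq> X" "x0 \<in> Y" "joined Y" "Q Y" for Y
    using that
  proof (induction "card (X - Y)" arbitrary: Y)
    case 0
    then have "Y = X" using fX by auto
    then show ?case using 0 by simp
  next
    case (Suc k)
    then obtain z where z: "z \<in> X - Y" by (metis card.empty ex_in_conv nat.distinct(1))
    obtain w where "walk X E w" "hd w = x0" "last w = z" using conn[OF root(1), of z] z by auto
    then obtain p v where pv: "p \<in> Y" "v \<in> X - Y" "{p, v} \<in> E"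
      using walk_crossing[of X E w Y] Suc.prems z by auto
    have uniq: "q = p" if q: "q \<in> Y" "{q, v} \<in> E" for q
    proof (rule ccontr)
      assume ne: "q \<noteq> p"
      obtain w where w: "walk Y E w" "distinct w" "hd w = p" "last w = q"
        using Suc.prems(3) pv(1) q(1) unfolding joined_def by blast
      have wne: "w \<noteq> []" "set w \<subseteq> Y" using w(1) by (auto simp: walk_def)
      \<comment> \<open>Two vertices of \<open>w\<close> and the new vertex \<open>v\<close> make up
        the length 3 that \<open>is_cycle\<close> demands.\<close>
      have "2 \<le> length w" using ne w wne by (cases w; cases "tl w") auto
      moreover have "walk X E (w @ [v])"
        using walk_mono[OF walk_snoc[OF w(1)]] w(4) q(2) Suc.prems(1) pv(2) by simp
      moreover have "distinct (w @ [v])" using w(2) wne pv(2) by auto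
      moreover have "{last (w @ [v]), hd (w @ [v])} \<in> E"
        using w(3) wne pv(3) by (simp add: insert_commute)
      ultimately have "is_cycle X E (w @ [v])" by (simp add: is_cycle_def)
      then show False using acyc by blast
    qed
    have QY: "Q (insert v Y)" using step[OF Suc.prems(1) pv(2,1,3)] uniq Suc.prems(4) by blast
    have J: "joined (insert v Y)"
      unfolding joined_def
    proof (intro ballI)
      fix y z assume yz: "y \<in> insert v Y" "z \<in> insert v Y"
      consider "y = v" "z = v" | "y = v" "z \<in> Y" | "y \<in> Y" "z = v" | "y \<in> Y" "z \<in> Y" using yz by blast
      then show "\<exists>p. walk (insert v Y) E p \<and> distinct p \<and> hd p = y \<and> last p = z"
      proof cases
        case 1 then show ?thesis by (intro exI[of _ "[v]"]) (auto simp: walk_def)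
      next
        case 2
        then obtain w where w: "walk Y E w" "distinct w" "hd w = p" "last w = z"
          using Suc.prems(3) pv(1) unfolding joined_def by blast
        have wne: "w \<noteq> []" "set w \<subseteq> Y" using w(1) by (auto simp: walk_def)
        show ?thesis
          using walk_Cons[OF w(1), of v] w wne pv 2 by (intro exI[of _ "v # w"]) (auto simp: insert_commute)
      next
        case 3
        then obtain w where w: "walk Y E w" "distinct w" "hd w = y" "last w = p"
          using Suc.prems(3) pv(1) unfolding joined_def by blast
        have wne: "w \<noteq> []" "set w \<subseteq> Y" using w(1) by (auto simp: walk_def)
        show ?thesis
          using walk_snoc[OF w(1), of v] w wne pv 3 by (intro exI[of _ "w @ [v]"]) auto
      next
        case 4
        then obtain w where w: "walk Y E w" "distinct w" "hd w = y" "last w = z"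
          using Suc.prems(3) unfolding joined_def by blast
        then show ?thesis using walk_mono[of Y E w "insert v Y"] by blast
      qed
    qed
    have "X - insert v Y = (X - Y) - {v}" by blast
    then have "k = card (X - insert v Y)" using Suc.hyps(2) pv(2) fX by simp
    then show ?case using Suc.hyps(1)[of "insert v Y"] QY J Suc.prems pv(2) by auto
  qed
  moreover have "joined {x0}"
    unfolding joined_def by (auto intro!: exI[of _ "[x0]"] simp: walk_def)
  ultimately show ?thesis using root by blast
qed

section \<open>Expanding families and the obstructions to them\<close>

text \<open>A triple \<open>(v, A, B)\<close> permits \<open>B\<close> at the vertex
  \<open>v\<close> of the tree together with \<open>A\<close> at a neighbour of \<open>v\<close>.
  The vertex \<open>v\<close> is recorded because the permitted pairs may depend on it, as they do
  once each \<open>v\<close> carries its own label. The set \<open>A\<close> must extend for every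
  \<open>v'\<close>, since any vertex of \<open>V\<close> may be attached to it next.\<close>

definition expanding :: "'v set \<Rightarrow> nat \<Rightarrow> ('v \<times> 'a set \<times> 'a set) set \<Rightarrow> bool" where
  "expanding V M P \<longleftrightarrow> (\<forall>v A B F. (v, A, B) \<in> P \<longrightarrow> finite F \<longrightarrow> card F \<le> M \<longrightarrow>
     (\<forall>v'\<in>V. \<exists>B'. (v', A, B') \<in> P \<and> B' \<inter> F = {}) \<and> (\<exists>A'. (v, A', B) \<in> P \<and> A' \<inter> F = {}))"

text \<open>A new vertex \<open>v\<close> of the growing tree has a single neighbour
  \<open>p\<close> among the old ones. So it suffices to complete the set at \<open>p\<close> by a
  set avoiding the union \<open>F\<close> of all sets placed so far, and \<open>M\<close> bounds the
  size of \<open>F\<close>.\<close>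

lemma expanding_tree_embedding:
  assumes tree: "is_tree (U \<union> V) E" and bip: "bipartition U V (U \<union> V) E" and "U \<noteq> {}"
    and exp: "expanding V M P" and "P \<noteq> {}"
    and P: "\<And>v A B. (v, A, B) \<in> P \<Longrightarrow> v \<in> V \<and> finite A \<and> finite B \<and> card A \<le> m \<and> card B \<le> m"
    and M: "m * card (U \<union> V) \<le> M"
  shows "\<exists>\<phi>. (\<forall>u\<in>U. \<exists>v B. (v, \<phi> u, B) \<in> P) \<and> (\<forall>v\<in>V. \<exists>A. (v, A, \<phi> v) \<in> P) \<and>
    disjoint_family_on \<phi> (U \<union> V) \<and> (\<forall>u\<in>U. \<forall>v\<in>V. {u, v} \<in> E \<longrightarrow> (v, \<phi> u, \<phi> v) \<in> P)"
proof -
  have UV: "U \<inter> V = {}" using bip by (simp add: bipartition_def)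
  have fX: "finite (U \<union> V)" using tree by (simp add: is_tree_def fin_graph_def)
  \<comment> \<open>The first two clauses keep every placed set inside some triple of
    \<open>P\<close>, so that \<open>expanding\<close> applies to it even before any edge at it has
    been placed.\<close>
  define Q where "Q Y \<longleftrightarrow> (\<exists>\<phi>. (\<forall>u\<in>U\<inter>Y. \<exists>v B. (v, \<phi> u, B) \<in> P) \<and> (\<forall>v\<in>V\<inter>Y. \<exists>A. (v, A, \<phi> v) \<in> P) \<and>
    disjoint_family_on \<phi> Y \<and> (\<forall>u\<in>U\<inter>Y. \<forall>v\<in>V\<inter>Y. {u, v} \<in> E \<longrightarrow> (v, \<phi> u, \<phi> v) \<in> P))" for Y
  obtain x0 where x0: "x0 \<in> U" using \<open>U \<noteq> {}\<close> by blast
  have "Q (U \<union> V)"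
  proof (rule tree_induct[OF tree, of x0])
    show "x0 \<in> U \<union> V" using x0 by simp
    obtain v A B where "(v, A, B) \<in> P" using \<open>P \<noteq> {}\<close> by auto
    then show "Q {x0}" using x0 UV unfolding Q_def
      by (intro exI[of _ "\<lambda>_. A"]) (auto simp: disjoint_family_on_def)
  next
    fix Y v p
    assume Y: "Y \<subseteq> U \<union> V" and v: "v \<in> U \<union> V - Y" and p: "p \<in> Y" and pv: "{p, v} \<in> E"
      and uniq: "\<And>q. q \<in> Y \<Longrightarrow> {q, v} \<in> E \<Longrightarrow> q = p" and "Q Y"
    then obtain \<phi> where \<phi>: "\<forall>u\<in>U\<inter>Y. \<exists>v B. (v, \<phi> u, B) \<in> P" "\<forall>v\<in>V\<inter>Y. \<exists>A. (v, A, \<phi> v) \<in> P"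
      "disjoint_family_on \<phi> Y" "\<forall>u\<in>U\<inter>Y. \<forall>v\<in>V\<inter>Y. {u, v} \<in> E \<longrightarrow> (v, \<phi> u, \<phi> v) \<in> P"
      unfolding Q_def by blast
    have fY: "finite Y" using Y fX finite_subset by blast
    have sz: "finite (\<phi> y) \<and> card (\<phi> y) \<le> m" if "y \<in> Y" for y
      using that Y \<phi>(1,2) P by blast
    define F where "F = (\<Union>y\<in>Y. \<phi> y)"
    have fF: "finite F" using sz fY by (auto simp: F_def)
    have "card F \<le> (\<Sum>y\<in>Y. card (\<phi> y))" unfolding F_def by (rule card_UN_le[OF fY])
    also have "\<dots> \<le> card Y * m" using sum_bounded_above[of Y "\<lambda>y. card (\<phi> y)" m] sz by simp
    also have "\<dots> \<le> card (U \<union> V) * m" using Y fX by (intro mult_right_mono card_mono) auto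
    finally have cF: "card F \<le> M" using M by (simp add: mult.commute)
    have ext: "Q (insert v Y)" if S: "S \<inter> F = {}"
      and act: "v \<in> U \<Longrightarrow> \<exists>w B. (w, S, B) \<in> P" "v \<in> V \<Longrightarrow> \<exists>A. (v, A, S) \<in> P"
      and edge: "v \<in> U \<Longrightarrow> p \<in> V \<Longrightarrow> (p, S, \<phi> p) \<in> P" "v \<in> V \<Longrightarrow> p \<in> U \<Longrightarrow> (v, \<phi> p, S) \<in> P" for S
      unfolding Q_def
    proof (intro exI[of _ "\<phi>(v := S)"] conjI)
      show "\<forall>u\<in>U \<inter> insert v Y. \<exists>w B. (w, (\<phi>(v := S)) u, B) \<in> P" using \<phi>(1) act(1) by auto
      show "\<forall>w\<in>V \<inter> insert v Y. \<exists>A. (w, A, (\<phi>(v := S)) w) \<in> P" using \<phi>(2) act(2) by auto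
      have *: "S \<inter> \<phi> y = {}" "\<phi> y \<inter> S = {}" if "y \<in> Y" for y using S that by (auto simp: F_def)
      show "disjoint_family_on (\<phi>(v := S)) (insert v Y)"
        using \<phi>(3) * v unfolding disjoint_family_on_def by auto
      show "\<forall>u\<in>U \<inter> insert v Y. \<forall>w\<in>V \<inter> insert v Y. {u, w} \<in> E \<longrightarrow>
          (w, (\<phi>(v := S)) u, (\<phi>(v := S)) w) \<in> P"
      proof (intro ballI impI)
        fix u w assume uw: "u \<in> U \<inter> insert v Y" "w \<in> V \<inter> insert v Y" "{u, w} \<in> E"
        have "u \<noteq> w" using uw UV by auto
        then consider "u = v" "w \<in> Y" | "w = v" "u \<in> Y" | "u \<in> Y" "w \<in> Y" "u \<noteq> v" "w \<noteq> v" using uw by blast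
        then show "(w, (\<phi>(v := S)) u, (\<phi>(v := S)) w) \<in> P"
        proof cases
          case 1
          then have "w = p" using uniq[of w] uw by (simp add: insert_commute)
          then show ?thesis using 1 uw edge(1) \<open>u \<noteq> w\<close> by auto
        next
          case 2
          then have "u = p" using uniq[of u] uw by simp
          then show ?thesis using 2 uw edge(2) \<open>u \<noteq> w\<close> by auto
        next
          case 3 then show ?thesis using uw \<phi>(4) by auto
        qed
      qed
    qed
    have "\<exists>x\<in>U. \<exists>y\<in>V. {p, v} = {x, y}" using bip pv by (simp add: bipartition_def)
    then consider "p \<in> U" "v \<in> V" | "p \<in> V" "v \<in> U" by (auto simp: doubleton_eq_iff)
    then show "Q (insert v Y)"
    proof cases
      case 1
      then obtain w B where "(w, \<phi> p, B) \<in> P" using \<phi>(1) p by blast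
      then obtain B' where "(v, \<phi> p, B') \<in> P" "B' \<inter> F = {}"
        using exp fF cF 1(2) unfolding expanding_def by blast
      then show ?thesis using ext[of B'] 1 UV by blast
    next
      case 2
      then obtain A where "(p, A, \<phi> p) \<in> P" using \<phi>(2) p by blast
      then obtain A' where "(p, A', \<phi> p) \<in> P" "A' \<inter> F = {}"
        using exp fF cF unfolding expanding_def by blast
      then show ?thesis using ext[of A'] 2 UV by blast
    qed
  qed
  moreover have "U \<inter> (U \<union> V) = U" "V \<inter> (U \<union> V) = V" by auto
  ultimately show ?thesis unfolding Q_def by simp
qed

text \<open>The covers record the obstructions met when violating parts are removed one at a time.\<close>

lemma not_expanding_cover:
  assumes "finite P" "V \<noteq> {}" and nexp: "\<And>P'. P' \<subseteq> P \<Longrightarrow> P' \<noteq> {} \<Longrightarrow> \<not> expanding V M P'"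
  shows "\<exists>W1 W2. (\<forall>A. finite (W1 A) \<and> card (W1 A) \<le> M) \<and> (\<forall>v B. finite (W2 v B) \<and> card (W2 v B) \<le> M) \<and>
    (\<forall>A. \<exists>v\<in>V. \<forall>B. (v, A, B) \<in> P \<longrightarrow> B \<inter> W1 A \<noteq> {} \<or> A \<inter> W2 v B \<noteq> {})"
  using assms(1) nexp
proof (induction "card P" arbitrary: P rule: less_induct)
  case less
  show ?case
  proof (cases "P = {}")
    case True
    then show ?thesis using \<open>V \<noteq> {}\<close>
      by (intro exI[of _ "\<lambda>_. {}"] exI[of _ "\<lambda>_ _. {}"]) auto
  next
    case False
    then have "\<not> expanding V M P" using less.prems(2) by blast
    then obtain v A B F where vAB: "(v, A, B) \<in> P" and F: "finite F" "card F \<le> M"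
      and alt: "(\<exists>v'\<in>V. \<forall>B'. (v', A, B') \<in> P \<longrightarrow> B' \<inter> F \<noteq> {}) \<or> (\<forall>A'. (v, A', B) \<in> P \<longrightarrow> A' \<inter> F \<noteq> {})"
      unfolding expanding_def by blast
    have IH: "\<exists>W1 W2. (\<forall>A. finite (W1 A) \<and> card (W1 A) \<le> M) \<and> (\<forall>v B. finite (W2 v B) \<and> card (W2 v B) \<le> M) \<and>
    (\<forall>A. \<exists>v\<in>V. \<forall>B. (v, A, B) \<in> P' \<longrightarrow> B \<inter> W1 A \<noteq> {} \<or> A \<inter> W2 v B \<noteq> {})"
      if "P' \<subseteq> P" "(v, A, B) \<notin> P'" for P'
    proof (rule less.hyps)
      have "P' \<subset> P" using that vAB by blast
      then show "card P' < card P" by (rule psubset_card_mono[OF less.prems(1)])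
      show "finite P'" using that less.prems(1) finite_subset by blast
      show "\<And>P''. P'' \<subseteq> P' \<Longrightarrow> P'' \<noteq> {} \<Longrightarrow> \<not> expanding V M P''" using less.prems(2) that by blast
    qed
    from alt show ?thesis
    proof
      assume "\<exists>v'\<in>V. \<forall>B'. (v', A, B') \<in> P \<longrightarrow> B' \<inter> F \<noteq> {}"
      then obtain v' where v': "v' \<in> V" "\<forall>B'. (v', A, B') \<in> P \<longrightarrow> B' \<inter> F \<noteq> {}" by blast
      \<comment> \<open>All triples with this \<open>A\<close> are dropped, so the value of
        \<open>W1\<close> at \<open>A\<close> is free and becomes \<open>F\<close>, with
        \<open>v'\<close> as the witness for \<open>A\<close>.\<close>
      let ?P' = "{q\<in>P. fst (snd q) \<noteq> A}"
      obtain W1 W2 where W: "\<forall>A. finite (W1 A) \<and> card (W1 A) \<le> M" "\<forall>v B. finite (W2 v B) \<and> card (W2 v B) \<le> M"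
        "\<forall>A. \<exists>v\<in>V. \<forall>B. (v, A, B) \<in> ?P' \<longrightarrow> B \<inter> W1 A \<noteq> {} \<or> A \<inter> W2 v B \<noteq> {}"
        using IH[of ?P'] by auto
      have "\<exists>v\<in>V. \<forall>B. (v, A0, B) \<in> P \<longrightarrow> B \<inter> (W1(A := F)) A0 \<noteq> {} \<or> A0 \<inter> W2 v B \<noteq> {}" for A0
      proof (cases "A0 = A")
        case True then show ?thesis using v' by auto
      next
        case False then show ?thesis using W(3) by fastforce
      qed
      then show ?thesis using W F by (intro exI[of _ "W1(A := F)"] exI[of _ W2]) simp
    next
      assume v': "\<forall>A'. (v, A', B) \<in> P \<longrightarrow> A' \<inter> F \<noteq> {}"
      \<comment> \<open>Here \<open>F\<close> becomes the value of \<open>W2\<close> at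
        \<open>v\<close> and \<open>B\<close>. The witnesses of the smaller family stay valid,
        because the first part of every dropped triple meets \<open>F\<close>.\<close>
      let ?P' = "{q\<in>P. \<not> (fst q = v \<and> snd (snd q) = B)}"
      obtain W1 W2 where W: "\<forall>A. finite (W1 A) \<and> card (W1 A) \<le> M" "\<forall>v B. finite (W2 v B) \<and> card (W2 v B) \<le> M"
        "\<forall>A. \<exists>v\<in>V. \<forall>B. (v, A, B) \<in> ?P' \<longrightarrow> B \<inter> W1 A \<noteq> {} \<or> A \<inter> W2 v B \<noteq> {}"
        using IH[of ?P'] by auto
      let ?W2 = "\<lambda>v0 B0. if v0 = v \<and> B0 = B then F else W2 v0 B0"
      have "\<exists>v\<in>V. \<forall>B. (v, A0, B) \<in> P \<longrightarrow> B \<inter> W1 A0 \<noteq> {} \<or> A0 \<inter> ?W2 v B \<noteq> {}" for A0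
      proof -
        obtain v0 where v0: "v0 \<in> V" "\<forall>B. (v0, A0, B) \<in> ?P' \<longrightarrow> B \<inter> W1 A0 \<noteq> {} \<or> A0 \<inter> W2 v0 B \<noteq> {}"
          using W(3) by blast
        then show ?thesis using v' by (intro bexI[of _ v0]) auto
      qed
      then show ?thesis using W(1,2) F by (intro exI[of _ W1] exI[of _ ?W2]) simp
    qed
  qed
qed

lemma contains_copy_blowupI:
  assumes U: "\<And>u. u \<in> U \<Longrightarrow> finite (\<phi> u) \<and> card (\<phi> u) = a"
    and V: "\<And>v. v \<in> V \<Longrightarrow> finite (\<phi> v) \<and> card (\<phi> v) = b"
    and disj: "disjoint_family_on \<phi> (U \<union> V)"
    and edge: "\<And>u v. u \<in> U \<Longrightarrow> v \<in> V \<Longrightarrow> {u, v} \<in> E \<Longrightarrow> \<phi> u \<union> \<phi> v \<in> H"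
  shows "contains_copy H (blowup U V E a b)"
proof -
  have "\<exists>h. bij_betw h {..<card (\<phi> x)} (\<phi> x)" if "x \<in> U \<union> V" for x
    using ex_bij_betw_nat_finite[of "\<phi> x"] U V that by (auto simp: atLeast0LessThan)
  then obtain h where h: "\<And>x. x \<in> U \<union> V \<Longrightarrow> bij_betw (h x) {..<card (\<phi> x)} (\<phi> x)" by metis
  define f where "f = (\<lambda>(x, i). h x i)"
  let ?D = "SIGMA x:U \<union> V. {..<card (\<phi> x)}"
  have "inj_on f ?D"
  proof (rule inj_onI)
    fix p q assume pq: "p \<in> ?D" "q \<in> ?D" "f p = f q"
    obtain x i y j where p: "p = (x, i)" and q: "q = (y, j)" by (metis surj_pair)
    have xy: "x \<in> U \<union> V" "y \<in> U \<union> V" "i \<in> {..<card (\<phi> x)}" "j \<in> {..<card (\<phi> y)}" "f (x, i) = f (y, j)"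
      using pq p q by auto
    have m: "h x i \<in> \<phi> x" "h y j \<in> \<phi> y" using xy h bij_betwE by blast+
    have e: "h x i = h y j" using xy by (simp add: f_def)
    have "x = y"
    proof (rule ccontr)
      assume "x \<noteq> y"
      then have "\<phi> x \<inter> \<phi> y = {}" using disj xy unfolding disjoint_family_on_def by blast
      then show False using m e by auto
    qed
    moreover have "i = j" using h[OF xy(1)] xy e \<open>x = y\<close> unfolding bij_betw_def inj_on_def by auto
    ultimately show "p = q" using p q by simp
  qed
  moreover have "\<Union>(blowup U V E a b) \<subseteq> ?D"
    unfolding blowup_def using U V by fastforce
  ultimately have inj: "inj_on f (\<Union>(blowup U V E a b))" by (rule inj_on_subset)
  have img: "f ` ({x} \<times> {..<card (\<phi> x)}) = \<phi> x" if "x \<in> U \<union> V" for x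
  proof -
    have "f ` ({x} \<times> {..<card (\<phi> x)}) = h x ` {..<card (\<phi> x)}" by (auto simp: f_def image_def)
    then show ?thesis using h[OF that] by (simp add: bij_betw_def)
  qed
  have "f ` e \<in> H" if "e \<in> blowup U V E a b" for e
  proof -
    obtain u v where uv: "u \<in> U" "v \<in> V" "{u, v} \<in> E" "e = ({u} \<times> {..<a}) \<union> ({v} \<times> {..<b})"
      using \<open>e \<in> blowup U V E a b\<close> by (auto simp: blowup_def)
    then have "f ` e = \<phi> u \<union> \<phi> v" using img[of u] img[of v] U[of u] V[of v] by (simp add: image_Un)
    then show ?thesis using edge uv by simp
  qed
  then show ?thesis using inj unfolding contains_copy_def by blast
qed

section \<open>Covers in families without a copy of the blowup\<close>

definition deg :: "'a set set \<Rightarrow> 'a set \<Rightarrow> nat" where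
  "deg H F = card {e \<in> H. F \<subseteq> e}"

lemma r_graph_finite:
  assumes "r_graph r X H" shows "finite X" "finite H" "e \<in> H \<Longrightarrow> finite e" "e \<in> H \<Longrightarrow> card e = r" "e \<in> H \<Longrightarrow> e \<subseteq> X"
proof -
  show X: "finite X" using assms by (simp add: r_graph_def)
  have "H \<subseteq> Pow X" using assms by (auto simp: r_graph_def)
  then show "finite H" using X finite_subset by blast
  show "e \<in> H \<Longrightarrow> finite e" "e \<in> H \<Longrightarrow> card e = r" "e \<in> H \<Longrightarrow> e \<subseteq> X"
    using assms X by (auto simp: r_graph_def intro: finite_subset)
qed

text \<open>Each \<open>F\<close> has at most \<open>2 ^ k\<close> subsets \<open>Q\<close>, and
  each of these offers at most \<open>M\<close> new vertices. The sets counted model edges in which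
  one vertex is confined to a bounded set by a part of the others.\<close>

lemma card_extensions_le:
  fixes W :: "'a set \<Rightarrow> 'a set"
  assumes fin: "finite \<F>" "\<And>F. F \<in> \<F> \<Longrightarrow> finite F \<and> card F \<le> k"
    and W: "\<And>Q. finite (W Q) \<and> card (W Q) \<le> M"
  shows "finite {e. \<exists>F\<in>\<F>. \<exists>Q\<subseteq>F. \<exists>w\<in>W Q. e = insert w F}" (is "finite ?S")
    and "real (card {e. \<exists>F\<in>\<F>. \<exists>Q\<subseteq>F. \<exists>w\<in>W Q. e = insert w F}) \<le> real (card \<F>) * (2 ^ k * real M)"
proof -
  define T where "T F = (\<Union>Q\<in>Pow F. (\<lambda>w. insert w F) ` W Q)" for F
  have S: "?S = (\<Union>F\<in>\<F>. T F)" by (auto simp: T_def)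
  have fT: "finite (T F)" if "F \<in> \<F>" for F using fin(2)[OF that] W by (auto simp: T_def)
  show "finite ?S" unfolding S using fin(1) fT by blast
  have "real (card (T F)) \<le> 2 ^ k * real M" if "F \<in> \<F>" for F
  proof -
    have "real (card (T F)) \<le> real (card (Pow F)) * real M"
    proof (rule card_cover_le)
      show "finite (Pow F)" using fin(2)[OF that] by simp
      show "T F \<subseteq> (\<Union>Q\<in>Pow F. (\<lambda>w. insert w F) ` W Q)" by (simp add: T_def)
      show "finite ((\<lambda>w. insert w F) ` W Q)" for Q using W by simp
      show "real (card ((\<lambda>w. insert w F) ` W Q)) \<le> real M" for Q
        using W card_image_le order_trans of_nat_mono by metis
    qed
    also have "\<dots> \<le> 2 ^ k * real M"
      using fin(2)[OF that] by (intro mult_right_mono) (auto simp: card_Pow)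
    finally show ?thesis .
  qed
  then show "real (card ?S) \<le> real (card \<F>) * (2 ^ k * real M)"
    unfolding S by (intro card_cover_le[OF fin(1) subset_refl fT])
qed

text \<open>Such a set is given by \<open>Q\<close>, a vertex of \<open>W Q\<close> and the other
  \<open>k - q\<close> vertices. The vertex confined to a bounded set saves one factor
  \<open>card X\<close>.\<close>

lemma card_meeting_cover_le:
  fixes W :: "'a set \<Rightarrow> 'a set"
  assumes X: "finite X" and q: "q \<le> k" and W: "\<And>Q. finite (W Q) \<and> card (W Q) \<le> M"
  shows "real (card {F \<in> nsets X (Suc k). \<exists>Q\<subseteq>F. card Q = q \<and> (F - Q) \<inter> W Q \<noteq> {}}) \<le> real M * real (card X) ^ k"
    (is "real (card ?S) \<le> _")
proof -
  let ?n = "real (card X)"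
  define T where "T Q = (\<Union>w\<in>W Q. (\<lambda>R. insert w (Q \<union> R)) ` nsets X (k - q))" for Q
  have fT: "finite (T Q)" for Q using X W by (auto simp: T_def finite_imp_finite_nsets)
  have cT: "real (card (T Q)) \<le> real M * ?n ^ (k - q)" for Q
  proof -
    have "real (card (T Q)) \<le> real (card (W Q)) * ?n ^ (k - q)"
    proof (rule card_cover_le)
      show "finite (W Q)" using W by simp
      show "T Q \<subseteq> (\<Union>w\<in>W Q. (\<lambda>R. insert w (Q \<union> R)) ` nsets X (k - q))" by (simp add: T_def)
      show "finite ((\<lambda>R. insert w (Q \<union> R)) ` nsets X (k - q))" for w using X by (simp add: finite_imp_finite_nsets)
      show "real (card ((\<lambda>R. insert w (Q \<union> R)) ` nsets X (k - q))) \<le> ?n ^ (k - q)" for w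
      proof -
        have "card ((\<lambda>R. insert w (Q \<union> R)) ` nsets X (k - q)) \<le> card (nsets X (k - q))"
          using X by (intro card_image_le finite_imp_finite_nsets)
        then show ?thesis using real_card_nsets_le[OF X order_refl, of "k - q"] by linarith
      qed
    qed
    also have "\<dots> \<le> real M * ?n ^ (k - q)" using W by (intro mult_right_mono) auto
    finally show ?thesis .
  qed
  have "?S \<subseteq> (\<Union>Q\<in>nsets X q. T Q)"
  proof
    fix F assume "F \<in> ?S"
    then obtain Q w where F: "F \<in> nsets X (Suc k)" and Q: "Q \<subseteq> F" "card Q = q" and w: "w \<in> F - Q" "w \<in> W Q" by auto
    have fF: "F \<subseteq> X" "finite F" "card F = Suc k" using F by (auto simp: nsets_def)
    have fQ: "finite Q" using Q fF finite_subset by blast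
    have "card (F - Q - {w}) = k - q" using fF Q w fQ by (simp add: card_Diff_subset)
    then have "F - Q - {w} \<in> nsets X (k - q)" using fF by (auto simp: nsets_def)
    moreover have "F = insert w (Q \<union> (F - Q - {w}))" using Q w by auto
    ultimately have "F \<in> T Q" using w unfolding T_def by blast
    moreover have "Q \<in> nsets X q" using Q fF fQ by (auto simp: nsets_def)
    ultimately show "F \<in> (\<Union>Q\<in>nsets X q. T Q)" by blast
  qed
  then have "real (card ?S) \<le> real (card (nsets X q)) * (real M * ?n ^ (k - q))"
    using X fT cT by (intro card_cover_le[where T = T]) (auto simp: finite_imp_finite_nsets)
  also have "\<dots> \<le> ?n ^ q * (real M * ?n ^ (k - q))"
    using X by (intro mult_right_mono real_card_nsets_le) auto
  also have "\<dots> = real M * ?n ^ k" using q by (simp flip: power_add)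
  finally show ?thesis .
qed

text \<open>Up to \<open>a\<close> vertices of \<open>L\<close> all fit into \<open>A\<close>; from
  \<open>a + 2\<close> on, \<open>A\<close> lies inside \<open>L\<close> and leaves at least two.
  For \<open>a + 1\<close> this would leave a single one, so \<open>A\<close> takes
  \<open>a - 1\<close> of them and, as \<open>b \<ge> 2\<close>, a vertex outside
  \<open>L\<close>.\<close>

lemma balanced_splitting:
  assumes "2 \<le> b" "b < a" and e: "finite e" "card e = a + b" and L: "L \<subseteq> e" "card L \<noteq> 1"
  shows "\<exists>A\<subseteq>e. card A = a \<and> card (A \<inter> L) \<noteq> 1 \<and> card (L - A) \<noteq> 1"
proof -
  have fL: "finite L" using e L finite_subset by blast
  have ceL: "card (e - L) = a + b - card L" using e L fL by (simp add: card_Diff_subset)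
  consider "card L \<le> a" | "card L = a + 1" | "card L \<ge> a + 2" by linarith
  then show ?thesis
  proof cases
    case 1
    then have "a - card L \<le> card (e - L)" using ceL by simp
    then obtain S where S: "S \<subseteq> e - L" "card S = a - card L" by (meson obtain_subset_with_card_n)
    have "card (L \<union> S) = card L + card S" using S fL e finite_subset[of S e] by (intro card_Un_disjoint) auto
    moreover have "(L \<union> S) \<inter> L = L" "card (L - (L \<union> S)) = 0" by (auto simp: card_eq_0_iff)
    ultimately show ?thesis using S L 1 by (intro exI[of _ "L \<union> S"]) (auto simp del: Un_Diff)
  next
    case 2
    then have "a - 1 \<le> card L" by simp
    then obtain S where S: "S \<subseteq> L" "card S = a - 1" by (rule obtain_subset_with_card_n)
    have "card (e - L) \<noteq> 0" using ceL 2 assms by simp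
    then obtain z where z: "z \<in> e - L" by (metis card.empty ex_in_conv)
    have fS: "finite S" using S fL finite_subset by blast
    have "card (insert z S) = a" using S z fS assms by (subst card_insert_disjoint) auto
    moreover have "insert z S \<inter> L = S" using S z by auto
    moreover have "L - insert z S = L - S" using z by auto
    moreover have "card (L - S) = 2" using S fS 2 assms by (simp add: card_Diff_subset)
    ultimately show ?thesis using S z L assms by (intro exI[of _ "insert z S"]) auto
  next
    case 3
    then have "a \<le> card L" by simp
    then obtain S where S: "S \<subseteq> L" "card S = a" by (rule obtain_subset_with_card_n)
    have fS: "finite S" using S fL finite_subset by blast
    have "S \<inter> L = S" using S by auto
    moreover have "card (L - S) \<noteq> 1" using S fS 3 by (simp add: card_Diff_subset)
    ultimately show ?thesis using S L assms by (intro exI[of _ S]) auto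
  qed
qed

text \<open>The condition \<open>a < r - 1\<close> of the theorem appears here as
  \<open>2 \<le> b\<close>. The critical leaf enters with the exact result, as an assumption of the
  lemmas there.\<close>

locale blowup_tree =
  fixes U V :: "'v set" and E :: "'v set set" and a b :: nat
  assumes tree: "is_tree (U \<union> V) E" and bip: "bipartition U V (U \<union> V) E"
    and U_nonempty: "U \<noteq> {}" and V_nonempty: "V \<noteq> {}" and b_ge: "2 \<le> b" and b_less: "b < a"
begin

abbreviation T :: "('v \<times> nat) set set" where "T \<equiv> blowup U V E a b"

text \<open>\<open>M\<close> bounds the vertices used by a copy of the blowup, and \<open>M1\<close> the covers of \<open>split_cover\<close>.\<close>

definition M where "M = (a + b) * card (U \<union> V)"
definition M1 where "M1 = (1 + card V) * M"
text \<open>Bounds the ratio of edges to shadow sets in \<open>edges_le_shadow\<close>: a shadow set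
  has at most \<open>2 ^ (a + b)\<close> subsets, each with a cover of at most \<open>M1\<close>
  vertices.\<close>

definition K :: real where "K = 2 ^ (a + b) * real M1"

lemma finite_UV: "finite U" "finite V"
  using tree by (auto simp: is_tree_def fin_graph_def)

text \<open>The set \<open>c v\<close> is a reserved part of the block of \<open>v\<close> that is
  added after the embedding, so the triples contain only the rest \<open>B\<close> of this block.
  \<open>split_cover\<close> uses empty reserved parts, and \<open>few_sets_with_all_labels\<close>
  uses one distinct vertex for each \<open>v\<close>.\<close>

lemma copy_of_expanding:
  assumes exp: "expanding V M P" "P \<noteq> {}" and inj: "disjoint_family_on c V"
    and P: "\<And>v A B. (v, A, B) \<in> P \<Longrightarrow> v \<in> V \<and> finite A \<and> finite B \<and> card A = a \<and> finite (c v) \<and>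
      card (B \<union> c v) = b \<and> B \<inter> \<Union>(c ` V) = {} \<and> A \<inter> \<Union>(c ` V) = {} \<and> A \<union> (B \<union> c v) \<in> H"
  shows "contains_copy H T"
proof -
  have UV: "U \<inter> V = {}" using bip by (simp add: bipartition_def)
  have "\<exists>\<phi>. (\<forall>u\<in>U. \<exists>v B. (v, \<phi> u, B) \<in> P) \<and> (\<forall>v\<in>V. \<exists>A. (v, A, \<phi> v) \<in> P) \<and>
    disjoint_family_on \<phi> (U \<union> V) \<and> (\<forall>u\<in>U. \<forall>v\<in>V. {u, v} \<in> E \<longrightarrow> (v, \<phi> u, \<phi> v) \<in> P)"
  proof (rule expanding_tree_embedding[OF tree bip U_nonempty exp])
    fix v A B assume q: "(v, A, B) \<in> P"
    have "card B \<le> card (B \<union> c v)" using P[OF q] by (intro card_mono) auto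
    then show "v \<in> V \<and> finite A \<and> finite B \<and> card A \<le> a + b \<and> card B \<le> a + b"
      using P[OF q] by auto
  qed (simp add: M_def)
  then obtain \<phi> where \<phi>: "\<And>u. u \<in> U \<Longrightarrow> \<exists>v B. (v, \<phi> u, B) \<in> P" "\<And>v. v \<in> V \<Longrightarrow> \<exists>A. (v, A, \<phi> v) \<in> P"
    "disjoint_family_on \<phi> (U \<union> V)" "\<And>u v. u \<in> U \<Longrightarrow> v \<in> V \<Longrightarrow> {u, v} \<in> E \<Longrightarrow> (v, \<phi> u, \<phi> v) \<in> P"
    by blast
  define \<psi> where "\<psi> x = (if x \<in> V then \<phi> x \<union> c x else \<phi> x)" for x
  have \<psi>U: "\<psi> u = \<phi> u" if "u \<in> U" for u using that UV by (auto simp: \<psi>_def)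
  have \<psi>V: "\<psi> v = \<phi> v \<union> c v" if "v \<in> V" for v using that by (auto simp: \<psi>_def)
  have out: "\<phi> x \<inter> c v = {}" if "x \<in> U \<union> V" "v \<in> V" for x v
    using that \<phi>(1)[of x] \<phi>(2)[of x] P by blast
  show ?thesis
  proof (rule contains_copy_blowupI[where \<phi> = \<psi>])
    show "finite (\<psi> u) \<and> card (\<psi> u) = a" if "u \<in> U" for u using \<phi>(1)[OF that] P \<psi>U[OF that] by metis
    show "finite (\<psi> v) \<and> card (\<psi> v) = b" if "v \<in> V" for v
      using \<phi>(2)[OF that] P \<psi>V[OF that] by (metis finite_Un)
    show "disjoint_family_on \<psi> (U \<union> V)"
      unfolding disjoint_family_on_def
    proof (intro ballI impI)
      fix x y assume xy: "x \<in> U \<union> V" "y \<in> U \<union> V" "x \<noteq> y"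
      have d: "\<phi> x \<inter> \<phi> y = {}" using \<phi>(3) xy unfolding disjoint_family_on_def by blast
      have d2: "c x \<inter> c y = {}" if "x \<in> V" "y \<in> V" using inj xy that unfolding disjoint_family_on_def by blast
      show "\<psi> x \<inter> \<psi> y = {}" using d d2 out[OF xy(1), of y] out[OF xy(2), of x] unfolding \<psi>_def by auto
    qed
    fix u v assume uv: "u \<in> U" "v \<in> V" "{u, v} \<in> E"
    then show "\<psi> u \<union> \<psi> v \<in> H" using \<phi>(4)[OF uv] P \<psi>U \<psi>V by metis
  qed
qed

text \<open>All vertices of \<open>V\<close> permit the same splittings here, and a subfamily that
  expands would give a copy. Uniting \<open>W1\<close> with the covers \<open>W2 v\<close> over all
  \<open>v\<close> leaves one cover for each part, whence the factor \<open>1 + card V\<close> in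
  \<open>M1\<close>.\<close>

lemma split_cover:
  assumes H: "r_graph (a + b) X H" and free: "\<not> contains_copy H T" and "H1 \<subseteq> H"
    and S: "\<And>e. e \<in> H1 \<Longrightarrow> S e \<subseteq> e \<and> card (S e) = a"
  obtains W where "\<And>Q. finite (W Q) \<and> card (W Q) \<le> M1"
    "\<And>e. e \<in> H1 \<Longrightarrow> (e - S e) \<inter> W (S e) \<noteq> {} \<or> S e \<inter> W (e - S e) \<noteq> {}"
proof -
  note fin = r_graph_finite[OF H]
  let ?P = "V \<times> (\<lambda>e. (S e, e - S e)) ` H1"
  have "\<exists>W1 W2. (\<forall>A. finite (W1 A) \<and> card (W1 A) \<le> M) \<and> (\<forall>v B. finite (W2 v B) \<and> card (W2 v B) \<le> M) \<and>
    (\<forall>A. \<exists>v\<in>V. \<forall>B. (v, A, B) \<in> ?P \<longrightarrow> B \<inter> W1 A \<noteq> {} \<or> A \<inter> W2 v B \<noteq> {})"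
  proof (rule not_expanding_cover)
    show "finite ?P" using finite_UV finite_subset[OF \<open>H1 \<subseteq> H\<close> fin(2)] by simp
    show "V \<noteq> {}" by (rule V_nonempty)
    fix P' assume P': "P' \<subseteq> ?P" "P' \<noteq> {}"
    show "\<not> expanding V M P'"
    proof
      assume "expanding V M P'"
      then have "contains_copy H T"
      proof (rule copy_of_expanding[OF _ P'(2), where c = "\<lambda>_. {}"])
        fix v A B assume "(v, A, B) \<in> P'"
        then obtain e where e: "v \<in> V" "e \<in> H1" "A = S e" "B = e - S e" using P' by auto
        have eH: "e \<in> H" using e \<open>H1 \<subseteq> H\<close> by blast
        have "finite (S e)" using S[OF e(2)] fin(3)[OF eH] finite_subset by blast
        moreover have "A \<union> B = e" using e S by auto
        ultimately show "v \<in> V \<and> finite A \<and> finite B \<and> card A = a \<and> finite {} \<and>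
          card (B \<union> {}) = b \<and> B \<inter> \<Union>((\<lambda>_. {}) ` V) = {} \<and> A \<inter> \<Union>((\<lambda>_. {}) ` V) = {} \<and> A \<union> (B \<union> {}) \<in> H"
          using e S fin(3,4)[OF eH] eH by (simp add: card_Diff_subset)
      qed (simp add: disjoint_family_on_def)
      then show False using free by simp
    qed
  qed
  then obtain W1 W2 where W1: "\<And>A. finite (W1 A) \<and> card (W1 A) \<le> M"
    and W2: "\<And>v B. finite (W2 v B) \<and> card (W2 v B) \<le> M"
    and cov: "\<And>A. \<exists>v\<in>V. \<forall>B. (v, A, B) \<in> ?P \<longrightarrow> B \<inter> W1 A \<noteq> {} \<or> A \<inter> W2 v B \<noteq> {}" by blast
  define W where "W Q = W1 Q \<union> (\<Union>v\<in>V. W2 v Q)" for Q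
  show ?thesis
  proof (rule that[of W])
    fix Q
    have "card (\<Union>v\<in>V. W2 v Q) \<le> (\<Sum>v\<in>V. card (W2 v Q))" by (rule card_UN_le[OF finite_UV(2)])
    also have "\<dots> \<le> card V * M" using sum_bounded_above[of V "\<lambda>v. card (W2 v Q)" M] W2 by simp
    finally have "card (W Q) \<le> M1"
      using card_Un_le[of "W1 Q" "\<Union>v\<in>V. W2 v Q"] W1[of Q] unfolding W_def M1_def by (simp add: algebra_simps)
    then show "finite (W Q) \<and> card (W Q) \<le> M1" using W1 W2 finite_UV by (simp add: W_def)
  next
    fix e assume e: "e \<in> H1"
    obtain v where v: "v \<in> V" "\<forall>B. (v, S e, B) \<in> ?P \<longrightarrow> B \<inter> W1 (S e) \<noteq> {} \<or> S e \<inter> W2 v B \<noteq> {}" using cov by blast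
    then have "(e - S e) \<inter> W1 (S e) \<noteq> {} \<or> S e \<inter> W2 v (e - S e) \<noteq> {}" using e by blast
    then show "(e - S e) \<inter> W (S e) \<noteq> {} \<or> S e \<inter> W (e - S e) \<noteq> {}" using v(1) unfolding W_def by blast
  qed
qed

text \<open>Any splitting will do. The cover supplies a vertex \<open>w\<close> of the edge
  \<open>e\<close> and a part \<open>Q\<close> of \<open>e - {w}\<close> with \<open>w\<close> in
  \<open>W Q\<close>, so every edge is one of boundedly many extensions of a shadow set.\<close>

lemma edges_le_shadow:
  assumes H: "r_graph (a + b) X H" and free: "\<not> contains_copy H T"
  shows "real (card H) \<le> K * real (card (\<Union>e\<in>H. nsets e (a + b - 1)))"
proof -
  note fin = r_graph_finite[OF H]
  have "\<exists>A\<subseteq>e. card A = a" if "e \<in> H" for e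
    using fin(4)[OF that] by (metis le_add1 obtain_subset_with_card_n)
  then obtain S where S: "\<And>e. e \<in> H \<Longrightarrow> S e \<subseteq> e" "\<And>e. e \<in> H \<Longrightarrow> card (S e) = a" by metis
  obtain W where W: "\<And>Q. finite (W Q) \<and> card (W Q) \<le> M1"
    and cov: "\<And>e. e \<in> H \<Longrightarrow> (e - S e) \<inter> W (S e) \<noteq> {} \<or> S e \<inter> W (e - S e) \<noteq> {}"
    by (rule split_cover[OF H free subset_refl, of S]) (use S in blast)+
  let ?F = "\<Union>e\<in>H. nsets e (a + b - 1)"
  have fF: "finite ?F" using fin by (auto simp: finite_imp_finite_nsets)
  have cF: "\<And>F. F \<in> ?F \<Longrightarrow> finite F \<and> card F \<le> a + b" by (auto simp: nsets_def)
  have ext: "finite {e. \<exists>F\<in>?F. \<exists>Q\<subseteq>F. \<exists>w\<in>W Q. e = insert w F}"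
    "real (card {e. \<exists>F\<in>?F. \<exists>Q\<subseteq>F. \<exists>w\<in>W Q. e = insert w F}) \<le> real (card ?F) * (2 ^ (a + b) * real M1)"
    using card_extensions_le[of ?F "a + b" W M1] fF cF W by blast+
  have "H \<subseteq> {e. \<exists>F\<in>?F. \<exists>Q\<subseteq>F. \<exists>w\<in>W Q. e = insert w F}"
  proof
    fix e assume e: "e \<in> H"
    obtain Q w where Q: "Q \<subseteq> e - {w}" "w \<in> e" "w \<in> W Q" using cov[OF e] S(1)[OF e] by blast
    have "e - {w} \<in> nsets e (a + b - 1)" using Q fin(3,4)[OF e] by (auto simp: nsets_def)
    then have "e - {w} \<in> ?F" using e by blast
    moreover have "e = insert w (e - {w})" using Q by auto
    ultimately show "e \<in> {e. \<exists>F\<in>?F. \<exists>Q\<subseteq>F. \<exists>w\<in>W Q. e = insert w F}" using Q by blast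
  qed
  then have "card H \<le> card {e. \<exists>F\<in>?F. \<exists>Q\<subseteq>F. \<exists>w\<in>W Q. e = insert w F}" by (rule card_mono[OF ext(1)])
  then have "real (card H) \<le> real (card ?F) * (2 ^ (a + b) * real M1)" using ext(2) by linarith
  then show ?thesis by (simp add: K_def mult_ac)
qed

lemma K_nonneg: "0 \<le> K" by (simp add: K_def)

lemma edges_le:
  assumes H: "r_graph (a + b) X H" and free: "\<not> contains_copy H T"
  shows "real (card H) \<le> K * real (card X) ^ (a + b - 1)"
proof -
  note fin = r_graph_finite[OF H]
  have "(\<Union>e\<in>H. nsets e (a + b - 1)) \<subseteq> nsets X (a + b - 1)"
    using fin(5) by (auto simp: nsets_def)
  then have "card (\<Union>e\<in>H. nsets e (a + b - 1)) \<le> card (nsets X (a + b - 1))"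
    using fin(1) by (intro card_mono finite_imp_finite_nsets)
  then have "real (card (\<Union>e\<in>H. nsets e (a + b - 1))) \<le> real (card X) ^ (a + b - 1)"
    using real_card_nsets_le[OF fin(1) order_refl, of "a + b - 1"] by linarith
  then show ?thesis using edges_le_shadow[OF assms] K_nonneg by (meson mult_left_mono order_trans)
qed

text \<open>\<open>balanced_splitting\<close> is applied to the set of light vertices of \<open>e\<close>.  The edge then arises from a
  light \<open>k\<close>-set containing some \<open>Q\<close> and a vertex of \<open>W Q\<close>, which gives few edges since such sets have
  small degree, or it adds a vertex of \<open>W Q\<close> to a heavy \<open>k\<close>-set containing \<open>Q\<close>.\<close>

lemma few_edges_not_one_light:
  assumes H: "r_graph (a + b) X H" and free: "\<not> contains_copy H T" and "0 \<le> \<tau>"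
  shows "real (card {e \<in> H. card {z\<in>e. real (deg H (e - {z})) < \<tau> * real (card X)} \<noteq> 1}) \<le>
    2 * real M1 * \<tau> * real (card X) ^ (a + b - 1) +
    K * real (card {F \<in> nsets X (a + b - 1). \<tau> * real (card X) \<le> real (deg H F)})"
proof -
  note fin = r_graph_finite[OF H]
  let ?n = "real (card X)"
  \<comment> \<open>This \<open>k\<close> is \<open>r - 2\<close>, so the sets of size
    \<open>r - 1\<close> are those in \<open>nsets X (Suc k)\<close>.\<close>
  define k where "k = a + b - 2"
  have ab: "a + b = Suc (Suc k)" "a + b - 1 = Suc k" "a \<le> k" "b \<le> k" using b_ge b_less by (auto simp: k_def)
  define \<Lambda> where "\<Lambda> e = {z\<in>e. real (deg H (e - {z})) < \<tau> * ?n}" for e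
  define Hv where "Hv = {F \<in> nsets X (a + b - 1). \<tau> * ?n \<le> real (deg H F)}"
  define H1 where "H1 = {e \<in> H. card (\<Lambda> e) \<noteq> 1}"
  have "\<exists>A\<subseteq>e. card A = a \<and> card (A \<inter> \<Lambda> e) \<noteq> 1 \<and> card (\<Lambda> e - A) \<noteq> 1" if "e \<in> H1" for e
    using that fin(3,4)[of e] by (intro balanced_splitting[OF b_ge b_less]) (auto simp: H1_def \<Lambda>_def)
  then obtain S where S: "\<And>e. e \<in> H1 \<Longrightarrow> S e \<subseteq> e" "\<And>e. e \<in> H1 \<Longrightarrow> card (S e) = a"
    "\<And>e. e \<in> H1 \<Longrightarrow> card (S e \<inter> \<Lambda> e) \<noteq> 1" "\<And>e. e \<in> H1 \<Longrightarrow> card (\<Lambda> e - S e) \<noteq> 1" by metis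
  have cB: "card (e - S e) = b" if "e \<in> H1" for e
    using S(1,2)[OF that] fin(3,4)[of e] that finite_subset[of "S e" e] by (simp add: card_Diff_subset H1_def)
  have "H1 \<subseteq> H" by (auto simp: H1_def)
  then obtain W where W: "\<And>Q. finite (W Q) \<and> card (W Q) \<le> M1"
    and cov: "\<And>e. e \<in> H1 \<Longrightarrow> (e - S e) \<inter> W (S e) \<noteq> {} \<or> S e \<inter> W (e - S e) \<noteq> {}"
    by (rule split_cover[OF H free, of H1 S]) (use S(1,2) in blast)+
  define Fq where "Fq q = {F \<in> nsets X (Suc k). \<exists>Q\<subseteq>F. card Q = q \<and> (F - Q) \<inter> W Q \<noteq> {}}" for q
  define Fl where "Fl = {F \<in> Fq a \<union> Fq b. real (deg H F) < \<tau> * ?n}"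
  have fFq: "finite (Fq q)" for q using fin(1) by (simp add: Fq_def finite_imp_finite_nsets)
  have "card Fl \<le> card (Fq a) + card (Fq b)"
    unfolding Fl_def using fFq by (intro order_trans[OF card_mono card_Un_le]) auto
  then have "real (card Fl) \<le> real (card (Fq a)) + real (card (Fq b))" by linarith
  also have "\<dots> \<le> real M1 * ?n ^ k + real M1 * ?n ^ k"
    unfolding Fq_def using ab by (intro add_mono card_meeting_cover_le fin(1) W)
  finally have cFl: "real (card Fl) \<le> 2 * real M1 * ?n ^ k" by (simp add: mult_ac)
  have fHv: "finite Hv" using fin(1) by (simp add: Hv_def finite_imp_finite_nsets)
  have cHv: "\<And>F. F \<in> Hv \<Longrightarrow> finite F \<and> card F \<le> a + b" by (auto simp: Hv_def nsets_def)
  let ?E = "{e. \<exists>F\<in>Hv. \<exists>Q\<subseteq>F. \<exists>w\<in>W Q. e = insert w F}"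
  have ext: "finite ?E" "real (card ?E) \<le> real (card Hv) * (2 ^ (a + b) * real M1)"
    using card_extensions_le[of Hv "a + b" W M1] fHv cHv W by blast+
  let ?L = "\<Union>F\<in>Fl. {e\<in>H. F \<subseteq> e}"
  have sub: "H1 \<subseteq> ?L \<union> ?E"
  proof
    fix e assume e: "e \<in> H1"
    then have eH: "e \<in> H" and fe: "finite e" "card e = a + b" "e \<subseteq> X" using fin by (auto simp: H1_def)
    have fS: "finite (S e)" using S(1)[OF e] fe finite_subset by blast
    \<comment> \<open>\<open>Q\<close> is the part whose cover is hit, and \<open>w\<close> is a
      vertex of the other part hitting it. By the choice of the splitting, this other part does not
      contain exactly one light vertex.\<close>
    obtain Q w where Q: "Q \<subseteq> e" "card Q = a \<or> card Q = b" "w \<in> (e - Q) \<inter> W Q" "card ((e - Q) \<inter> \<Lambda> e) \<noteq> 1"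
    proof -
      have eq: "(e - S e) \<inter> \<Lambda> e = \<Lambda> e - S e" "e - (e - S e) = S e" using S(1)[OF e] by (auto simp: \<Lambda>_def)
      from cov[OF e] show ?thesis
      proof
        assume "(e - S e) \<inter> W (S e) \<noteq> {}"
        then obtain w where "w \<in> (e - S e) \<inter> W (S e)" by blast
        then show ?thesis using that[of "S e" w] S[OF e] eq by simp
      next
        assume "S e \<inter> W (e - S e) \<noteq> {}"
        then obtain w where "w \<in> S e \<inter> W (e - S e)" by blast
        then show ?thesis using that[of "e - S e" w] S[OF e] eq cB[OF e] by simp
      qed
    qed
    have mem: "e - {z} \<in> nsets X (Suc k)" if "z \<in> e" for z
      using that fe ab by (auto simp: nsets_def)
    \<comment> \<open>If some light \<open>z \<noteq> w\<close> lies outside \<open>Q\<close>, then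
      \<open>e - {z}\<close> still contains \<open>Q\<close> and \<open>w\<close>, and its degree is
      small. Otherwise \<open>w\<close> is not light, as it would be the only light vertex outside
      \<open>Q\<close>, so \<open>e - {w}\<close> is heavy.\<close>
    show "e \<in> ?L \<union> ?E"
    proof (cases "\<exists>z\<in>e - Q - {w}. z \<in> \<Lambda> e")
      case True
      then obtain z where z: "z \<in> e" "z \<notin> Q" "z \<noteq> w" "z \<in> \<Lambda> e" by auto
      have "e - {z} \<in> Fq (card Q)"
        unfolding Fq_def using mem[OF z(1)] Q z by blast
      then have "e - {z} \<in> Fl" using Q(2) z unfolding Fl_def \<Lambda>_def by auto
      then show ?thesis using eH by blast
    next
      case False
      have "w \<notin> \<Lambda> e"
      proof
        assume "w \<in> \<Lambda> e"
        then have "(e - Q) \<inter> \<Lambda> e = {w}" using False Q(3) by auto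
        then show False using Q(4) by simp
      qed
      then have "e - {w} \<in> Hv" using mem[of w] Q(3) ab unfolding Hv_def \<Lambda>_def by auto
      moreover have "e = insert w (e - {w})" "Q \<subseteq> e - {w}" "w \<in> W Q" using Q by auto
      ultimately show ?thesis by blast
    qed
  qed
  have fL: "finite ?L" by (rule finite_subset[OF _ fin(2)]) auto
  have "card H1 \<le> card (?L \<union> ?E)" by (rule card_mono[OF finite_UnI[OF fL ext(1)] sub])
  also have "\<dots> \<le> card ?L + card ?E" by (rule card_Un_le)
  finally have "card H1 \<le> card ?L + card ?E" .
  moreover have "real (card ?L) \<le> real (card Fl) * (\<tau> * ?n)"
  proof (rule card_cover_le)
    show "finite Fl" using fFq by (simp add: Fl_def)
    show "finite {e\<in>H. F \<subseteq> e}" for F using fin(2) by simp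
    show "real (card {e\<in>H. F \<subseteq> e}) \<le> \<tau> * ?n" if "F \<in> Fl" for F
      using that by (auto simp: Fl_def deg_def)
  qed simp
  moreover have "real (card Fl) * (\<tau> * ?n) \<le> (2 * real M1 * ?n ^ k) * (\<tau> * ?n)"
    using cFl \<open>0 \<le> \<tau>\<close> by (intro mult_right_mono) auto
  moreover have "(2 * real M1 * ?n ^ k) * (\<tau> * ?n) = 2 * real M1 * \<tau> * ?n ^ (a + b - 1)"
    using ab by simp
  ultimately have "real (card H1) \<le> 2 * real M1 * \<tau> * ?n ^ (a + b - 1) + real (card Hv) * (2 ^ (a + b) * real M1)"
    using ext(2) by linarith
  then show ?thesis unfolding H1_def \<Lambda>_def Hv_def K_def by (simp add: mult_ac)
qed


section \<open>Vertices of large degree\<close>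

text \<open>Let \<open>c\<close> be the only light vertex of \<open>e\<close>. Every other vertex
  leaves a heavy set when removed, so all \<open>(r - 2)\<close>-subsets of \<open>e - {c}\<close>
  lie in the link \<open>G c\<close> of the heavy sets. If \<open>c\<close> has small degree, this
  link is sparse and \<open>few_full_sets\<close> allows few such \<open>e\<close>. The sizes of all
  links sum to a multiple of the number of heavy sets, which has order at most
  \<open>n ^ (r - 2)\<close>.\<close>

lemma few_edges_without_heavy_vertex:
  assumes "0 < (\<epsilon>::real)"
  shows "\<exists>\<omega>>0. \<exists>n0. \<forall>(X::'a set) H. r_graph (a + b) X H \<longrightarrow> \<not> contains_copy H T \<longrightarrow> n0 \<le> card X \<longrightarrow>
    real (card {e \<in> H. \<forall>v\<in>e. real (deg H {v}) < \<omega> * real (card X) ^ (a + b - 1)}) \<le> \<epsilon> * real (card X) ^ (a + b - 1)"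
proof -
  define m where "m = a + b - 2"
  have ab: "a + b - 1 = Suc m" "a + b = Suc (Suc m)" using b_ge b_less by (auto simp: m_def)
  define \<tau> where "\<tau> = \<epsilon> / (8 * (real M1 + 1))"
  have \<tau>: "0 < \<tau>" using assms by (simp add: \<tau>_def)
  have M1\<tau>: "2 * real M1 * \<tau> \<le> \<epsilon> / 4"
  proof -
    have "8 * (real M1 + 1) * \<tau> = \<epsilon>" by (simp add: \<tau>_def)
    then show ?thesis using \<tau> by (simp add: algebra_simps)
  qed
  \<comment> \<open>Counting edges at heavy sets gives \<open>\<tau> * n * card Hv \<le> r * card H
    \<le> r * K * n ^ (m + 1)\<close>, that is, \<open>card Hv \<le> C * n ^ m\<close>.\<close>
  define C where "C = real (a + b) * K / \<tau>"
  have C: "0 \<le> C" using K_nonneg \<tau> by (simp add: C_def)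
  \<comment> \<open>The edges with a centre of small degree number at most \<open>e2 * n\<close>
    times the sum of the \<open>card (G c)\<close>. That sum is \<open>Suc m * card Hv\<close>, so
    the product stays below \<open>\<epsilon> / 2 * n ^ (m + 1)\<close>.\<close>
  define e2 where "e2 = \<epsilon> / (2 * (real (Suc m) * C + 1))"
  have pos: "0 < 2 * (real (Suc m) * C + 1)" using C by (simp add: add_nonneg_pos)
  have e2: "0 < e2" unfolding e2_def using assms pos by (rule divide_pos_pos)
  have e2C: "e2 * (real (Suc m) * C) \<le> \<epsilon> / 2"
  proof -
    have "e2 * (2 * (real (Suc m) * C + 1)) = \<epsilon>" unfolding e2_def using pos by simp
    then show ?thesis using e2 by (simp add: algebra_simps)
  qed
  obtain \<delta> where \<delta>: "0 < \<delta>" and full: "\<And>(X::'a set) \<B>. finite X \<Longrightarrow> \<B> \<subseteq> nsets X m \<Longrightarrow> real (card \<B>) \<le> \<delta> * real (card X) ^ m \<Longrightarrow>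
     real (card {D \<in> nsets X (Suc m). nsets D m \<subseteq> \<B>}) \<le> e2 * real (card \<B>) * real (card X)"
    using few_full_sets[OF e2, of m] by blast
  \<comment> \<open>A degree of \<open>c\<close> below \<open>\<omega> * n ^ Suc m\<close> leaves at
    most \<open>\<delta> * n ^ m\<close> heavy sets through \<open>c\<close>, the sparsity required
    by \<open>few_full_sets\<close>.\<close>
  define \<omega> where "\<omega> = \<delta> * \<tau> / real (Suc m)"
  have \<omega>: "0 < \<omega>" using \<delta> \<tau> by (simp add: \<omega>_def)
  define n0 where "n0 = max 1 (nat \<lceil>4 * K * C / \<epsilon>\<rceil>)"
  have "real (card {e \<in> H. \<forall>v\<in>e. real (deg H {v}) < \<omega> * real (card X) ^ Suc m}) \<le> \<epsilon> * real (card X) ^ Suc m"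
    if H: "r_graph (a + b) X H" and free: "\<not> contains_copy H T" and n0: "n0 \<le> card X" for X :: "'a set" and H
  proof -
    note fin = r_graph_finite[OF H]
    let ?n = "real (card X)"
    have n: "0 < ?n" "4 * K * C / \<epsilon> \<le> ?n" using n0 unfolding n0_def by linarith+
    define L where "L e = {z\<in>e. real (deg H (e - {z})) < \<tau> * ?n}" for e
    define Hv where "Hv = {F \<in> nsets X (Suc m). \<tau> * ?n \<le> real (deg H F)}"
    have Hvsub: "Hv \<subseteq> nsets X (Suc m)" by (simp add: Hv_def)
    have fHv: "finite Hv" using fin(1) by (simp add: Hv_def finite_imp_finite_nsets)
    have cHv: "real (card Hv) \<le> C * ?n ^ m"
    proof -
      have "(\<tau> * ?n) * real (card Hv) \<le> real (a + b) * real (card H)"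
      proof (rule double_count_le[where R = "\<lambda>F e. F \<subseteq> e", OF fHv fin(2)])
        show "\<tau> * ?n \<le> real (card {e \<in> H. F \<subseteq> e})" if "F \<in> Hv" for F using that by (simp add: Hv_def deg_def)
        show "real (card {F \<in> Hv. F \<subseteq> e}) \<le> real (a + b)" if "e \<in> H" for e
        proof -
          have "card {F \<in> Hv. F \<subseteq> e} \<le> card (nsets e (Suc m))"
            using fin(3)[OF that] by (intro card_mono finite_imp_finite_nsets) (auto simp: Hv_def nsets_def)
          also have "\<dots> = a + b" using fin(4)[OF that] ab by simp
          finally show ?thesis by simp
        qed
      qed
      also have "\<dots> \<le> real (a + b) * (K * ?n ^ Suc m)"
        using edges_le[OF H free] ab by (intro mult_left_mono) auto
      also have "\<dots> = (C * ?n ^ m) * (\<tau> * ?n)" using \<tau> by (simp add: C_def)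
      finally have "real (card Hv) * (\<tau> * ?n) \<le> (C * ?n ^ m) * (\<tau> * ?n)" by (simp only: mult.commute)
      then show ?thesis by (rule mult_right_le_imp_le) (use \<tau> n in simp)
    qed
    define C1 where "C1 = {c\<in>X. real (deg H {c}) < \<omega> * ?n ^ Suc m}"
    define G where "G c = {S \<in> nsets X m. c \<notin> S \<and> insert c S \<in> Hv}" for c
    have cG: "real (card (G c)) \<le> \<delta> * ?n ^ m" if "c \<in> C1" for c
    proof -
      let ?J = "{e\<in>H. {c} \<subseteq> e}"
      have "(\<tau> * ?n) * real (card (G c)) \<le> real (Suc m) * real (card ?J)"
      proof (rule double_count_le[where R = "\<lambda>S e. insert c S \<subseteq> e"])
        show "finite (G c)" "finite ?J" using fin by (simp_all add: G_def finite_imp_finite_nsets)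
        show "\<tau> * ?n \<le> real (card {e \<in> ?J. insert c S \<subseteq> e})" if "S \<in> G c" for S
        proof -
          have "{e \<in> ?J. insert c S \<subseteq> e} = {e\<in>H. insert c S \<subseteq> e}" by auto
          then show ?thesis using that by (simp add: G_def Hv_def deg_def)
        qed
        show "real (card {S \<in> G c. insert c S \<subseteq> e}) \<le> real (Suc m)" if "e \<in> ?J" for e
        proof -
          have "card {S \<in> G c. insert c S \<subseteq> e} \<le> card (nsets (e - {c}) m)"
            using fin(3)[of e] that by (intro card_mono finite_imp_finite_nsets) (auto simp: G_def nsets_def)
          also have "\<dots> = Suc m" using fin(3,4)[of e] that ab by simp
          finally show ?thesis by simp
        qed
      qed
      also have "\<dots> = real (Suc m) * real (deg H {c})" by (simp add: deg_def)
      also have "\<dots> \<le> real (Suc m) * (\<omega> * ?n ^ Suc m)" using that by (intro mult_left_mono) (auto simp: C1_def)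
      also have "\<dots> = (\<delta> * ?n ^ m) * (\<tau> * ?n)" unfolding \<omega>_def by (simp del: of_nat_Suc)
      finally have "real (card (G c)) * (\<tau> * ?n) \<le> (\<delta> * ?n ^ m) * (\<tau> * ?n)" by (simp add: mult_ac)
      then show ?thesis by (rule mult_right_le_imp_le) (use \<tau> n in simp)
    qed
    define E1 where "E1 = {e\<in>H. card (L e) \<noteq> 1}"
    define Dc where "Dc c = {D \<in> nsets X (Suc m). nsets D m \<subseteq> G c}" for c
    let ?E = "{e \<in> H. \<forall>v\<in>e. real (deg H {v}) < \<omega> * ?n ^ Suc m}"
    let ?E2 = "\<Union>c\<in>C1. insert c ` Dc c"
    have sub: "?E \<subseteq> E1 \<union> ?E2"
    proof
      fix e assume e: "e \<in> ?E"
      then have eH: "e \<in> H" by simp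
      note fe = fin(3,4,5)[OF eH]
      show "e \<in> E1 \<union> ?E2"
      proof (cases "card (L e) = 1")
        case False then show ?thesis using eH by (simp add: E1_def)
      next
        case True
        then obtain c where c: "L e = {c}" by (rule card_1_singletonE)
        then have ce: "c \<in> e" by (auto simp: L_def)
        have D: "e - {c} \<in> nsets X (Suc m)" using fe ce ab by (auto simp: nsets_def)
        have "nsets (e - {c}) m \<subseteq> G c"
        proof
          fix S assume S: "S \<in> nsets (e - {c}) m"
          then have S': "S \<subseteq> e - {c}" "finite S" "card S = m" by (auto simp: nsets_def)
          then have "card (e - {c} - S) = 1" using fe ce ab by (simp add: card_Diff_subset)
          then obtain z where z: "e - {c} - S = {z}" by (rule card_1_singletonE)
          then have "z \<notin> L e" "z \<in> e" using c by auto
          then have "\<tau> * ?n \<le> real (deg H (e - {z}))" "e - {z} \<in> nsets X (Suc m)"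
            using fe ab by (auto simp: L_def nsets_def)
          moreover have "e - {z} = insert c S" using z S' ce by blast
          ultimately have "insert c S \<in> Hv" unfolding Hv_def by simp
          then show "S \<in> G c" using S' fe unfolding G_def nsets_def by auto
        qed
        then have "e - {c} \<in> Dc c" using D by (simp add: Dc_def)
        moreover have "c \<in> C1" using e ce fe by (auto simp: C1_def)
        moreover have "e = insert c (e - {c})" using ce by auto
        ultimately show ?thesis by blast
      qed
    qed
    have fC1: "finite C1" using fin(1) by (simp add: C1_def)
    have fDc: "finite (Dc c)" for c using fin(1) by (simp add: Dc_def finite_imp_finite_nsets)
    have "card ?E \<le> card (E1 \<union> ?E2)"
      by (rule card_mono[OF _ sub]) (use fin(2) fC1 fDc in \<open>simp add: E1_def\<close>)
    also have "\<dots> \<le> card E1 + card ?E2" by (rule card_Un_le)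
    finally have "real (card ?E) \<le> real (card E1) + real (card ?E2)" by linarith
    moreover have "real (card E1) \<le> \<epsilon> / 2 * ?n ^ Suc m"
    proof -
      have "real (card E1) \<le> 2 * real M1 * \<tau> * ?n ^ Suc m + K * real (card Hv)"
        using few_edges_not_one_light[OF H free, of \<tau>] \<tau> unfolding E1_def L_def Hv_def ab(1) by simp
      also have "\<dots> \<le> \<epsilon> / 4 * ?n ^ Suc m + K * (C * ?n ^ m)"
        using M1\<tau> cHv K_nonneg by (intro add_mono mult_right_mono mult_left_mono) auto
      also have "K * (C * ?n ^ m) \<le> \<epsilon> / 4 * ?n ^ Suc m"
      proof -
        have "4 * K * C \<le> \<epsilon> * ?n" using n(2) assms by (simp add: field_simps)
        then have "K * C * ?n ^ m \<le> (\<epsilon> / 4 * ?n) * ?n ^ m" by (intro mult_right_mono) auto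
        then show ?thesis by (simp add: mult_ac)
      qed
      finally show ?thesis by simp
    qed
    moreover have "real (card ?E2) \<le> \<epsilon> / 2 * ?n ^ Suc m"
    proof -
      have "card ?E2 \<le> (\<Sum>c\<in>C1. card (insert c ` Dc c))" by (rule card_UN_le[OF fC1])
      also have "\<dots> \<le> (\<Sum>c\<in>C1. card (Dc c))" by (intro sum_mono card_image_le fDc)
      finally have "real (card ?E2) \<le> (\<Sum>c\<in>C1. real (card (Dc c)))"
        by (simp only: of_nat_sum[symmetric] of_nat_le_iff)
      also have "\<dots> \<le> (\<Sum>c\<in>C1. e2 * real (card (G c)) * ?n)"
        unfolding Dc_def by (intro sum_mono full fin(1) cG) (auto simp: G_def)
      also have "\<dots> \<le> (\<Sum>c\<in>X. e2 * real (card (G c)) * ?n)"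
        using fin(1) e2 by (intro sum_mono2) (auto simp: C1_def)
      also have "\<dots> = e2 * ?n * real (\<Sum>c\<in>X. card (G c))" by (simp add: sum_distrib_left mult_ac)
      also have "\<dots> = e2 * ?n * (real (Suc m) * real (card Hv))"
        using sum_link_card[OF fin(1) Hvsub] unfolding G_def by (simp only: of_nat_mult)
      also have "\<dots> \<le> e2 * ?n * (real (Suc m) * (C * ?n ^ m))"
        using cHv e2 by (intro mult_left_mono) auto
      also have "\<dots> = e2 * (real (Suc m) * C) * ?n ^ Suc m" by (simp del: of_nat_Suc add: mult_ac)
      also have "\<dots> \<le> \<epsilon> / 2 * ?n ^ Suc m" using e2C by (intro mult_right_mono) auto
      finally show ?thesis .
    qed
    ultimately show ?thesis by argo
  qed
  then show ?thesis using \<omega> unfolding ab(1) by blast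
qed

text \<open>The label \<open>w v\<close> is to become one of the \<open>b\<close> points that replace \<open>v\<close>.\<close>

lemma few_sets_with_all_labels:
  fixes w :: "'v \<Rightarrow> 'a"
  assumes free: "\<not> contains_copy H T" and Y: "finite Y" "card Y \<le> n" and w: "inj_on w V" "w ` V \<inter> Y = {}"
    and \<delta>: "0 < \<delta>" and n: "0 < n" "2 * real M / \<delta> \<le> real n"
  shows "real (card {A \<in> nsets Y a. \<forall>v\<in>V. \<delta> * real n ^ (b - 1) \<le>
      real (card {B \<in> nsets Y (b - 1). A \<inter> B = {} \<and> insert (w v) (A \<union> B) \<in> H})}) \<le>
    2 * real (card V) * real M / \<delta> * real n ^ (a - 1)"
proof -
  let ?n = "real n"
  define ext where "ext v A = {B \<in> nsets Y (b - 1). A \<inter> B = {} \<and> insert (w v) (A \<union> B) \<in> H}" for v A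
  define \<A> where "\<A> = {A \<in> nsets Y a. \<forall>v\<in>V. \<delta> * ?n ^ (b - 1) \<le> real (card (ext v A))}"
  define P where "P = (SIGMA v:V. SIGMA A:\<A>. ext v A)"
  obtain b' where b': "b - 1 = Suc b'" "b = Suc (Suc b')" using b_ge by (metis Suc_diff_1 diff_Suc_1 le_Suc_ex add_2_eq_Suc)
  obtain a' where a': "a = Suc a'" using b_less by (cases a) auto
  have fY: "finite (nsets Y k)" for k using Y by (simp add: finite_imp_finite_nsets)
  have fA: "finite \<A>" using fY by (simp add: \<A>_def)
  have fext: "finite (ext v A)" for v A using fY by (simp add: ext_def)
  have "\<exists>W1 W2. (\<forall>A. finite (W1 A) \<and> card (W1 A) \<le> M) \<and> (\<forall>v B. finite (W2 v B) \<and> card (W2 v B) \<le> M) \<and>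
    (\<forall>A. \<exists>v\<in>V. \<forall>B. (v, A, B) \<in> P \<longrightarrow> B \<inter> W1 A \<noteq> {} \<or> A \<inter> W2 v B \<noteq> {})"
  proof (rule not_expanding_cover)
    show "finite P" using finite_UV fA fext by (auto simp: P_def)
    show "V \<noteq> {}" by (rule V_nonempty)
    fix P' assume P': "P' \<subseteq> P" "P' \<noteq> {}"
    show "\<not> expanding V M P'"
    proof
      assume "expanding V M P'"
      then have "contains_copy H T"
      proof (rule copy_of_expanding[OF _ P'(2), where c = "\<lambda>v. {w v}"])
        show "disjoint_family_on (\<lambda>v. {w v}) V" using w(1) by (auto simp: disjoint_family_on_def inj_on_def)
        fix v A B assume "(v, A, B) \<in> P'"
        then have q: "v \<in> V" "A \<in> nsets Y a" "B \<in> nsets Y (b - 1)" "insert (w v) (A \<union> B) \<in> H"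
          using P' by (auto simp: P_def \<A>_def ext_def)
        have YAB: "A \<subseteq> Y" "B \<subseteq> Y" "finite A" "finite B" "card A = a" "card B = b - 1"
          using q by (auto simp: nsets_def)
        have "w v \<notin> B" using w(2) q(1) YAB by auto
        then have "card (B \<union> {w v}) = b" using YAB b' by simp
        moreover have "B \<inter> \<Union>((\<lambda>v. {w v}) ` V) = {}" "A \<inter> \<Union>((\<lambda>v. {w v}) ` V) = {}"
          using w(2) YAB by auto
        moreover have "A \<union> (B \<union> {w v}) = insert (w v) (A \<union> B)" by auto
        ultimately show "v \<in> V \<and> finite A \<and> finite B \<and> card A = a \<and> finite {w v} \<and>
          card (B \<union> {w v}) = b \<and> B \<inter> \<Union>((\<lambda>v. {w v}) ` V) = {} \<and> A \<inter> \<Union>((\<lambda>v. {w v}) ` V) = {} \<and>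
          A \<union> (B \<union> {w v}) \<in> H"
          using q YAB by simp
      qed
      then show False using free by simp
    qed
  qed
  then obtain W1 W2 where W1: "\<And>A. finite (W1 A) \<and> card (W1 A) \<le> M"
    and W2: "\<And>v B. finite (W2 v B) \<and> card (W2 v B) \<le> M"
    and cov: "\<And>A. \<exists>v\<in>V. \<forall>B. (v, A, B) \<in> P \<longrightarrow> B \<inter> W1 A \<noteq> {} \<or> A \<inter> W2 v B \<noteq> {}" by blast
  \<comment> \<open>Pairs of a set \<open>A\<close> and some \<open>(v, B)\<close> with
    \<open>A\<close> meeting \<open>W2 v B\<close> are counted. For the \<open>v\<close> that the
    cover gives to \<open>A\<close>, at most \<open>M * n ^ (b - 2)\<close> of the at least
    \<open>\<delta> * n ^ (b - 1)\<close> sets \<open>B\<close> meet \<open>W1 A\<close>, so at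
    least \<open>\<delta> / 2 * n ^ (b - 1)\<close> give such a pair. In turn \<open>W2 v B\<close>
    meets at most \<open>M * n ^ (a - 1)\<close> sets \<open>A\<close>.\<close>
  have "\<delta> / 2 * ?n ^ (b - 1) * real (card \<A>) \<le> real M * ?n ^ a' * real (card (V \<times> nsets Y (b - 1)))"
  proof (rule double_count_le[where R = "\<lambda>A (v, B). A \<inter> W2 v B \<noteq> {}"])
    show "finite \<A>" by (rule fA)
    show fVB: "finite (V \<times> nsets Y (b - 1))" using finite_UV fY by simp
    show "\<delta> / 2 * ?n ^ (b - 1) \<le> real (card {j \<in> V \<times> nsets Y (b - 1). case j of (v, B) \<Rightarrow> A \<inter> W2 v B \<noteq> {}})"
      if A: "A \<in> \<A>" for A
    proof -
      let ?J = "{j \<in> V \<times> nsets Y (b - 1). case j of (v, B) \<Rightarrow> A \<inter> W2 v B \<noteq> {}}"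
      obtain v where v: "v \<in> V" "\<And>B. (v, A, B) \<in> P \<Longrightarrow> B \<inter> W1 A \<noteq> {} \<or> A \<inter> W2 v B \<noteq> {}" using cov by blast
      let ?m = "{B \<in> nsets Y (Suc b'). B \<inter> W1 A \<noteq> {}}"
      have fJ: "finite ?J" using fVB by simp
      have fm: "finite (?m \<union> snd ` ?J)" using fY fJ by simp
      have "ext v A \<subseteq> ?m \<union> snd ` ?J"
      proof
        fix B assume B: "B \<in> ext v A"
        then have "(v, A, B) \<in> P" using v(1) A by (simp add: P_def)
        moreover have "B \<in> nsets Y (b - 1)" using B by (simp add: ext_def)
        ultimately show "B \<in> ?m \<union> snd ` ?J" using v b' by force
      qed
      then have "card (ext v A) \<le> card (?m \<union> snd ` ?J)" by (rule card_mono[OF fm])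
      also have "\<dots> \<le> card ?m + card (snd ` ?J)" by (rule card_Un_le)
      also have "\<dots> \<le> card ?m + card ?J" using card_image_le[OF fJ] by simp
      finally have "real (card (ext v A)) \<le> real (card ?m) + real (card ?J)" by linarith
      moreover have "real (card ?m) \<le> real M * ?n ^ b'"
        using card_nsets_meeting_le[OF Y, of "W1 A" M b'] W1 by blast
      moreover have "real M * ?n ^ b' \<le> \<delta> / 2 * ?n ^ (b - 1)"
      proof -
        have "real M \<le> \<delta> / 2 * ?n" using n \<delta> by (simp add: field_simps)
        then have "real M * ?n ^ b' \<le> (\<delta> / 2 * ?n) * ?n ^ b'" by (rule mult_right_mono) simp
        then show ?thesis using b' by (simp add: mult_ac)
      qed
      moreover have "\<delta> * ?n ^ (b - 1) \<le> real (card (ext v A))" using A v(1) by (simp add: \<A>_def)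
      ultimately show ?thesis by linarith
    qed
    show "real (card {A \<in> \<A>. case j of (v, B) \<Rightarrow> A \<inter> W2 v B \<noteq> {}}) \<le> real M * ?n ^ a'"
      if "j \<in> V \<times> nsets Y (b - 1)" for j
    proof -
      obtain v B where j: "j = (v, B)" by (cases j)
      have "card {A \<in> \<A>. A \<inter> W2 v B \<noteq> {}} \<le> card {A \<in> nsets Y (Suc a'). A \<inter> W2 v B \<noteq> {}}"
        using fY a' by (intro card_mono) (auto simp: \<A>_def)
      moreover have "real (card {A \<in> nsets Y (Suc a'). A \<inter> W2 v B \<noteq> {}}) \<le> real M * ?n ^ a'"
        using card_nsets_meeting_le[OF Y, of "W2 v B" M a'] W2 by blast
      ultimately show ?thesis using j by simp
    qed
  qed
  also have "\<dots> \<le> real M * ?n ^ a' * (real (card V) * ?n ^ (b - 1))"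
    unfolding card_cartesian_product of_nat_mult
    by (intro mult_left_mono real_card_nsets_le Y) auto
  finally have "real (card \<A>) * (\<delta> / 2 * ?n ^ (b - 1)) \<le> (2 * real (card V) * real M / \<delta> * ?n ^ (a - 1)) * (\<delta> / 2 * ?n ^ (b - 1))"
    using \<delta> a' by (simp add: mult_ac)
  then have "real (card \<A>) \<le> 2 * real (card V) * real M / \<delta> * ?n ^ (a - 1)"
    by (rule mult_right_le_imp_le) (use \<delta> n in simp)
  then show ?thesis by (simp add: \<A>_def ext_def)
qed


text \<open>\<open>few_sets_with_all_labels\<close> is applied to each of the at most
  \<open>2 ^ q\<close> subsets of \<open>W\<close> of size \<open>card V\<close>, with a bijection
  from \<open>V\<close> as the labelling.\<close>

lemma few_sets_with_many_labels:
  assumes free: "\<not> contains_copy H T" and Y: "finite Y" "card Y \<le> n"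
    and W: "finite W" "W \<inter> Y = {}" "card W \<le> q"
    and \<delta>: "0 < \<delta>" and n: "0 < n" "2 * real M / \<delta> \<le> real n"
  shows "real (card {A \<in> nsets Y a. card V \<le> card {w\<in>W. \<delta> * real n ^ (b - 1) \<le>
      real (card {B \<in> nsets Y (b - 1). A \<inter> B = {} \<and> insert w (A \<union> B) \<in> H})}}) \<le>
    2 ^ q * (2 * real (card V) * real M / \<delta> * real n ^ (a - 1))"
proof -
  define big where "big w A \<longleftrightarrow> \<delta> * real n ^ (b - 1) \<le>
      real (card {B \<in> nsets Y (b - 1). A \<inter> B = {} \<and> insert w (A \<union> B) \<in> H})" for w A
  define c where "c = 2 * real (card V) * real M / \<delta> * real n ^ (a - 1)"
  have c0: "0 \<le> c" using \<delta> by (simp add: c_def)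
  define I where "I = {W'\<in>Pow W. card W' = card V}"
  have fI: "finite I" using W by (simp add: I_def)
  have "real (card {A \<in> nsets Y a. card V \<le> card {w\<in>W. big w A}}) \<le> real (card I) * c"
  proof (rule card_cover_le[OF fI])
    show "{A \<in> nsets Y a. card V \<le> card {w\<in>W. big w A}} \<subseteq> (\<Union>W'\<in>I. {A \<in> nsets Y a. \<forall>w\<in>W'. big w A})"
    proof
      fix A assume A: "A \<in> {A \<in> nsets Y a. card V \<le> card {w\<in>W. big w A}}"
      then obtain W' where "W' \<subseteq> {w\<in>W. big w A}" "card W' = card V" by (metis (no_types, lifting) mem_Collect_eq obtain_subset_with_card_n)
      then show "A \<in> (\<Union>W'\<in>I. {A \<in> nsets Y a. \<forall>w\<in>W'. big w A})" using A by (auto simp: I_def)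
    qed
    show "finite {A \<in> nsets Y a. \<forall>w\<in>W'. big w A}" for W' using Y by (simp add: finite_imp_finite_nsets)
    fix W' assume W': "W' \<in> I"
    then have "finite W'" "card V = card W'" using W by (auto simp: I_def intro: finite_subset)
    then obtain w where w: "bij_betw w V W'"
      using finite_same_card_bij[OF finite_UV(2)] by blast
    have "{A \<in> nsets Y a. \<forall>w\<in>W'. big w A} = {A \<in> nsets Y a. \<forall>v\<in>V. big (w v) A}"
      using w by (auto simp: bij_betw_def)
    moreover have "real (card {A \<in> nsets Y a. \<forall>v\<in>V. big (w v) A}) \<le> c"
      unfolding big_def c_def
    proof (rule few_sets_with_all_labels[OF free Y])
      show "inj_on w V" "w ` V \<inter> Y = {}" using w W W' by (auto simp: bij_betw_def I_def)
    qed (use \<delta> n in auto)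
    ultimately show "real (card {A \<in> nsets Y a. \<forall>w\<in>W'. big w A}) \<le> c" by simp
  qed
  also have "\<dots> \<le> 2 ^ q * c"
  proof -
    have "card I \<le> card (Pow W)" using W by (intro card_mono) (auto simp: I_def)
    also have "\<dots> \<le> 2 ^ q" using W by (simp add: card_Pow)
    finally have "real (card I) \<le> 2 ^ q" by (metis of_nat_le_iff of_nat_numeral of_nat_power)
    then show ?thesis using c0 by (rule mult_right_mono)
  qed
  finally show ?thesis by (simp add: big_def c_def)
qed

section \<open>Stability\<close>

text \<open>All but few edges consist of a vertex of \<open>W\<close> and an
  \<open>(r - 1)\<close>-set \<open>D\<close> outside \<open>W\<close>. Thus \<open>card H\<close>
  is nearly the sum of the \<open>card (N D)\<close>, whose terms are almost always at most
  \<open>t - 1\<close>; the lower bound on \<open>card H\<close> forces almost all of them to equal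
  \<open>t - 1\<close>.\<close>

lemma stability:
  assumes "0 < (\<eta>::real)"
  shows "\<exists>n0. \<forall>(X::'a set) H. r_graph (a + b) X H \<longrightarrow> \<not> contains_copy H T \<longrightarrow> n0 \<le> card X \<longrightarrow>
    real (card X choose (a + b)) - real ((card X - (card V - 1)) choose (a + b)) \<le> real (card H) \<longrightarrow>
    (\<exists>L\<subseteq>X. card L = card V - 1 \<and>
      real (card {D \<in> nsets (X - L) (a + b - 1). \<exists>l\<in>L. insert l D \<notin> H}) \<le> \<eta> * real (card X) ^ (a + b - 1))"
proof -
  define m where "m = a + b - 2"
  define k where "k = Suc m"
  define t1 where "t1 = card V - 1"
  have ab: "a + b - 1 = k" "a + b = Suc k" "a \<le> m" "a + (b - 1) = k" "(b - 1) + (a - 1) = m"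
    using b_ge b_less by (auto simp: m_def k_def)
  have k0: "0 < real k" by (simp add: k_def)
  have V0: "card V \<noteq> 0" using V_nonempty finite_UV by simp
  \<comment> \<open>The first bound is half of the allowed error. The second ensures that the
    exceptional sets do not exhaust the \<open>k\<close>-subsets of \<open>Y\<close>.\<close>
  define \<eta>1 where "\<eta>1 = min (\<eta> / 2) ((1 / (4 * real k)) ^ k / 2)"
  have \<eta>1: "0 < \<eta>1" using assms k0 by (simp add: \<eta>1_def)
  have \<eta>1_le: "\<eta>1 \<le> \<eta> / 2" "\<eta>1 \<le> (1 / (4 * real k)) ^ k / 2"
    unfolding \<eta>1_def by (rule min.cobounded1, rule min.cobounded2)
  obtain \<delta>c n1 where \<delta>c: "0 < \<delta>c" and nc: "\<And>(X::'a set) Z (g :: 'a set \<Rightarrow> 'a set). finite X \<Longrightarrow> n1 \<le> card X \<Longrightarrow> Z \<subseteq> nsets X k \<Longrightarrow>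
     real (card Z) \<le> \<delta>c * real (card X) ^ k \<Longrightarrow>
     (\<forall>D\<in>nsets X k - Z. \<forall>D'\<in>nsets X k - Z. k \<le> Suc (card (D \<inter> D')) \<longrightarrow> g D = g D') \<Longrightarrow>
     (\<exists>c. real (card {D \<in> nsets X k. D \<in> Z \<or> g D \<noteq> c}) \<le> \<eta>1 * real (card X) ^ k)"
    using nearly_constant[OF \<eta>1, of k] by blast
  \<comment> \<open>\<open>Z\<close> will have at most \<open>5 * \<epsilon> * n ^ k\<close>
    members; \<open>Y\<close> has at least \<open>n / 2\<close> vertices, which accounts for
    \<open>2 ^ k\<close>.\<close>
  define \<epsilon> where "\<epsilon> = \<delta>c / (5 * 2 ^ k)"
  have \<epsilon>: "0 < \<epsilon>" using \<delta>c by (simp add: \<epsilon>_def)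
  obtain \<omega> n2 where \<omega>: "0 < \<omega>" and few: "\<And>(X::'a set) H. r_graph (a + b) X H \<Longrightarrow> \<not> contains_copy H T \<Longrightarrow> n2 \<le> card X \<Longrightarrow>
    real (card {e \<in> H. \<forall>v\<in>e. real (deg H {v}) < \<omega> * real (card X) ^ k}) \<le> \<epsilon> * real (card X) ^ k"
    using few_edges_without_heavy_vertex[OF \<epsilon>] unfolding ab(1) by blast
  \<comment> \<open>Bounds \<open>card W\<close>, since counting edges at the vertices of
    \<open>W\<close> gives \<open>\<omega> * n ^ k * card W \<le> r * K * n ^ k\<close>.\<close>
  define q where "q = max 1 (nat \<lceil>real (a + b) * K / \<omega>\<rceil>)"
  have q: "real (a + b) * K / \<omega> \<le> real q" "1 \<le> real q" unfolding q_def by linarith+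
  \<comment> \<open>\<open>X1\<close> has at most \<open>q * \<delta> * n ^ k\<close> members, each
    of weight up to \<open>q\<close> in the sum of the \<open>card (N D)\<close>; this choice makes
    their contribution at most \<open>\<epsilon> / 2 * n ^ k\<close>.\<close>
  define \<delta> where "\<delta> = \<epsilon> / (2 * real q ^ 2)"
  have \<delta>: "0 < \<delta>" using \<epsilon> q by (simp add: \<delta>_def)
  have q\<delta>: "real q * (real q * \<delta>) = \<epsilon> / 2" using q by (simp add: \<delta>_def power2_eq_square)
  define C where "C = 2 ^ q * (2 * real (card V) * real M / \<delta>)"
  have C: "0 \<le> C" using \<delta> by (simp add: C_def)
  define B where "B = max (max (2 * real q * C / \<epsilon>) (real q ^ 2 / \<epsilon>)) (max (real t1 ^ 2 / \<epsilon>) (max (2 * real M / \<delta>) (2 * real q / \<eta>)))"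
  define n0 where "n0 = nat \<lceil>B\<rceil> + 2 * n1 + n2 + 2 * q + 4 * k + t1 + 1"
  show ?thesis
  proof (intro exI[of _ n0] allI impI)
    fix X :: "'a set" and H
    assume H: "r_graph (a + b) X H" and free: "\<not> contains_copy H T" and n0: "n0 \<le> card X"
      and cH: "real (card X choose (a + b)) - real ((card X - (card V - 1)) choose (a + b)) \<le> real (card H)"
    note fin = r_graph_finite[OF H]
    let ?n = "real (card X)"
    have nB: "B \<le> ?n" and nn: "2 * n1 \<le> card X" "n2 \<le> card X" "2 * q \<le> card X" "4 * k \<le> card X" "t1 \<le> card X" "0 < card X"
      using n0 unfolding n0_def by linarith+
    have "2 * real q * C / \<epsilon> \<le> ?n" "real q ^ 2 / \<epsilon> \<le> ?n" "real t1 ^ 2 / \<epsilon> \<le> ?n" "2 * real M / \<delta> \<le> ?n" "2 * real q / \<eta> \<le> ?n"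
      using nB unfolding B_def by auto
    then have nb: "2 * real q * C \<le> \<epsilon> * ?n" "real q ^ 2 \<le> \<epsilon> * ?n" "real t1 ^ 2 \<le> \<epsilon> * ?n" "2 * real M / \<delta> \<le> ?n" "2 * real q \<le> \<eta> * ?n"
      using \<epsilon> \<delta> assms by (simp_all add: pos_divide_le_eq mult.commute)
    have scale: "x * ?n ^ m \<le> c * ?n ^ k" if "x \<le> c * ?n" for x c
      using mult_right_mono[OF that, of "?n ^ m"] by (simp add: k_def mult_ac)
    define W where "W = {v\<in>X. \<omega> * ?n ^ k \<le> real (deg H {v})}"
    define Y where "Y = X - W"
    have fW: "finite W" "W \<subseteq> X" and fY: "finite Y" using fin(1) by (auto simp: W_def Y_def)
    have cY: "card Y \<le> card X" using fin(1) by (auto simp: Y_def intro: card_mono)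
    have cW: "card W \<le> q"
    proof -
      have "(\<omega> * ?n ^ k) * real (card W) \<le> real (a + b) * real (card H)"
      proof (rule double_count_le[where R = "\<lambda>v e. {v} \<subseteq> e", OF fW(1) fin(2)])
        show "\<omega> * ?n ^ k \<le> real (card {e \<in> H. {v} \<subseteq> e})" if "v \<in> W" for v using that by (simp add: W_def deg_def)
        show "real (card {v \<in> W. {v} \<subseteq> e}) \<le> real (a + b)" if "e \<in> H" for e
        proof -
          have "card {v \<in> W. {v} \<subseteq> e} \<le> card e" using fin(3)[OF that] by (intro card_mono) auto
          then show ?thesis using fin(4)[OF that] by simp
        qed
      qed
      also have "\<dots> \<le> real (a + b) * (K * ?n ^ k)"
        using edges_le[OF H free] ab by (intro mult_left_mono) auto
      also have "\<dots> = (real (a + b) * K / \<omega>) * (\<omega> * ?n ^ k)" using \<omega> by simp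
      finally have "real (card W) * (\<omega> * ?n ^ k) \<le> (real (a + b) * K / \<omega>) * (\<omega> * ?n ^ k)" by (simp only: mult.commute)
      then have "real (card W) \<le> real (a + b) * K / \<omega>"
        by (rule mult_right_le_imp_le) (use \<omega> nn in simp)
      then show ?thesis using q by linarith
    qed
    have cY2: "?n / 2 \<le> real (card Y)"
    proof -
      have "card Y = card X - card W" unfolding Y_def using fW by (simp add: card_Diff_subset)
      then show ?thesis using cW nn by linarith
    qed
    define N where "N D = {w\<in>W. insert w D \<in> H}" for D
    define ext where "ext w A = {B \<in> nsets Y (b - 1). A \<inter> B = {} \<and> insert w (A \<union> B) \<in> H}" for w A
    \<comment> \<open>\<open>Ns A\<close> holds the vertices of \<open>W\<close> that are frequent
      at \<open>A\<close>. \<open>X1\<close> collects the sets \<open>D\<close> with a neighbour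
      that is not frequent at one of their parts, \<open>X2\<close> those with a part that has too
      many frequent vertices, and \<open>X3\<close> the remaining ones with too few
      neighbours.\<close>
    define Ns where "Ns A = {w\<in>W. \<delta> * ?n ^ (b - 1) \<le> real (card (ext w A))}" for A
    define X1 where "X1 = {D \<in> nsets Y k. \<exists>A\<subseteq>D. card A = a \<and> \<not> N D \<subseteq> Ns A}"
    define X2 where "X2 = {D \<in> nsets Y k. \<exists>A\<subseteq>D. card A = a \<and> card V \<le> card (Ns A)}"
    define X3 where "X3 = {D \<in> nsets Y k - (X1 \<union> X2). card (N D) < t1}"
    define Z where "Z = X1 \<union> X2 \<union> X3"
    have fN: "finite (N D)" "card (N D) \<le> q" for D
    proof -
      show "finite (N D)" using fW by (simp add: N_def)
      have "card (N D) \<le> card W" using fW by (intro card_mono) (auto simp: N_def)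
      then show "card (N D) \<le> q" using cW by simp
    qed
    have fNs: "finite (Ns A)" for A using fW by (simp add: Ns_def)
    have fns: "finite (nsets Y j)" for j using fY by (rule finite_imp_finite_nsets)
    have fX: "finite X1" "finite X2" "finite X3" using fns by (simp_all add: X1_def X2_def X3_def)
    have fext: "finite (ext w A)" for w A using fns by (simp add: ext_def)
    have split: "A \<in> nsets Y a \<and> D - A \<in> nsets Y (b - 1) \<and> D = A \<union> (D - A)"
      if "D \<in> nsets Y k" "A \<subseteq> D" "card A = a" for D A
    proof -
      have "finite A" using that finite_subset by (auto simp: nsets_def)
      then have "card (D - A) = b - 1" using that ab by (simp add: nsets_def card_Diff_subset)
      then show ?thesis using that \<open>finite A\<close> by (auto simp: nsets_def)
    qed
    have cX1: "real (card X1) \<le> real q * \<delta> * ?n ^ k"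
    proof -
      define S where "S A = (\<Union>w\<in>W - Ns A. (\<lambda>B. A \<union> B) ` ext w A)" for A
      have S: "real (card (S A)) \<le> real q * (\<delta> * ?n ^ (b - 1))" for A
      proof -
        have "real (card (S A)) \<le> real (card (W - Ns A)) * (\<delta> * ?n ^ (b - 1))"
        proof (rule card_cover_le)
          show "finite (W - Ns A)" using fW by simp
          show "S A \<subseteq> (\<Union>w\<in>W - Ns A. (\<lambda>B. A \<union> B) ` ext w A)" by (simp add: S_def)
          show "finite ((\<lambda>B. A \<union> B) ` ext w A)" for w using fext by simp
          show "real (card ((\<lambda>B. A \<union> B) ` ext w A)) \<le> \<delta> * ?n ^ (b - 1)" if "w \<in> W - Ns A" for w
          proof -
            have "\<not> \<delta> * ?n ^ (b - 1) \<le> real (card (ext w A))" using that by (simp add: Ns_def)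
            then show ?thesis using card_image_le[OF fext[of w A], of "\<lambda>B. A \<union> B"] by linarith
          qed
        qed
        also have "\<dots> \<le> real q * (\<delta> * ?n ^ (b - 1))"
        proof (rule mult_right_mono)
          have "card (W - Ns A) \<le> card W" by (rule card_mono[OF fW(1)]) simp
          then show "real (card (W - Ns A)) \<le> real q" using cW by simp
        qed (use \<delta> in simp)
        finally show ?thesis .
      qed
      have "real (card X1) \<le> real (card (nsets Y a)) * (real q * (\<delta> * ?n ^ (b - 1)))"
      proof (rule card_cover_le[OF fns])
        show "X1 \<subseteq> (\<Union>A\<in>nsets Y a. S A)"
        proof
          fix D assume "D \<in> X1"
          then obtain A w where D: "D \<in> nsets Y k" "A \<subseteq> D" "card A = a" "w \<in> N D" "w \<notin> Ns A"
            by (auto simp: X1_def)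
          note sp = split[OF D(1,2,3)]
          have "D - A \<in> ext w A" using D(4) sp by (auto simp: ext_def N_def)
          moreover have "w \<in> W - Ns A" using D by (auto simp: N_def)
          ultimately have "D \<in> S A" using sp unfolding S_def by blast
          then show "D \<in> (\<Union>A\<in>nsets Y a. S A)" using sp by blast
        qed
        show "finite (S A)" for A using fW fext by (simp add: S_def)
      qed (rule S)
      also have "\<dots> \<le> ?n ^ a * (real q * (\<delta> * ?n ^ (b - 1)))"
        using \<delta> by (intro mult_right_mono real_card_nsets_le fY cY) auto
      also have "\<dots> = real q * \<delta> * ?n ^ (a + (b - 1))" by (simp add: power_add)
      finally show ?thesis by (simp only: ab)
    qed
    have cX2: "real (card X2) \<le> C * ?n ^ m"
    proof -
      define A2 where "A2 = {A \<in> nsets Y a. card V \<le> card (Ns A)}"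
      have fA2: "finite A2" using fns by (simp add: A2_def)
      have "real (card A2) \<le> C * ?n ^ (a - 1)"
        using few_sets_with_many_labels[OF free fY cY fW(1) _ cW \<delta> _ nb(4)] nn
        unfolding A2_def Ns_def ext_def C_def by (auto simp: Y_def mult_ac)
      have "real (card X2) \<le> real (card A2) * ?n ^ (b - 1)"
      proof (rule card_cover_le[OF fA2])
        show "X2 \<subseteq> (\<Union>A\<in>A2. (\<lambda>B. A \<union> B) ` nsets Y (b - 1))"
        proof
          fix D assume "D \<in> X2"
          then obtain A where D: "D \<in> nsets Y k" "A \<subseteq> D" "card A = a" "card V \<le> card (Ns A)"
            by (auto simp: X2_def)
          then show "D \<in> (\<Union>A\<in>A2. (\<lambda>B. A \<union> B) ` nsets Y (b - 1))"
            using split[OF D(1,2,3)] unfolding A2_def by blast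
        qed
        show "finite ((\<lambda>B. A \<union> B) ` nsets Y (b - 1))" for A using fns by simp
        show "real (card ((\<lambda>B. A \<union> B) ` nsets Y (b - 1))) \<le> ?n ^ (b - 1)" for A
          using card_image_le[OF fns[of "b - 1"], of "\<lambda>B. A \<union> B"] real_card_nsets_le[OF fY cY, of "b - 1"] by linarith
      qed
      also have "\<dots> \<le> (C * ?n ^ (a - 1)) * ?n ^ (b - 1)"
        using \<open>real (card A2) \<le> C * ?n ^ (a - 1)\<close> by (rule mult_right_mono) simp
      also have "\<dots> = C * ?n ^ ((b - 1) + (a - 1))" by (simp add: power_add)
      finally show ?thesis by (simp only: ab)
    qed
    have cX12: "real q * real (card (X1 \<union> X2)) \<le> \<epsilon> * ?n ^ k"
    proof -
      have "real (card (X1 \<union> X2)) \<le> real (card X1) + real (card X2)" using card_Un_le[of X1 X2] by linarith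
      also have "\<dots> \<le> real q * \<delta> * ?n ^ k + C * ?n ^ m" using cX1 cX2 by simp
      finally have "real q * real (card (X1 \<union> X2)) \<le> real q * (real q * \<delta> * ?n ^ k + C * ?n ^ m)"
        by (rule mult_left_mono) simp
      also have "\<dots> = (real q * (real q * \<delta>)) * ?n ^ k + (real q * C) * ?n ^ m" by (simp add: algebra_simps)
      also have "(real q * C) * ?n ^ m \<le> (\<epsilon> / 2) * ?n ^ k" using nb(1) by (intro scale) simp
      finally show ?thesis unfolding q\<delta> by simp
    qed
    have N_le: "card (N D) \<le> t1" "N D \<subseteq> Ns A" "card (Ns A) \<le> t1"
      if "D \<in> nsets Y k" "D \<notin> X1 \<union> X2" "A \<subseteq> D" "card A = a" for D A
    proof -
      show 1: "N D \<subseteq> Ns A" using that by (auto simp: X1_def)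
      have "card (Ns A) < card V" using that by (force simp: X2_def)
      then show 2: "card (Ns A) \<le> t1" by (simp add: t1_def)
      then show "card (N D) \<le> t1" using card_mono[OF fNs 1] by simp
    qed
    have sub_a: "\<exists>A\<subseteq>D. card A = a" if "D \<in> nsets Y k" for D
    proof -
      have "a \<le> card D" using that ab by (simp add: nsets_def k_def)
      then show ?thesis by (meson obtain_subset_with_card_n)
    qed
    \<comment> \<open>Each term is at most \<open>t1\<close>, except on
      \<open>X1 \<union> X2\<close>, where it may reach \<open>q\<close>; each set in
      \<open>X3\<close> falls short of \<open>t1\<close> by at least 1.\<close>
    have sumN: "(\<Sum>D\<in>nsets Y k. real (card (N D))) \<le>
        real t1 * real (card (nsets Y k)) + real q * real (card (X1 \<union> X2)) - real (card X3)"
    proof -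
      have "(\<Sum>D\<in>nsets Y k. real (card (N D))) \<le>
          (\<Sum>D\<in>nsets Y k. real t1 + real q * of_bool (D \<in> X1 \<union> X2) - of_bool (D \<in> X3))"
      proof (rule sum_mono)
        fix D assume D: "D \<in> nsets Y k"
        obtain A where A: "A \<subseteq> D" "card A = a" using sub_a[OF D] by blast
        consider "D \<in> X1 \<union> X2" "D \<notin> X3" | "D \<notin> X1 \<union> X2" "D \<in> X3" | "D \<notin> X1 \<union> X2" "D \<notin> X3"
          by (auto simp: X3_def)
        then show "real (card (N D)) \<le> real t1 + real q * of_bool (D \<in> X1 \<union> X2) - of_bool (D \<in> X3)"
        proof cases
          case 1 then show ?thesis using fN(2)[of D] by simp
        next
          case 2 then show ?thesis by (auto simp: X3_def)
        next
          case 3 then show ?thesis using N_le(1)[OF D _ A] by simp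
        qed
      qed
      also have "\<dots> = real t1 * real (card (nsets Y k)) + real q * (\<Sum>D\<in>nsets Y k. of_bool (D \<in> X1 \<union> X2)) - (\<Sum>D\<in>nsets Y k. of_bool (D \<in> X3))"
        by (simp add: sum.distrib sum_subtractf sum_distrib_left mult.commute del: Ramsey.card_nsets)
      also have "(\<Sum>D\<in>nsets Y k. of_bool (D \<in> X1 \<union> X2)) = real (card (X1 \<union> X2))"
      proof -
        have "nsets Y k \<inter> {D. D \<in> X1 \<union> X2} = X1 \<union> X2" by (auto simp: X1_def X2_def)
        then show ?thesis using fns by (simp del: Un_iff)
      qed
      also have "(\<Sum>D\<in>nsets Y k. of_bool (D \<in> X3)) = real (card X3)"
      proof -
        have "nsets Y k \<inter> {D. D \<in> X3} = X3" by (auto simp: X3_def)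
        then show ?thesis using fns by simp
      qed
      finally show ?thesis .
    qed
    \<comment> \<open>Three kinds of edges: those avoiding \<open>W\<close>, those with at least two
      vertices in \<open>W\<close>, and those with exactly one, which the sum counts.\<close>
    have cH2: "real (card H) \<le> \<epsilon> * ?n ^ k + real q ^ 2 * ?n ^ m + (\<Sum>D\<in>nsets Y k. real (card (N D)))"
    proof -
      define E0 where "E0 = {e \<in> H. \<forall>v\<in>e. real (deg H {v}) < \<omega> * ?n ^ k}"
      define E1 where "E1 = (\<Union>w\<in>W. insert w ` {F \<in> nsets X (Suc m). F \<inter> W \<noteq> {}})"
      define E2 where "E2 = (\<Union>D\<in>nsets Y k. (\<lambda>w. insert w D) ` N D)"
      have "H \<subseteq> E0 \<union> E1 \<union> E2"
      proof
        fix e assume e: "e \<in> H"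
        note fe = fin(3,4,5)[OF e]
        show "e \<in> E0 \<union> E1 \<union> E2"
        proof (cases "e \<inter> W = {}")
          case True
          then have "e \<in> E0" using e fe by (auto simp: E0_def W_def not_le)
          then show ?thesis by simp
        next
          case False
          then obtain w where w: "w \<in> e" "w \<in> W" by auto
          have ew: "e - {w} \<in> nsets X k" "e = insert w (e - {w})" using fe w ab by (auto simp: nsets_def)
          show ?thesis
          proof (cases "(e - {w}) \<inter> W = {}")
            case True
            then have "e - {w} \<in> nsets Y k" using ew by (auto simp: nsets_def Y_def)
            moreover have "w \<in> N (e - {w})" using w ew e by (simp add: N_def)
            ultimately have "e \<in> E2" using ew(2) unfolding E2_def by blast
            then show ?thesis by simp
          next
            case False
            then have "e \<in> E1" using ew w unfolding E1_def k_def by blast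
            then show ?thesis by simp
          qed
        qed
      qed
      moreover have fE: "finite E0" "finite E1" "finite E2"
        using fin fW fns fN by (auto simp: E0_def E1_def E2_def finite_imp_finite_nsets)
      ultimately have "card H \<le> card (E0 \<union> E1 \<union> E2)" by (intro card_mono) auto
      also have "\<dots> \<le> card E0 + card E1 + card E2"
        using card_Un_le[of "E0 \<union> E1" E2] card_Un_le[of E0 E1] by linarith
      finally have "real (card H) \<le> real (card E0) + real (card E1) + real (card E2)" by linarith
      moreover have "real (card E0) \<le> \<epsilon> * ?n ^ k" unfolding E0_def by (rule few[OF H free nn(2)])
      moreover have "real (card E1) \<le> real q ^ 2 * ?n ^ m"
      proof -
        have "real (card E1) \<le> real (card W) * (real q * ?n ^ m)"
        proof (rule card_cover_le[OF fW(1)])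
          show "E1 \<subseteq> (\<Union>w\<in>W. insert w ` {F \<in> nsets X (Suc m). F \<inter> W \<noteq> {}})" by (simp add: E1_def)
          have fi: "finite {F \<in> nsets X (Suc m). F \<inter> W \<noteq> {}}" using fin(1) by (simp add: finite_imp_finite_nsets)
          then show "finite (insert w ` {F \<in> nsets X (Suc m). F \<inter> W \<noteq> {}})" for w by simp
          show "real (card (insert w ` {F \<in> nsets X (Suc m). F \<inter> W \<noteq> {}})) \<le> real q * ?n ^ m" for w
            using card_image_le[OF fi, of "insert w"] card_nsets_meeting_le[OF fin(1) order_refl fW(1) cW, of m] by linarith
        qed
        also have "\<dots> \<le> real q * (real q * ?n ^ m)" using cW by (intro mult_right_mono) auto
        finally show ?thesis by (simp add: power2_eq_square)
      qed
      moreover have "real (card E2) \<le> (\<Sum>D\<in>nsets Y k. real (card (N D)))"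
      proof -
        have "card E2 \<le> (\<Sum>D\<in>nsets Y k. card ((\<lambda>w. insert w D) ` N D))"
          unfolding E2_def by (rule card_UN_le[OF fns])
        also have "\<dots> \<le> (\<Sum>D\<in>nsets Y k. card (N D))" by (intro sum_mono card_image_le fN)
        finally show ?thesis by (simp only: of_nat_sum[symmetric] of_nat_le_iff)
      qed
      ultimately show ?thesis by linarith
    qed
    \<comment> \<open>Four errors of \<open>\<epsilon> * n ^ k\<close> each: the edges avoiding
      \<open>W\<close>, the edges meeting \<open>W\<close> at least twice, the sets in
      \<open>X1 \<union> X2\<close>, and the change from \<open>n - t1\<close> to \<open>n\<close>
      in the binomial.\<close>
    have cX3: "real (card X3) \<le> 4 * \<epsilon> * ?n ^ k"
    proof -
      have "real t1 * real ((card X - t1) choose k) \<le> real (card X choose Suc k) - real ((card X - t1) choose Suc k)"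
        by (rule binomial_diff_ge[OF nn(5)])
      also have "\<dots> \<le> real (card H)" using cH unfolding ab(2) t1_def by simp
      finally have 1: "real t1 * real ((card X - t1) choose k) \<le> real (card H)" .
      have "real (card X choose k) - real ((card X - t1) choose k) \<le> real t1 * ?n ^ m"
        unfolding k_def by (rule binomial_diff_le)
      then have "real t1 * (real (card X choose k) - real ((card X - t1) choose k)) \<le> real t1 * (real t1 * ?n ^ m)"
        by (rule mult_left_mono) simp
      then have 2: "real t1 * real (card X choose k) - real t1 * real ((card X - t1) choose k) \<le> real t1 ^ 2 * ?n ^ m"
        by (simp add: algebra_simps power2_eq_square)
      have "card (nsets Y k) \<le> card X choose k" using cY by (simp add: binomial_right_mono)
      then have 3: "real t1 * real (card (nsets Y k)) \<le> real t1 * real (card X choose k)"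
        by (intro mult_left_mono) simp_all
      have "real t1 ^ 2 * ?n ^ m \<le> \<epsilon> * ?n ^ k" "real q ^ 2 * ?n ^ m \<le> \<epsilon> * ?n ^ k"
        using nb(2,3) by (auto intro: scale)
      then show ?thesis using 1 2 3 sumN cH2 cX12 by linarith
    qed
    have cZ: "real (card Z) \<le> \<delta>c * real (card Y) ^ k"
    proof -
      have "real (card Z) \<le> real (card (X1 \<union> X2)) + real (card X3)"
        unfolding Z_def using card_Un_le[of "X1 \<union> X2" X3] by linarith
      moreover have "real (card (X1 \<union> X2)) \<le> real q * real (card (X1 \<union> X2))"
        using mult_right_mono[OF q(2), of "real (card (X1 \<union> X2))"] by simp
      ultimately have "real (card Z) \<le> 5 * \<epsilon> * ?n ^ k" using cX12 cX3 by linarith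
      also have "\<dots> = \<delta>c * (?n / 2) ^ k" by (simp add: \<epsilon>_def power_divide)
      also have "\<dots> \<le> \<delta>c * real (card Y) ^ k" using cY2 \<delta>c by (intro mult_left_mono power_mono) auto
      finally show ?thesis .
    qed
    have "\<exists>c. real (card {D \<in> nsets Y k. D \<in> Z \<or> N D \<noteq> c}) \<le> \<eta>1 * real (card Y) ^ k"
    proof (rule nc[OF fY _ _ cZ])
      show "n1 \<le> card Y" using cY2 nn by linarith
      show "Z \<subseteq> nsets Y k" by (auto simp: Z_def X1_def X2_def X3_def)
      show "\<forall>D\<in>nsets Y k - Z. \<forall>D'\<in>nsets Y k - Z. k \<le> Suc (card (D \<inter> D')) \<longrightarrow> N D = N D'"
      proof (intro ballI impI)
        fix D D' assume D: "D \<in> nsets Y k - Z" "D' \<in> nsets Y k - Z" and le: "k \<le> Suc (card (D \<inter> D'))"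
        \<comment> \<open>As \<open>b \<ge> 2\<close>, sets sharing \<open>k - 1\<close> vertices
          have a common \<open>a\<close>-subset \<open>A\<close>. Both \<open>N D\<close> and
          \<open>N D'\<close> lie in \<open>Ns A\<close> and have at least as many elements, so both
          equal it.\<close>
        have "a \<le> card (D \<inter> D')" using le ab by (simp add: k_def)
        then obtain A where A: "A \<subseteq> D \<inter> D'" "card A = a" by (meson obtain_subset_with_card_n)
        have eq: "N D0 = Ns A" if "D0 \<in> nsets Y k - Z" "A \<subseteq> D0" for D0
        proof (rule card_seteq[OF fNs])
          show "N D0 \<subseteq> Ns A" using N_le(2)[of D0 A] that A by (auto simp: Z_def)
          have "card (Ns A) \<le> t1" using N_le(3)[of D0 A] that A by (auto simp: Z_def)
          moreover have "t1 \<le> card (N D0)" using that by (force simp: Z_def X3_def)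
          ultimately show "card (Ns A) \<le> card (N D0)" by simp
        qed
        show "N D = N D'" using eq[OF D(1)] eq[OF D(2)] A by auto
      qed
    qed
    then obtain L where L: "real (card {D \<in> nsets Y k. D \<in> Z \<or> N D \<noteq> L}) \<le> \<eta>1 * real (card Y) ^ k" by blast
    define Ex where "Ex = {D \<in> nsets Y k. D \<in> Z \<or> N D \<noteq> L}"
    have fEx: "finite Ex" using fns by (simp add: Ex_def)
    have cEx: "real (card Ex) \<le> \<eta>1 * ?n ^ k"
    proof -
      have "\<eta>1 * real (card Y) ^ k \<le> \<eta>1 * ?n ^ k" using cY \<eta>1 by (intro mult_left_mono power_mono) auto
      then show ?thesis using L unfolding Ex_def by linarith
    qed
    \<comment> \<open>So far \<open>L\<close> is an arbitrary set. One \<open>k\<close>-set outside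
      \<open>Ex\<close> shows that it is some \<open>N D0\<close>, hence lies in \<open>W\<close>
      and has \<open>t1\<close> elements.\<close>
    obtain D0 where D0: "D0 \<in> nsets Y k" "D0 \<notin> Ex"
    proof -
      have "real (card Ex) < (real (card Y) / (2 * real k)) ^ k"
      proof -
        have eq: "(1 / (4 * real k)) ^ k * ?n ^ k = (?n / 2 / (2 * real k)) ^ k"
          unfolding power_mult_distrib[symmetric] by (rule arg_cong[of _ _ "\<lambda>x. x ^ k"]) simp
        have pos: "0 < (?n / 2 / (2 * real k)) ^ k" using nn(6) k0 by (intro zero_less_power) simp
        have "\<eta>1 * ?n ^ k \<le> (1 / (4 * real k)) ^ k / 2 * ?n ^ k"
          by (rule mult_right_mono[OF \<eta>1_le(2)]) simp
        also have "\<dots> = (?n / 2 / (2 * real k)) ^ k / 2" using eq by (simp only: times_divide_eq_left)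
        also have "\<dots> < (?n / 2 / (2 * real k)) ^ k" using pos by linarith
        also have "\<dots> \<le> (real (card Y) / (2 * real k)) ^ k"
          using cY2 k0 by (intro power_mono divide_right_mono) auto
        finally show ?thesis using cEx by linarith
      qed
      moreover have "2 * k \<le> card Y" using cY2 nn(4) by linarith
      ultimately show ?thesis using nsets_avoiding[OF fY _ _ _ _ fEx, of k "{}"] that k_def by auto
    qed
    then have D0': "D0 \<notin> Z" "N D0 = L" by (auto simp: Ex_def)
    obtain A0 where A0: "A0 \<subseteq> D0" "card A0 = a" using sub_a[OF D0(1)] by blast
    have D0'': "D0 \<notin> X1 \<union> X2" "D0 \<notin> X3" using D0'(1) unfolding Z_def by simp_all
    have "card (N D0) \<le> t1" by (rule N_le(1)[OF D0(1) D0''(1) A0])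
    moreover have "\<not> card (N D0) < t1" using D0(1) D0'' unfolding X3_def by simp
    ultimately have cL: "card L = t1" using D0'(2) by simp
    have LW: "L \<subseteq> W" using D0' by (auto simp: N_def)
    let ?Miss = "{D \<in> nsets (X - L) k. \<exists>l\<in>L. insert l D \<notin> H}"
    let ?Q = "{D \<in> nsets X (Suc m). D \<inter> W \<noteq> {}}"
    have "?Miss \<subseteq> Ex \<union> ?Q"
    proof
      fix D assume D: "D \<in> ?Miss"
      show "D \<in> Ex \<union> ?Q"
      proof (cases "D \<inter> W = {}")
        case True
        then have "D \<in> nsets Y k" using D by (auto simp: nsets_def Y_def)
        moreover have "N D \<noteq> L" using D LW by (auto simp: N_def)
        ultimately show ?thesis by (simp add: Ex_def)
      next
        case False then show ?thesis using D by (auto simp: nsets_def k_def)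
      qed
    qed
    moreover have "finite (Ex \<union> ?Q)" using fEx fin(1) by (simp add: finite_imp_finite_nsets)
    ultimately have "card ?Miss \<le> card (Ex \<union> ?Q)" by (intro card_mono)
    also have "\<dots> \<le> card Ex + card ?Q" by (rule card_Un_le)
    finally have "real (card ?Miss) \<le> real (card Ex) + real (card ?Q)" by linarith
    moreover have "real (card ?Q) \<le> real q * ?n ^ m"
      by (rule card_nsets_meeting_le[OF fin(1) order_refl fW(1) cW])
    moreover have "real q * ?n ^ m \<le> \<eta> / 2 * ?n ^ k" using nb(5) by (intro scale) simp
    moreover have "\<eta>1 * ?n ^ k \<le> \<eta> / 2 * ?n ^ k" by (rule mult_right_mono[OF \<eta>1_le(1)]) simp
    ultimately have "real (card ?Miss) \<le> \<eta> * ?n ^ k" using cEx by linarith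
    then show "\<exists>L\<subseteq>X. card L = card V - 1 \<and>
      real (card {D \<in> nsets (X - L) (a + b - 1). \<exists>l\<in>L. insert l D \<notin> H}) \<le> \<eta> * real (card X) ^ (a + b - 1)"
      using cL LW fW(2) unfolding ab(1) t1_def by (intro exI[of _ L]) auto
  qed
qed


section \<open>The exact result\<close>

text \<open>Here \<open>e0 - A\<close> replaces the critical leaf and \<open>A\<close> its neighbour, while all other pairs are embedded
  completely, without using the tree structure.\<close>

lemma copy_via_critical_leaf:
  fixes \<nu> :: real
  assumes x: "x \<in> V" "vertex_degree E x = 1"
    and X: "finite X" "L \<subseteq> X" "card L = card V - 1"
    and e0: "e0 \<in> H" "e0 \<subseteq> X" "card e0 = a + b" "e0 \<inter> L = {}" and A: "A \<subseteq> e0" "card A = a"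
  defines "Y \<equiv> X - L"
  defines "Miss \<equiv> {D \<in> nsets (X - L) (a + b - 1). \<exists>l\<in>L. insert l D \<notin> H}"
  assumes few: "real (card {B \<in> nsets Y (b - 1). A \<inter> B = {} \<and> A \<union> B \<in> Miss}) +
      real (card {B \<in> nsets Y (b - 1). \<nu> < real (card {A' \<in> nsets Y a. A' \<inter> B = {} \<and> A' \<union> B \<in> Miss})})
      < (real (card Y) / (2 * real (b - 1))) ^ (b - 1)"
    and \<nu>: "0 \<le> \<nu>" "real (card V) * \<nu> < (real (card Y) / (2 * real a)) ^ a"
    and big: "2 * ((a + b) + (a + b) * (card U + card V)) \<le> card Y"
  shows "contains_copy H T"
proof -
  have UV: "U \<inter> V = {}" using bip by (simp add: bipartition_def)
  have "card {e \<in> E. x \<in> e} = 1" using x(2) by (simp add: vertex_degree_def)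
  then obtain ex where ex: "{e \<in> E. x \<in> e} = {ex}" by (rule card_1_singletonE)
  then have "ex \<in> E" "x \<in> ex" by auto
  moreover have "\<forall>e\<in>E. \<exists>u\<in>U. \<exists>v\<in>V. e = {u, v}" using bip by (simp add: bipartition_def)
  ultimately obtain u0 v0 where u0v0: "u0 \<in> U" "v0 \<in> V" "ex = {u0, v0}" by blast
  then have "v0 = x" using \<open>x \<in> ex\<close> UV x(1) by auto
  then have u0: "u0 \<in> U" "ex = {u0, x}" using u0v0 by simp_all
  have uniq: "u = u0" if "{u, x} \<in> E" "u \<in> U" for u
  proof -
    have "{u, x} \<in> {e \<in> E. x \<in> e}" using that by simp
    then have "{u, x} = {u0, x}" unfolding ex u0(2) by simp
    then show ?thesis using that UV x(1) by (auto simp: doubleton_eq_iff)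
  qed
  define V' where "V' = V - {x}"
  have fV': "finite V'" "card V' = card L" "card V' \<le> card V" using finite_UV x X by (auto simp: V'_def)
  have fL: "finite L" and fY: "finite Y" and fe0: "finite e0" using X e0 finite_subset by (auto simp: Y_def)
  obtain lab where lab: "bij_betw lab V' L" using finite_same_card_bij[OF fV'(1) fL fV'(2)] by blast
  have fns: "finite (nsets Y j)" for j using fY by (rule finite_imp_finite_nsets)
  have AY: "A \<subseteq> Y" "e0 \<subseteq> Y" "finite A" using A e0 fe0 finite_subset by (auto simp: Y_def)
  \<comment> \<open>Forbidden choices for blocks of \<open>V'\<close>: those in \<open>S1\<close>
    fail with \<open>A\<close>, the block of the neighbour of the leaf, and those in
    \<open>S2\<close> fail with more than \<open>\<nu>\<close> possible blocks for vertices of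
    \<open>U\<close>.\<close>
  define S1 where "S1 = {B \<in> nsets Y (b - 1). A \<inter> B = {} \<and> A \<union> B \<in> Miss}"
  define S2 where "S2 = {B \<in> nsets Y (b - 1). \<nu> < real (card {A' \<in> nsets Y a. A' \<inter> B = {} \<and> A' \<union> B \<in> Miss})}"
  have cS: "real (card (S1 \<union> S2)) < (real (card Y) / (2 * real (b - 1))) ^ (b - 1)"
    using few card_Un_le[of S1 S2] unfolding S1_def[symmetric] S2_def[symmetric] by linarith
  have fS: "finite (S1 \<union> S2)" using fns by (simp add: S1_def S2_def)
  have "(b - 1) * card V' \<le> (a + b) * card V" using fV'(3) by (intro mult_mono) auto
  then have big1: "2 * (card e0 + (b - 1) * card V') \<le> card Y" using big e0(3) by (simp add: algebra_simps)
  have big2: "2 * (a + b) \<le> card Y" by (rule order_trans[OF _ big]) simp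
  have "\<exists>f. (\<forall>v\<in>V'. f v \<in> nsets Y (b - 1) \<and> f v \<inter> e0 = {} \<and> f v \<notin> S1 \<union> S2) \<and> disjoint_family_on f V'"
    using big1 big2 b_ge by (intro disjoint_nsets_avoiding fV'(1) fY fe0 fS cS) auto
  then obtain f where f: "\<And>v. v \<in> V' \<Longrightarrow> f v \<in> nsets Y (b - 1) \<and> f v \<inter> e0 = {} \<and> f v \<notin> S1 \<union> S2"
    and fd: "disjoint_family_on f V'" by blast
  define U' where "U' = U - {u0}"
  have fU': "finite U'" "card U' \<le> card U" using finite_UV by (auto simp: U'_def intro: card_mono)
  \<comment> \<open>Blocks that fail with some chosen \<open>f v\<close>. As the \<open>f v\<close>
    avoid \<open>S2\<close>, there are at most \<open>card V * \<nu>\<close> of them.\<close>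
  define S3 where "S3 = (\<Union>v\<in>V'. {A' \<in> nsets Y a. A' \<inter> f v = {} \<and> A' \<union> f v \<in> Miss})"
  have fS3: "finite S3" using fV' fns by (simp add: S3_def)
  have "real (card S3) \<le> real (card V') * \<nu>"
    unfolding S3_def
  proof (rule card_cover_le[OF fV'(1) subset_refl])
    show "finite {A' \<in> nsets Y a. A' \<inter> f v = {} \<and> A' \<union> f v \<in> Miss}" for v using fns by simp
    show "real (card {A' \<in> nsets Y a. A' \<inter> f v = {} \<and> A' \<union> f v \<in> Miss}) \<le> \<nu>" if "v \<in> V'" for v
      using f[OF that] by (simp add: S2_def not_less)
  qed
  also have "\<dots> \<le> real (card V) * \<nu>" using fV'(3) \<nu> by (intro mult_right_mono) auto
  finally have cS3: "real (card S3) < (real (card Y) / (2 * real a)) ^ a" using \<nu> by linarith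
  define F where "F = e0 \<union> (\<Union>v\<in>V'. f v)"
  have ff: "finite (f v)" "card (f v) = b - 1" "f v \<subseteq> Y" "f v \<inter> e0 = {}" if "v \<in> V'" for v
    using f[OF that] by (auto simp: nsets_def)
  have fF: "finite F" using fe0 fV' ff by (simp add: F_def)
  have "card (\<Union>v\<in>V'. f v) \<le> (\<Sum>v\<in>V'. card (f v))" by (rule card_UN_le[OF fV'(1)])
  also have "\<dots> = card V' * (b - 1)" using ff by simp
  also have "\<dots> \<le> card V * (a + b)" using fV'(3) by (intro mult_mono) auto
  finally have cF: "card F \<le> (a + b) + card V * (a + b)"
    using card_Un_le[of e0 "\<Union>v\<in>V'. f v"] e0(3) unfolding F_def by linarith
  have "a * card U' \<le> (a + b) * card U" using fU' by (intro mult_mono) auto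
  then have big3: "2 * (card F + a * card U') \<le> card Y" using big cF by (simp add: algebra_simps)
  have "\<exists>g. (\<forall>u\<in>U'. g u \<in> nsets Y a \<and> g u \<inter> F = {} \<and> g u \<notin> S3) \<and> disjoint_family_on g U'"
    using big3 big2 b_less by (intro disjoint_nsets_avoiding fU'(1) fY fF fS3 cS3) auto
  then obtain g where g: "\<And>u. u \<in> U' \<Longrightarrow> g u \<in> nsets Y a \<and> g u \<inter> F = {} \<and> g u \<notin> S3"
    and gd: "disjoint_family_on g U'" by blast
  have gg: "finite (g u)" "card (g u) = a" "g u \<subseteq> Y" "g u \<inter> e0 = {}" "\<And>v. v \<in> V' \<Longrightarrow> g u \<inter> f v = {}" if "u \<in> U'" for u
    using g[OF that] by (auto simp: nsets_def F_def)
  \<comment> \<open>A union outside \<open>Miss\<close> forms an edge with every vertex of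
    \<open>L\<close>, so any bijection from \<open>V'\<close> to \<open>L\<close> can serve as
    \<open>lab\<close>.\<close>
  have hit: "insert (lab v) (S \<union> f v) \<in> H" if v: "v \<in> V'" and S: "S \<in> nsets Y a" "S \<inter> f v = {}" "S \<union> f v \<notin> Miss" for v S
  proof -
    have "card (S \<union> f v) = a + b - 1" using S ff[OF v] b_ge by (subst card_Un_disjoint) (auto simp: nsets_def)
    then have "S \<union> f v \<in> nsets (X - L) (a + b - 1)" using S ff[OF v] by (auto simp: nsets_def Y_def)
    moreover have "lab v \<in> L" using lab v by (auto simp: bij_betw_def)
    ultimately show ?thesis using S(3) by (auto simp: Miss_def)
  qed
  define \<phi> where "\<phi> y = (if y = x then e0 - A else if y = u0 then A else if y \<in> V' then insert (lab y) (f y) else g y)" for y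
  have xu: "x \<noteq> u0" using u0 x UV by auto
  have \<phi>x: "\<phi> x = e0 - A" and \<phi>u0: "\<phi> u0 = A" using xu by (simp_all add: \<phi>_def)
  have \<phi>V: "\<phi> v = insert (lab v) (f v)" if "v \<in> V'" for v
    using that u0 UV by (auto simp: \<phi>_def V'_def)
  have \<phi>U: "\<phi> u = g u" if "u \<in> U'" for u using that x UV by (auto simp: \<phi>_def V'_def U'_def)
  have labL: "lab v \<in> L" if "v \<in> V'" for v using lab that by (auto simp: bij_betw_def)
  have LY: "L \<inter> Y = {}" by (auto simp: Y_def)
  show ?thesis
  proof (rule contains_copy_blowupI[where \<phi> = \<phi>])
    show "finite (\<phi> u) \<and> card (\<phi> u) = a" if "u \<in> U" for u
      using that \<phi>u0 A AY \<phi>U[of u] gg[of u] by (cases "u = u0") (auto simp: U'_def)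
    show "finite (\<phi> v) \<and> card (\<phi> v) = b" if "v \<in> V" for v
    proof (cases "v = x")
      case True then show ?thesis using \<phi>x A AY fe0 e0 by (simp add: card_Diff_subset)
    next
      case False
      then have v: "v \<in> V'" using that by (simp add: V'_def)
      then have "lab v \<notin> f v" using labL[OF v] ff(3)[OF v] LY by auto
      then show ?thesis using \<phi>V[OF v] ff[OF v] b_ge by simp
    qed
    show "disjoint_family_on \<phi> (U \<union> V)"
    proof -
      have d1: "\<phi> x \<inter> \<phi> u0 = {}" using \<phi>x \<phi>u0 by auto
      have d2: "\<phi> x \<inter> \<phi> v = {}" "\<phi> u0 \<inter> \<phi> v = {}" if "v \<in> V'" for v
        using \<phi>V[OF that] \<phi>x \<phi>u0 ff(4)[OF that] labL[OF that] e0(4) A by auto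
      have d3: "\<phi> x \<inter> \<phi> u = {}" "\<phi> u0 \<inter> \<phi> u = {}" if "u \<in> U'" for u
        using \<phi>U[OF that] \<phi>x \<phi>u0 gg(4)[OF that] A by auto
      have d4: "\<phi> u \<inter> \<phi> v = {}" if "u \<in> U'" "v \<in> V'" for u v
        using \<phi>U[OF that(1)] \<phi>V[OF that(2)] gg(3,5)[OF that(1)] that(2) labL[OF that(2)] LY by auto
      have d5: "\<phi> v \<inter> \<phi> w = {}" if "v \<in> V'" "w \<in> V'" "v \<noteq> w" for v w
      proof -
        have "lab v \<noteq> lab w" using lab that unfolding bij_betw_def inj_on_def by blast
        moreover have "f v \<inter> f w = {}" using fd that unfolding disjoint_family_on_def by blast
        ultimately show ?thesis
          using \<phi>V that labL[OF that(1)] labL[OF that(2)] ff(3)[OF that(1)] ff(3)[OF that(2)] LY by auto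
      qed
      have d6: "\<phi> u \<inter> \<phi> w = {}" if "u \<in> U'" "w \<in> U'" "u \<noteq> w" for u w
        using gd that \<phi>U unfolding disjoint_family_on_def by auto
      have cases: "y = x \<or> y = u0 \<or> y \<in> V' \<or> y \<in> U'" if "y \<in> U \<union> V" for y
        using that by (auto simp: U'_def V'_def)
      show ?thesis
        unfolding disjoint_family_on_def
      proof (intro ballI impI)
        fix y z assume yz: "y \<in> U \<union> V" "z \<in> U \<union> V" "y \<noteq> z"
        show "\<phi> y \<inter> \<phi> z = {}"
          using cases[OF yz(1)] cases[OF yz(2)] yz(3)
          by (elim disjE) (simp_all add: d1 d2 d3 d4 d5 d6 
            d1[THEN trans[OF Int_commute]] d2[THEN trans[OF Int_commute]]
            d3[THEN trans[OF Int_commute]] d4[THEN trans[OF Int_commute]])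
      qed
    qed
    fix u v assume uv: "u \<in> U" "v \<in> V" "{u, v} \<in> E"
    show "\<phi> u \<union> \<phi> v \<in> H"
    proof (cases "v = x")
      case True
      then have "u = u0" using uniq uv by simp
      moreover have "A \<union> (e0 - A) = e0" using A by auto
      ultimately show ?thesis using True \<phi>x \<phi>u0 e0(1) by simp
    next
      case False
      then have v: "v \<in> V'" using uv by (simp add: V'_def)
      show ?thesis
      proof (cases "u = u0")
        case True
        have "A \<inter> f v = {}" using ff(4)[OF v] A by auto
        moreover have "A \<union> f v \<notin> Miss" using f[OF v] calculation by (auto simp: S1_def)
        moreover have "A \<in> nsets Y a" using A AY by (simp add: nsets_def)
        ultimately have "insert (lab v) (A \<union> f v) \<in> H" using hit[OF v] by blast
        then show ?thesis using True \<phi>u0 \<phi>V[OF v] by simp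
      next
        case False
        then have u: "u \<in> U'" using uv by (simp add: U'_def)
        have "g u \<union> f v \<notin> Miss" using g[OF u] gg(5)[OF u v] v unfolding S3_def by blast
        then have "insert (lab v) (g u \<union> f v) \<in> H" using hit[OF v] g[OF u] gg(5)[OF u v] by blast
        then show ?thesis using \<phi>U[OF u] \<phi>V[OF v] by simp
      qed
    qed
  qed
qed

text \<open>Let \<open>PL\<close> be the family of all \<open>r\<close>-sets meeting
  \<open>L\<close>, and \<open>H0\<close> the edges of \<open>H\<close> avoiding \<open>L\<close>.
  Since \<open>card H \<ge> card PL\<close>, the family \<open>PL - H\<close> has at most
  \<open>card H0\<close> members; each set in \<open>Miss\<close> yields its own member of
  \<open>PL - H\<close>; and \<open>card H0 \<le> card Miss / 2\<close>. Together these force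
  \<open>H0\<close> and \<open>PL - H\<close> to be empty.\<close>

lemma extremal_structure:
  assumes x: "x \<in> V" "vertex_degree E x = 1"
  shows "\<exists>n0. \<forall>(X::'a set) H. r_graph (a + b) X H \<longrightarrow> \<not> contains_copy H T \<longrightarrow> n0 \<le> card X \<longrightarrow>
    (card X choose (a + b)) - ((card X - (card V - 1)) choose (a + b)) \<le> card H \<longrightarrow>
    (\<exists>L\<subseteq>X. card L = card V - 1 \<and> H = {e \<in> nsets X (a + b). e \<inter> L \<noteq> {}})"
proof -
  define p where "p = b - 1"
  define k where "k = a + b - 1"
  have ab: "k = a + p" "k = p + a" "a + b = Suc k" "b = Suc p" "1 \<le> p" "1 \<le> a"
    using b_ge b_less by (auto simp: k_def p_def)
  have V0: "card V \<noteq> 0" using V_nonempty finite_UV by simp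
  \<comment> \<open>As \<open>Y\<close> has at least half of the vertices, \<open>c1 * n ^ p\<close>
    and \<open>c2 * n ^ a\<close> do not exceed the thresholds of
    \<open>copy_via_critical_leaf\<close>.\<close>
  define c1 where "c1 = (1 / (4 * real p)) ^ p"
  define c2 where "c2 = (1 / (4 * real a)) ^ a"
  have c: "0 < c1" "0 < c2" using ab by (simp_all add: c1_def c2_def)
  define \<delta> where "\<delta> = c1 / 2"
  have \<delta>: "0 < \<delta>" using c by (simp add: \<delta>_def)
  \<comment> \<open>The denominator cancels the factor \<open>2 ^ k\<close> of \<open>cB\<close> and
    the constant \<open>K\<close>, and leaves half of \<open>card Miss\<close>.\<close>
  define e3 where "e3 = \<delta> / (2 ^ (k + 1) * (K + 1))"
  have e3: "0 < e3" using \<delta> K_nonneg by (simp add: e3_def)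
  obtain d3 where d3: "0 < d3" and full: "\<And>(X::'a set) \<B>. finite X \<Longrightarrow> \<B> \<subseteq> nsets X a \<Longrightarrow> real (card \<B>) \<le> d3 * real (card X) ^ a \<Longrightarrow>
     real (card {D \<in> nsets X (Suc a). nsets D a \<subseteq> \<B>}) \<le> e3 * real (card \<B>) * real (card X)"
    using few_full_sets[OF e3, of a] by blast
  \<comment> \<open>The first bound makes \<open>\<B>\<close> sparse enough for
    \<open>few_full_sets\<close>; the second keeps \<open>card BadB\<close> within
    \<open>c1 / 4 * n ^ p\<close>.\<close>
  define \<eta> where "\<eta> = min (\<delta> * d3 / (2 ^ k * 2 ^ a)) (c1 * c2 / (2 ^ (k + 3) * real (card V)))"
  have \<eta>_le: "\<eta> \<le> \<delta> * d3 / (2 ^ k * 2 ^ a)" "\<eta> \<le> c1 * c2 / (2 ^ (k + 3) * real (card V))"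
    unfolding \<eta>_def by (rule min.cobounded1, rule min.cobounded2)
  have \<eta>: "0 < \<eta>" using \<delta> d3 c V0 by (simp add: \<eta>_def)
  obtain n1 where stab: "\<And>(X::'a set) H. r_graph (a + b) X H \<Longrightarrow> \<not> contains_copy H T \<Longrightarrow> n1 \<le> card X \<Longrightarrow>
    real (card X choose (a + b)) - real ((card X - (card V - 1)) choose (a + b)) \<le> real (card H) \<Longrightarrow>
    (\<exists>L\<subseteq>X. card L = card V - 1 \<and>
      real (card {D \<in> nsets (X - L) k. \<exists>l\<in>L. insert l D \<notin> H}) \<le> \<eta> * real (card X) ^ k)"
    using stability[OF \<eta>] unfolding k_def by blast
  define n0 where "n0 = n1 + 2 * card V + 4 * ((a + b) + (a + b) * (card U + card V)) + 1"
  show ?thesis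
  proof (intro exI[of _ n0] allI impI)
    fix X :: "'a set" and H
    assume H: "r_graph (a + b) X H" and free: "\<not> contains_copy H T" and n0: "n0 \<le> card X"
      and cH: "(card X choose (a + b)) - ((card X - (card V - 1)) choose (a + b)) \<le> card H"
    note fin = r_graph_finite[OF H]
    let ?n = "real (card X)"
    have nn: "n1 \<le> card X" "2 * card V \<le> card X" "4 * ((a + b) + (a + b) * (card U + card V)) \<le> card X" "0 < card X"
      using n0 unfolding n0_def by linarith+
    have "real (card X choose (a + b)) - real ((card X - (card V - 1)) choose (a + b)) \<le> real (card H)"
      using cH by linarith
    then obtain L where L: "L \<subseteq> X" "card L = card V - 1"
      and miss: "real (card {D \<in> nsets (X - L) k. \<exists>l\<in>L. insert l D \<notin> H}) \<le> \<eta> * ?n ^ k"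
      using stab[OF H free nn(1)] by blast
    define Y where "Y = X - L"
    define Miss where "Miss = {D \<in> nsets Y k. \<exists>l\<in>L. insert l D \<notin> H}"
    have cMiss: "real (card Miss) \<le> \<eta> * ?n ^ k" using miss by (simp add: Miss_def Y_def)
    have fY: "finite Y" and fL: "finite L" using fin(1) L finite_subset by (auto simp: Y_def)
    have fns: "finite (nsets Y j)" for j using fY by (rule finite_imp_finite_nsets)
    have cY: "card Y \<le> card X" using fin(1) by (auto simp: Y_def intro: card_mono)
    have cYeq: "card Y = card X - card L" unfolding Y_def using fL L by (simp add: card_Diff_subset)
    then have cY2: "?n / 2 \<le> real (card Y)" using nn L by linarith
    have bigY: "2 * ((a + b) + (a + b) * (card U + card V)) \<le> card Y" using cY2 nn(3) by linarith
    have low: "(1 / (4 * real j)) ^ j * ?n ^ j \<le> (real (card Y) / (2 * real j)) ^ j" if "1 \<le> j" for j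
    proof -
      have "1 / (4 * real j) * ?n \<le> real (card Y) / (2 * real j)" using cY2 that by (simp add: field_simps)
      then show ?thesis unfolding power_mult_distrib[symmetric] by (rule power_mono) simp
    qed
    have Msub: "Miss \<subseteq> nsets Y (a + p)" "Miss \<subseteq> nsets Y (p + a)"
      unfolding Miss_def ab(1) by (auto simp: add.commute)
    define \<nu> where "\<nu> = c2 / (2 * real (card V)) * ?n ^ a"
    have \<nu>: "0 < \<nu>" using c V0 nn by (simp add: \<nu>_def)
    define BadB where "BadB = {B \<in> nsets Y p. \<nu> < real (card {A' \<in> nsets Y a. A' \<inter> B = {} \<and> A' \<union> B \<in> Miss})}"
    have cBadB: "real (card BadB) \<le> c1 / 4 * ?n ^ p"
    proof -
      have "\<nu> * real (card BadB) \<le> 2 ^ (p + a) * real (card Miss)"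
      proof (rule card_sets_extending_to[OF fY Msub(2)])
        show "\<nu> \<le> real (card {B \<in> nsets Y a. A \<inter> B = {} \<and> A \<union> B \<in> Miss})" if "A \<in> BadB" for A
          using that by (simp add: BadB_def Int_commute Un_commute)
      qed (use \<nu> in \<open>auto simp: BadB_def\<close>)
      also have "\<dots> \<le> 2 ^ k * (\<eta> * ?n ^ k)" unfolding ab(2)[symmetric] using cMiss by (rule mult_left_mono) simp
      also have "\<dots> \<le> 2 ^ k * (c1 * c2 / (2 ^ (k + 3) * real (card V)) * ?n ^ k)"
        using \<eta>_le(2) by (intro mult_left_mono mult_right_mono) auto
      also have "\<dots> = (c1 / 4 * ?n ^ p) * \<nu>"
        using V0 unfolding \<nu>_def ab(1) by (simp add: power_add field_simps)
      finally have "real (card BadB) * \<nu> \<le> (c1 / 4 * ?n ^ p) * \<nu>" by (simp only: mult.commute)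
      then show ?thesis by (rule mult_right_le_imp_le) (rule \<nu>)
    qed
    define \<B> where "\<B> = {A \<in> nsets Y a. \<delta> * ?n ^ p \<le> real (card {B \<in> nsets Y p. A \<inter> B = {} \<and> A \<union> B \<in> Miss})}"
    have cB: "\<delta> * ?n ^ p * real (card \<B>) \<le> 2 ^ k * real (card Miss)"
      unfolding ab(1) using \<delta> by (intro card_sets_extending_to[OF fY Msub(1)]) (auto simp: \<B>_def)
    define H0 where "H0 = {e\<in>H. e \<inter> L = {}}"
    have H0B: "nsets e a \<subseteq> \<B>" if e: "e \<in> H0" for e
    proof
      fix A assume A: "A \<in> nsets e a"
      have eH: "e \<in> H" "e \<inter> L = {}" using e by (auto simp: H0_def)
      have AY: "A \<in> nsets Y a" using A fin(5)[OF eH(1)] eH(2) by (auto simp: nsets_def Y_def)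
      show "A \<in> \<B>"
      proof (rule ccontr)
        assume "A \<notin> \<B>"
        then have lt: "real (card {B \<in> nsets Y p. A \<inter> B = {} \<and> A \<union> B \<in> Miss}) < \<delta> * ?n ^ p"
          using AY by (simp add: \<B>_def)
        have np: "0 < ?n ^ p" "0 < ?n ^ a" using nn by simp_all
        have "contains_copy H T"
        proof (rule copy_via_critical_leaf[OF x fin(1) L eH(1) fin(5)[OF eH(1)] fin(4)[OF eH(1)] eH(2)])
          show "A \<subseteq> e" "card A = a" using A by (auto simp: nsets_def)
          have "real (card {B \<in> nsets Y p. A \<inter> B = {} \<and> A \<union> B \<in> Miss}) + real (card BadB) < \<delta> * ?n ^ p + c1 / 4 * ?n ^ p"
            using lt cBadB by linarith
          also have "\<dots> \<le> c1 * ?n ^ p" using c np by (simp add: \<delta>_def)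
          also have "\<dots> \<le> (real (card Y) / (2 * real p)) ^ p" unfolding c1_def by (rule low[OF ab(5)])
          finally show "real (card {B \<in> nsets (X - L) (b - 1). A \<inter> B = {} \<and> A \<union> B \<in> {D \<in> nsets (X - L) (a + b - 1). \<exists>l\<in>L. insert l D \<notin> H}}) +
            real (card {B \<in> nsets (X - L) (b - 1). \<nu> < real (card {A' \<in> nsets (X - L) a. A' \<inter> B = {} \<and>
              A' \<union> B \<in> {D \<in> nsets (X - L) (a + b - 1). \<exists>l\<in>L. insert l D \<notin> H}})})
            < (real (card (X - L)) / (2 * real (b - 1))) ^ (b - 1)"
            unfolding BadB_def Miss_def Y_def p_def k_def .
          show "0 \<le> \<nu>" using \<nu> by simp
          have "real (card V) * \<nu> = c2 / 2 * ?n ^ a" using V0 by (simp add: \<nu>_def)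
          also have "\<dots> < c2 * ?n ^ a" using c np by simp
          also have "\<dots> \<le> (real (card Y) / (2 * real a)) ^ a" unfolding c2_def by (rule low[OF ab(6)])
          finally show "real (card V) * \<nu> < (real (card (X - L)) / (2 * real a)) ^ a" unfolding Y_def .
          show "2 * ((a + b) + (a + b) * (card U + card V)) \<le> card (X - L)" using bigY unfolding Y_def .
        qed
        then show False using free by simp
      qed
    qed
    have Bsub: "\<B> \<subseteq> nsets Y a" by (auto simp: \<B>_def)
    have cBsmall: "real (card \<B>) \<le> d3 * real (card Y) ^ a"
    proof -
      have "real (card \<B>) * (\<delta> * ?n ^ p) \<le> 2 ^ k * real (card Miss)"
        using cB by (simp only: mult.commute)
      also have "\<dots> \<le> 2 ^ k * (\<eta> * ?n ^ k)" using cMiss by (rule mult_left_mono) simp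
      also have "\<dots> \<le> 2 ^ k * (\<delta> * d3 / (2 ^ k * 2 ^ a) * ?n ^ k)"
        using \<eta>_le(1) by (intro mult_left_mono mult_right_mono) auto
      also have "\<dots> = (d3 * (?n / 2) ^ a) * (\<delta> * ?n ^ p)"
        unfolding ab(1) by (simp add: power_add power_divide)
      finally have "real (card \<B>) \<le> d3 * (?n / 2) ^ a"
        by (rule mult_right_le_imp_le) (use \<delta> nn in simp)
      also have "\<dots> \<le> d3 * real (card Y) ^ a" using cY2 d3 by (intro mult_left_mono power_mono) auto
      finally show ?thesis .
    qed
    have H0: "r_graph (a + b) Y H0" using H fY unfolding r_graph_def H0_def Y_def by auto
    have free0: "\<not> contains_copy H0 T" using free unfolding contains_copy_def H0_def by blast
    define Full where "Full = {G \<in> nsets Y (Suc a). nsets G a \<subseteq> \<B>}"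
    have fFull: "finite Full" using fns by (simp add: Full_def)
    define Sh where "Sh = (\<Union>e\<in>H0. nsets e k)"
    \<comment> \<open>Since \<open>k \<ge> a + 1\<close>, each shadow set of \<open>H0\<close>
      contains an \<open>(a + 1)\<close>-set all of whose \<open>a\<close>-subsets lie in
      \<open>\<B>\<close>, and \<open>p - 1\<close> further vertices. Counting \<open>H0\<close>
      itself in this way would lose a factor \<open>n\<close>, whereas passing to the shadow costs
      only the factor \<open>K\<close>.\<close>
    have "real (card Sh) \<le> real (card Full) * ?n ^ (p - 1)"
    proof (rule card_cover_le[OF fFull])
      show "Sh \<subseteq> (\<Union>G\<in>Full. (\<lambda>R. G \<union> R) ` nsets Y (p - 1))"
      proof
        fix D assume "D \<in> Sh"
        then obtain e where e: "e \<in> H0" "D \<in> nsets e k" by (auto simp: Sh_def)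
        have eY: "e \<subseteq> Y" using H0 e(1) by (auto simp: r_graph_def)
        have D: "D \<subseteq> e" "finite D" "card D = k" using e by (auto simp: nsets_def)
        have "Suc a \<le> card D" using D ab by simp
        then obtain G where G: "G \<subseteq> D" "card G = Suc a" "finite G" by (rule obtain_subset_with_card_n)
        have "nsets G a \<subseteq> nsets e a" using G D by (intro nsets_mono) auto
        then have "G \<in> Full" using H0B[OF e(1)] G D eY by (auto simp: Full_def nsets_def)
        moreover have "D - G \<in> nsets Y (p - 1)" using G D eY ab by (auto simp: nsets_def card_Diff_subset)
        moreover have "D = G \<union> (D - G)" using G by auto
        ultimately show "D \<in> (\<Union>G\<in>Full. (\<lambda>R. G \<union> R) ` nsets Y (p - 1))" by blast
      qed
      show "finite ((\<lambda>R. G \<union> R) ` nsets Y (p - 1))" for G using fns by simp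
      show "real (card ((\<lambda>R. G \<union> R) ` nsets Y (p - 1))) \<le> ?n ^ (p - 1)" for G
        using card_image_le[OF fns[of "p - 1"], of "\<lambda>R. G \<union> R"] real_card_nsets_le[OF fY cY, of "p - 1"] by linarith
    qed
    also have "\<dots> \<le> (e3 * real (card \<B>) * ?n) * ?n ^ (p - 1)"
    proof (rule mult_right_mono)
      have "real (card Full) \<le> e3 * real (card \<B>) * real (card Y)"
        unfolding Full_def by (rule full[OF fY Bsub cBsmall])
      also have "\<dots> \<le> e3 * real (card \<B>) * ?n" using cY e3 by (intro mult_left_mono) auto
      finally show "real (card Full) \<le> e3 * real (card \<B>) * ?n" .
    qed simp
    also have "\<dots> = e3 * real (card \<B>) * ?n ^ p" using ab(5) by (simp add: power_eq_if)
    finally have cSh: "real (card Sh) \<le> e3 * real (card \<B>) * ?n ^ p" .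
    have "real (card H0) \<le> K * real (card Sh)"
      using edges_le_shadow[OF H0 free0] unfolding Sh_def k_def .
    also have "\<dots> \<le> (K + 1) * (e3 * real (card \<B>) * ?n ^ p)"
      using cSh K_nonneg by (intro mult_mono) auto
    also have "\<dots> = ((K + 1) * e3) * (?n ^ p * real (card \<B>))" by (simp only: mult_ac)
    also have "\<dots> = (\<delta> * ?n ^ p * real (card \<B>)) / 2 ^ (k + 1)"
    proof -
      have "(K + 1) * e3 = \<delta> / 2 ^ (k + 1)" using K_nonneg by (simp add: e3_def)
      then show ?thesis by (simp only: times_divide_eq_left mult.assoc)
    qed
    also have "\<dots> \<le> (2 ^ k * real (card Miss)) / 2 ^ (k + 1)" using cB by (rule divide_right_mono) simp
    also have "\<dots> = real (card Miss) / 2" by simp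
    finally have H0M: "real (card H0) \<le> real (card Miss) / 2" .
    define PL where "PL = {e \<in> nsets X (a + b). e \<inter> L \<noteq> {}}"
    have fPL: "finite PL" using fin(1) by (simp add: PL_def finite_imp_finite_nsets)
    \<comment> \<open>A set in \<open>Miss\<close> is recovered from its missing edge by deleting
      \<open>L\<close>.\<close>
    have cMP: "card Miss \<le> card (PL - H)"
    proof -
      have "\<forall>D\<in>Miss. \<exists>l. l \<in> L \<and> insert l D \<notin> H" by (auto simp: Miss_def)
      then obtain l where l: "\<And>D. D \<in> Miss \<Longrightarrow> l D \<in> L \<and> insert (l D) D \<notin> H" by metis
      show ?thesis
      proof (rule card_inj_on_le[where f = "\<lambda>D. insert (l D) D"])
        have DL: "D \<inter> L = {}" if "D \<in> Miss" for D using that by (auto simp: Miss_def nsets_def Y_def)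
        show "inj_on (\<lambda>D. insert (l D) D) Miss"
        proof (rule inj_onI)
          fix D D' assume D: "D \<in> Miss" "D' \<in> Miss" "insert (l D) D = insert (l D') D'"
          have "insert (l D) D - L = D" "insert (l D') D' - L = D'"
            using l[OF D(1)] l[OF D(2)] DL[OF D(1)] DL[OF D(2)] by auto
          then show "D = D'" using D(3) by metis
        qed
        show "(\<lambda>D. insert (l D) D) ` Miss \<subseteq> PL - H"
        proof
          fix e assume "e \<in> (\<lambda>D. insert (l D) D) ` Miss"
          then obtain D where D: "D \<in> Miss" "e = insert (l D) D" by auto
          have "D \<subseteq> X" "finite D" "card D = k" using D by (auto simp: Miss_def nsets_def Y_def)
          moreover have "l D \<notin> D" "l D \<in> X" using l[OF D(1)] DL[OF D(1)] L by auto
          ultimately show "e \<in> PL - H" using l[OF D(1)] D(2) ab(3) by (auto simp: PL_def nsets_def)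
        qed
      qed (use fPL in simp)
    qed
    have "card (PL - H) \<le> card H0"
    proof -
      have "H = (PL \<inter> H) \<union> H0" using fin(3,4,5) by (auto simp: PL_def H0_def nsets_def)
      moreover have "(PL \<inter> H) \<inter> H0 = {}" by (auto simp: PL_def H0_def)
      moreover have "finite (PL \<inter> H)" "finite H0" using fPL fin(2) by (auto simp: H0_def)
      ultimately have "card H = card (PL \<inter> H) + card H0" by (metis card_Un_disjoint)
      moreover have "card PL = card (PL \<inter> H) + card (PL - H)"
        using fPL by (metis card_Int_Diff)
      moreover have "card PL \<le> card H"
        using cH card_nsets_meeting[OF fin(1) L(1), of "a + b"] L(2) unfolding PL_def by simp
      ultimately show ?thesis by linarith
    qed
    then have "card H0 = 0" "card (PL - H) = 0" using H0M cMP by linarith+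
    then have "H0 = {}" "PL - H = {}" using fin(2) fPL by (auto simp: H0_def)
    moreover have "H \<subseteq> PL \<union> H0" using fin(3,4,5) by (auto simp: PL_def H0_def nsets_def)
    ultimately have "H = PL" by auto
    then show "\<exists>L\<subseteq>X. card L = card V - 1 \<and> H = {e \<in> nsets X (a + b). e \<inter> L \<noteq> {}}"
      using L unfolding PL_def by blast
  qed
qed

end

section \<open>Uniqueness up to isomorphism, and the theorem\<close>

lemma finite_isomorphism_extending:
  assumes "finite X" "L \<subseteq> X" "L' \<subseteq> X" "card L = card L'"
  obtains f where "bij_betw f X X" "f ` L = L'"
proof -
  have fin: "finite L" "finite L'" using assms finite_subset by auto
  obtain g where g: "bij_betw g L L'" using finite_same_card_bij[OF fin assms(4)] by blast
  have "card (X - L) = card (X - L')" using assms fin by (simp add: card_Diff_subset)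
  then obtain h where h: "bij_betw h (X - L) (X - L')" using finite_same_card_bij[of "X - L" "X - L'"] assms(1) by blast
  define f where "f y = (if y \<in> L then g y else h y)" for y
  have "bij_betw f L L'" using g by (simp add: f_def cong: bij_betw_cong)
  moreover have "bij_betw f (X - L) (X - L')" using h by (rule bij_betw_cong[THEN iffD1, rotated]) (simp add: f_def)
  ultimately have "bij_betw f (L \<union> (X - L)) (L' \<union> (X - L'))" by (rule bij_betw_combine) auto
  then have "bij_betw f X X" using assms by (simp add: Un_absorb1)
  moreover have "f ` L = L'" using \<open>bij_betw f L L'\<close> by (simp add: bij_betw_def)
  ultimately show ?thesis by (rule that)
qed

lemma isomorphic_Psi:
  assumes "L \<subseteq> {1..n}" "card L = c" and H: "H = {e \<in> nsets {1..n} r. e \<inter> L \<noteq> {}}"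
  shows "isomorphic_on {1..n} H {1..n} (Psi c n r)"
proof -
  have "c \<le> n" using assms(1,2) card_mono[of "{1..n}" L] by simp
  then obtain f where f: "bij_betw f {1..n} {1..n}" "f ` L = {1..c}"
    using finite_isomorphism_extending[of "{1..n}" L "{1..c}"] assms by auto
  have inj: "inj_on f {1..n}" using f(1) by (simp add: bij_betw_def)
  have sub: "f ` e \<subseteq> {1..n}" "card (f ` e) = card e" "f ` (e \<inter> L) = f ` e \<inter> {1..c}" if "e \<subseteq> {1..n}" for e
  proof -
    show "f ` e \<subseteq> {1..n}" using f(1) that by (auto simp: bij_betw_def)
    show "card (f ` e) = card e" by (rule card_image[OF inj_on_subset[OF inj that]])
    show "f ` (e \<inter> L) = f ` e \<inter> {1..c}" using inj_on_image_Int[OF inj that assms(1)] f(2) by simp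
  qed
  have "(\<lambda>e. f ` e) ` H = Psi c n r"
  proof
    show "(\<lambda>e. f ` e) ` H \<subseteq> Psi c n r"
    proof
      fix d assume "d \<in> (\<lambda>e. f ` e) ` H"
      then obtain e where e: "e \<subseteq> {1..n}" "card e = r" "e \<inter> L \<noteq> {}" "d = f ` e" by (auto simp: H nsets_def)
      have "f ` (e \<inter> L) \<noteq> {}" using e(3) by blast
      then show "d \<in> Psi c n r" using sub[OF e(1)] e unfolding Psi_def by auto
    qed
    show "Psi c n r \<subseteq> (\<lambda>e. f ` e) ` H"
    proof
      fix d assume d: "d \<in> Psi c n r"
      define e where "e = {y\<in>{1..n}. f y \<in> d}"
      have e: "e \<subseteq> {1..n}" by (auto simp: e_def)
      have fe: "f ` e = d"
      proof -
        have "d \<subseteq> f ` {1..n}" using d f(1) by (auto simp: Psi_def bij_betw_def)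
        then show ?thesis by (auto simp: e_def)
      qed
      have "f ` (e \<inter> L) \<noteq> {}" using sub(3)[OF e] fe d by (auto simp: Psi_def)
      moreover have "card e = r" using sub(2)[OF e] fe d by (simp add: Psi_def)
      ultimately have "e \<in> H" using e unfolding H nsets_def by (auto intro: finite_subset)
      then show "d \<in> (\<lambda>e. f ` e) ` H" using fe by blast
    qed
  qed
  then show ?thesis using f(1) unfolding isomorphic_on_def by blast
qed

lemma Psi_eq_nsets:
  assumes "0 < r" shows "Psi c n r = {e \<in> nsets {1..n} r. e \<inter> {1..c} \<noteq> {}}"
  by (auto simp: Psi_def nsets_def intro: finite_subset)

text \<open>The vertices that a copy maps into \<open>{1..c}\<close> form a cover of
  \<open>F\<close> with at most \<open>c\<close> elements.\<close>

lemma Psi_free: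
  assumes fin: "finite (\<Union>F)" and c: "c < cover_number F"
  shows "\<not> contains_copy (Psi c n r) F"
proof
  assume "contains_copy (Psi c n r) F"
  then obtain f where f: "inj_on f (\<Union>F)" "\<And>e. e \<in> F \<Longrightarrow> f ` e \<in> Psi c n r" unfolding contains_copy_def by blast
  define C where "C = {y\<in>\<Union>F. f y \<in> {1..c}}"
  have C: "C \<subseteq> \<Union>F" by (auto simp: C_def)
  moreover have "finite C" using finite_subset[OF C fin] .
  moreover have "C \<inter> e \<noteq> {}" if "e \<in> F" for e
  proof -
    have "f ` e \<inter> {1..c} \<noteq> {}" using f(2)[OF that] by (simp add: Psi_def)
    then show ?thesis using that by (auto simp: C_def)
  qed
  ultimately have "cover_number F \<le> card C" unfolding cover_number_def by (intro Least_le) blast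
  moreover have "card C \<le> card {1..c}"
    by (rule card_inj_on_le[OF inj_on_subset[OF f(1)]]) (auto simp: C_def)
  ultimately show False using c by simp
qed

theorem theorem3:
  fixes U V :: "'v set" and E :: "'v set set" and r s t a b :: nat
  assumes "5 \<le> r" and "2 \<le> t" and "t \<le> s"
    and "a + b = r" and "b < a" and "a < r - 1"
    and "is_tree (U \<union> V) E" and "bipartition U V (U \<union> V) E"
    and "card U = s" and "card V = t"
    and "\<exists>x\<in>V. vertex_degree E x = 1"
  shows "\<forall>\<^sub>F n in sequentially.
      ex_turan r n (blowup U V E a b) \<le> (n choose r) - ((n - t + 1) choose r) \<and>
      (cover_number (blowup U V E a b) = t \<longrightarrow>
        ex_turan r n (blowup U V E a b) = (n choose r) - ((n - t + 1) choose r) \<and>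
        (r_graph r {1..n} (Psi (t - 1) n r) \<and>
         \<not> contains_copy (Psi (t - 1) n r) (blowup U V E a b) \<and>
         card (Psi (t - 1) n r) = (n choose r) - ((n - t + 1) choose r)) \<and>
        (\<forall>H :: nat set set.
           r_graph r {1..n} H \<and> \<not> contains_copy H (blowup U V E a b) \<and>
           card H = (n choose r) - ((n - t + 1) choose r) \<longrightarrow>
           isomorphic_on {1..n} H {1..n} (Psi (t - 1) n r)))"
proof -
  let ?T = "blowup U V E a b"
  \<comment> \<open>\<open>2 \<le> b\<close> follows from \<open>a + b = r\<close> and
    \<open>a < r - 1\<close>; both parts are nonempty by \<open>2 \<le> t\<close> and
    \<open>t \<le> s\<close>.\<close>
  interpret blowup_tree U V E a b
    using assms by unfold_locales auto
  obtain x where x: "x \<in> V" "vertex_degree E x = 1" using assms(11) by blast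
  obtain n0 where n0: "\<And>(X::nat set) H. r_graph r X H \<Longrightarrow> \<not> contains_copy H ?T \<Longrightarrow> n0 \<le> card X \<Longrightarrow>
    (card X choose r) - ((card X - (t - 1)) choose r) \<le> card H \<Longrightarrow>
    (\<exists>L\<subseteq>X. card L = t - 1 \<and> H = {e \<in> nsets X r. e \<inter> L \<noteq> {}})"
    using extremal_structure[OF x] assms(4,10) by blast
  have fT: "finite (\<Union>?T)"
  proof -
    have "\<Union>?T \<subseteq> (U \<times> {..<a}) \<union> (V \<times> {..<b})" by (auto simp: blowup_def)
    then show ?thesis using finite_UV finite_subset by blast
  qed
  have neT: "?T \<noteq> {}"
  proof -
    have "{e\<in>E. x \<in> e} \<noteq> {}" using x(2) unfolding vertex_degree_def by (metis card.empty zero_neq_one)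
    then obtain e where e: "e \<in> E" by blast
    moreover have "\<forall>e\<in>E. \<exists>u\<in>U. \<exists>v\<in>V. e = {u, v}" using assms(8) by (simp add: bipartition_def)
    ultimately obtain u v where uv: "u \<in> U" "v \<in> V" "e = {u, v}" by blast
    then show ?thesis using e by (auto simp: blowup_def)
  qed
  show ?thesis
    unfolding eventually_sequentially
  proof (intro exI[of _ "n0 + t"] allI impI)
    fix n assume n: "n0 + t \<le> n"
    let ?m = "(n choose r) - ((n - t + 1) choose r)"
    \<comment> \<open>With truncated subtraction this rests on \<open>t \<le> n\<close>, which is
      why \<open>t\<close> is added to \<open>n0\<close>.\<close>
    have nt: "n - t + 1 = n - (t - 1)" using n assms(2) by simp
    have struct: "\<exists>L\<subseteq>{1..n}. card L = t - 1 \<and> H = {e \<in> nsets {1..n} r. e \<inter> L \<noteq> {}}"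
      if "r_graph r {1..n} H" "\<not> contains_copy H ?T" "?m \<le> card H" for H
      using n0[OF that(1,2)] n that(3) nt by simp
    have cle: "card H \<le> ?m" if hyp: "r_graph r {1..n} H" "\<not> contains_copy H ?T" for H
    proof (rule ccontr)
      assume "\<not> card H \<le> ?m"
      moreover then obtain L where L: "L \<subseteq> {1..n}" "card L = t - 1" "H = {e \<in> nsets {1..n} r. e \<inter> L \<noteq> {}}"
        using struct[OF hyp] by auto
      moreover have "card H = ?m" using card_nsets_meeting[of "{1..n}" L r] L nt by simp
      ultimately show False by simp
    qed
    \<comment> \<open>\<open>Max\<close> is meaningful on this set: its elements are at most
      \<open>?m\<close>, and it contains 0 because \<open>?T\<close> has an edge, so the empty
      family contains no copy.\<close>
    define S where "S = {card H | H. r_graph r {1..n} H \<and> \<not> contains_copy H ?T}"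
    have exS: "ex_turan r n ?T = Max S" by (simp add: ex_turan_def S_def)
    have S_le: "c \<le> ?m" if "c \<in> S" for c
      using that cle unfolding S_def by blast
    then have fS: "finite S" by (intro finite_subset[of S "{..?m}"]) auto
    have "r_graph r {1..n} {}" "\<not> contains_copy ({} :: nat set set) ?T"
      using neT by (auto simp: r_graph_def contains_copy_def)
    then have neS: "S \<noteq> {}" unfolding S_def by blast
    have upper: "ex_turan r n ?T \<le> ?m"
      unfolding exS by (rule S_le[OF Max_in[OF fS neS]])
    have Psi: "r_graph r {1..n} (Psi (t - 1) n r)" "card (Psi (t - 1) n r) = ?m"
    proof -
      show "r_graph r {1..n} (Psi (t - 1) n r)" by (auto simp: r_graph_def Psi_def)
      have "{1..t - 1} \<subseteq> {1..n}" using n by auto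
      then show "card (Psi (t - 1) n r) = ?m"
        using card_nsets_meeting[of "{1..n}" "{1..t - 1}" r] Psi_eq_nsets[of r "t - 1" n] assms(1) nt by simp
    qed
    have "ex_turan r n ?T = ?m" "\<not> contains_copy (Psi (t - 1) n r) ?T" if "cover_number ?T = t"
    proof -
      show free: "\<not> contains_copy (Psi (t - 1) n r) ?T"
        by (rule Psi_free[OF fT]) (use that assms(2) in simp)
      then have "?m \<in> S" using Psi unfolding S_def by force
      then show "ex_turan r n ?T = ?m" using upper Max_ge[OF fS] unfolding exS by (simp add: le_antisym)
    qed
    moreover have "isomorphic_on {1..n} H {1..n} (Psi (t - 1) n r)"
      if hyp: "r_graph r {1..n} H" "\<not> contains_copy H ?T" "card H = ?m" for H :: "nat set set"
    proof -
      obtain L where L: "L \<subseteq> {1..n}" "card L = t - 1" "H = {e \<in> nsets {1..n} r. e \<inter> L \<noteq> {}}"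
        using struct[OF hyp(1,2) eq_imp_le[OF hyp(3)[symmetric]]] by blast
      then show ?thesis by (rule isomorphic_Psi)
    qed
    ultimately show "ex_turan r n ?T \<le> ?m \<and> (cover_number ?T = t \<longrightarrow> ex_turan r n ?T = ?m \<and>
        (r_graph r {1..n} (Psi (t - 1) n r) \<and> \<not> contains_copy (Psi (t - 1) n r) ?T \<and> card (Psi (t - 1) n r) = ?m) \<and>
        (\<forall>H :: nat set set. r_graph r {1..n} H \<and> \<not> contains_copy H ?T \<and> card H = ?m \<longrightarrow>
           isomorphic_on {1..n} H {1..n} (Psi (t - 1) n r)))"
      using upper Psi by blast
  qed
qed

end
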